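(* The following holds in $\mathsf{ZF}$ (Zermelo--Fraenkel set theory, without the axiom of choice). Let $\Sigma$ be a first-order signature. A class $\mathcal{K}$ of $\Sigma$-structures is axiomatized by a set of basic Horn formulas if and only if $\mathcal{K}$ is closed under isomorphisms, substructures, and reduced products.
   Context: The background theory is $\mathsf{ZF}$; the axiom of choice may not be used. A first-order signature $\Sigma$ is a set of relation and function symbols, each having a fixed finite arity (constants are $0$-ary function symbols). Formulas are those of first-order logic with equality; atomic formulas are equations between terms and formulas $r(t_1,\dots,t_n)$ with $r$ a relation symbol of $\Sigma$. Structures have nonempty domain, as is customary in first-order logic. For a $\Sigma$-structure $A$ and a formula $\phi$, $A\models\phi$ means that $\phi$ is satisfied in $A$ under every assignment of elements of $A$ to its free variables. A basic Horn formula is a formula $\phi_0\vee\cdots\vee\phi_n$ ($n\geqslant 0$) where at most one of the $\phi_i$ is an atomic formula, the rest being negations of atomic formulas. A class $\mathcal{K}$ of $\Sigma$-structures is axiomatized by a set $\Gamma$ of formulas if $\mathcal{K}$ is the class of all $\Sigma$-structures satisfying every formula in $\Gamma$. Given a family $\langle A_i\rangle_{i\in I}$ of $\Sigma$-structures (with $I$ a set) and a (proper) filter $\mathcal{F}$ over $I$, the reduced product $\prod_{\mathcal{F}}A_i$ is the structure whose domain is the set of classes $\bar a/\mathcal{F}$ of elements $\bar a\in\prod_{i\in I}A_i$ under the equivalence $\bar a\sim\bar b\iff\{i\in I\mid\bar a(i)=\bar b(i)\}\in\mathcal{F}$, with function symbols interpreted coordinatewise on representatives, and $r(\bar a_1/\mathcal{F},\dots,\bar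 a_n/\mathcal{F})$ holding iff $\{i\in I\mid r^{A_i}(\bar a_1(i),\dots,\bar a_n(i))\}\in\mathcal{F}$. (Since choice is not assumed, $\prod_{i\in I}A_i$ might be empty; reduced products are considered only when it is nonempty.) $\mathcal{K}$ is closed under isomorphisms (substructures, reduced products) if every structure isomorphic to a member of $\mathcal{K}$ (every substructure of a member of $\mathcal{K}$, every reduced product of a family of members of $\mathcal{K}$) belongs to $\mathcal{K}$. *)

theory Defs
  imports Main
begin

text \<open>
  ``Holds in ZF'' is rendered as ``holds in every model of ZF''. A model is an arbitrary type
  equipped with a binary relation satisfying the first-order axioms of ZF; separation and
  replacement are schemas over formulas of the language of set theory, so the choice operator of
  the metalogic does not make the axiom of choice true in the model. Signatures, structures,
  formulas, sequences, filters and natural numbers below are elements of the model (in particular,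
  arities and lengths of formulas are natural numbers in the sense of the model), and every notion
  about them is expressed by quantifying over elements of the model only. As usual in ZF, classes
  are given by formulas of set theory with parameters.
\<close>

datatype set_fm = SMem nat nat | SEq nat nat | SNot set_fm | SAnd set_fm set_fm | SEx nat set_fm

primrec holds :: "('v \<Rightarrow> 'v \<Rightarrow> bool) \<Rightarrow> (nat \<Rightarrow> 'v) \<Rightarrow> set_fm \<Rightarrow> bool" where
  "holds mem s (SMem i j) \<longleftrightarrow> mem (s i) (s j)"
| "holds mem s (SEq i j) \<longleftrightarrow> s i = s j"
| "holds mem s (SNot \<phi>) \<longleftrightarrow> \<not> holds mem s \<phi>"
| "holds mem s (SAnd \<phi> \<psi>) \<longleftrightarrow> holds mem s \<phi> \<and> holds mem s \<psi>"
| "holds mem s (SEx i \<phi>) \<longleftrightarrow> (\<exists>x. holds mem (s(i := x)) \<phi>)"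

locale membership =
  fixes mem :: "'v \<Rightarrow> 'v \<Rightarrow> bool"
begin

definition elts :: "'v \<Rightarrow> 'v set" where
  "elts a = {x. mem x a}"

definition definable_class :: "'v set \<Rightarrow> bool" where
  "definable_class K \<longleftrightarrow> (\<exists>\<phi> s. \<forall>x. x \<in> K \<longleftrightarrow> holds mem (s(0 := x)) \<phi>)"

end

locale ZF_model = membership mem for mem :: "'v \<Rightarrow> 'v \<Rightarrow> bool" +
  assumes extensionality: "\<forall>a b. (\<forall>x. mem x a \<longleftrightarrow> mem x b) \<longrightarrow> a = b"
    and foundation: "\<forall>a. (\<exists>x. mem x a) \<longrightarrow> (\<exists>x. mem x a \<and> (\<forall>y. mem y x \<longrightarrow> \<not> mem y a))"
    and pairing: "\<forall>a b. \<exists>c. \<forall>x. mem x c \<longleftrightarrow> x = a \<or> x = b"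
    and union: "\<forall>a. \<exists>u. \<forall>x. mem x u \<longleftrightarrow> (\<exists>y. mem y a \<and> mem x y)"
    and powerset: "\<forall>a. \<exists>p. \<forall>x. mem x p \<longleftrightarrow> (\<forall>y. mem y x \<longrightarrow> mem y a)"
    and infinity: "\<exists>w. (\<exists>e. mem e w \<and> (\<forall>x. \<not> mem x e)) \<and>
      (\<forall>x. mem x w \<longrightarrow> (\<exists>y. mem y w \<and> (\<forall>z. mem z y \<longleftrightarrow> mem z x \<or> z = x)))"
    and separation: "\<forall>\<phi> s a. \<exists>b. \<forall>x. mem x b \<longleftrightarrow> mem x a \<and> holds mem (s(0 := x)) \<phi>"
    and replacement: "\<forall>\<phi> s a.
      (\<forall>x. mem x a \<longrightarrow> (\<exists>!y. holds mem (s(0 := x, 1 := y)) \<phi>)) \<longrightarrow>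
      (\<exists>b. \<forall>y. mem y b \<longleftrightarrow> (\<exists>x. mem x a \<and> holds mem (s(0 := x, 1 := y)) \<phi>))"

context membership
begin

text \<open>
  \<open>mkset X\<close> is the element of the model with extension \<open>X\<close>. It is meaningful only if there is
  such an element; in a model of ZF this is the case wherever it is used below.
\<close>

definition mkset :: "'v set \<Rightarrow> 'v" where
  "mkset X = (THE a. elts a = X)"

definition opair :: "'v \<Rightarrow> 'v \<Rightarrow> 'v" where
  "opair a b = mkset {mkset {a}, mkset {a, b}}"

definition pfst :: "'v \<Rightarrow> 'v" where
  "pfst p = (THE a. \<exists>b. p = opair a b)"

definition psnd :: "'v \<Rightarrow> 'v" where
  "psnd p = (THE b. \<exists>a. p = opair a b)"

definition succ :: "'v \<Rightarrow> 'v" where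
  "succ a = mkset (insert a (elts a))"

definition omega :: 'v where
  "omega = mkset {n. \<forall>w. mkset {} \<in> elts w \<and> (\<forall>x\<in>elts w. succ x \<in> elts w) \<longrightarrow> n \<in> elts w}"

primrec num :: "nat \<Rightarrow> 'v" where
  "num 0 = mkset {}"
| "num (Suc k) = succ (num k)"

definition func_on :: "'v \<Rightarrow> 'v \<Rightarrow> bool" where
  "func_on f X \<longleftrightarrow> (\<forall>p\<in>elts f. \<exists>x\<in>elts X. \<exists>y. p = opair x y) \<and>
    (\<forall>x\<in>elts X. \<exists>!y. opair x y \<in> elts f)"

definition app :: "'v \<Rightarrow> 'v \<Rightarrow> 'v" (infixl "\<cdot>" 90) where
  "f \<cdot> x = (THE y. opair x y \<in> elts f)"

definition dom :: "'v \<Rightarrow> 'v" where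
  "dom f = mkset {x. \<exists>y. opair x y \<in> elts f}"

definition maps :: "'v \<Rightarrow> 'v \<Rightarrow> 'v \<Rightarrow> bool" where
  "maps f X Y \<longleftrightarrow> func_on f X \<and> (\<forall>x\<in>elts X. f \<cdot> x \<in> elts Y)"

definition lam :: "'v \<Rightarrow> ('v \<Rightarrow> 'v) \<Rightarrow> 'v" where
  "lam X g = mkset {opair x (g x) | x. x \<in> elts X}"

text \<open>\<open>n\<close>-tuples are functions on the von Neumann numeral \<open>n\<close>, so \<open>funspace n D\<close> is the set of
  \<open>n\<close>-tuples from \<open>D\<close>.\<close>

definition funspace :: "'v \<Rightarrow> 'v \<Rightarrow> 'v" where
  "funspace X Y = mkset {f. maps f X Y}"


subsection \<open>Signatures and structures\<close>

text \<open>A signature is the pair of the arity functions on its relation and function symbols.\<close>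

definition rel_ar :: "'v \<Rightarrow> 'v" where "rel_ar S = pfst S"
definition fun_ar :: "'v \<Rightarrow> 'v" where "fun_ar S = psnd S"
definition rel_syms :: "'v \<Rightarrow> 'v" where "rel_syms S = dom (rel_ar S)"
definition fun_syms :: "'v \<Rightarrow> 'v" where "fun_syms S = dom (fun_ar S)"

definition is_signature :: "'v \<Rightarrow> bool" where
  "is_signature S \<longleftrightarrow> S = opair (rel_ar S) (fun_ar S) \<and>
    maps (rel_ar S) (rel_syms S) omega \<and> maps (fun_ar S) (fun_syms S) omega"

definition mkstruct :: "'v \<Rightarrow> 'v \<Rightarrow> 'v \<Rightarrow> 'v" where
  "mkstruct D R G = opair D (opair R G)"

definition carrier :: "'v \<Rightarrow> 'v" where "carrier A = pfst A"
definition rels :: "'v \<Rightarrow> 'v" where "rels A = pfst (psnd A)"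
definition funs :: "'v \<Rightarrow> 'v" where "funs A = psnd (psnd A)"

definition is_structure :: "'v \<Rightarrow> 'v \<Rightarrow> bool" where
  "is_structure S A \<longleftrightarrow> A = mkstruct (carrier A) (rels A) (funs A) \<and>
    elts (carrier A) \<noteq> {} \<and>
    func_on (rels A) (rel_syms S) \<and>
    (\<forall>r\<in>elts (rel_syms S). elts (rels A \<cdot> r) \<subseteq> elts (funspace (rel_ar S \<cdot> r) (carrier A))) \<and>
    func_on (funs A) (fun_syms S) \<and>
    (\<forall>f\<in>elts (fun_syms S). maps (funs A \<cdot> f) (funspace (fun_ar S \<cdot> f) (carrier A)) (carrier A))"


subsection \<open>Terms and formulas\<close>

definition Var :: "'v \<Rightarrow> 'v" where "Var n = opair (num 0) n"
definition Fn :: "'v \<Rightarrow> 'v \<Rightarrow> 'v" where "Fn f ts = opair (num 1) (opair f ts)"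

definition terms :: "'v \<Rightarrow> 'v" where
  "terms S = mkset {t. \<forall>X.
    (\<forall>n\<in>elts omega. Var n \<in> elts X) \<and>
    (\<forall>f\<in>elts (fun_syms S). \<forall>ts. maps ts (fun_ar S \<cdot> f) X \<longrightarrow> Fn f ts \<in> elts X)
    \<longrightarrow> t \<in> elts X}"

definition Eq :: "'v \<Rightarrow> 'v \<Rightarrow> 'v" where "Eq t u = opair (num 0) (opair t u)"
definition Rel :: "'v \<Rightarrow> 'v \<Rightarrow> 'v" where "Rel r ts = opair (num 1) (opair r ts)"
definition Neg :: "'v \<Rightarrow> 'v" where "Neg \<phi> = opair (num 2) \<phi>"
definition Disj :: "'v \<Rightarrow> 'v \<Rightarrow> 'v" where "Disj \<phi> \<psi> = opair (num 3) (opair \<phi> \<psi>)"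
definition Exists :: "'v \<Rightarrow> 'v \<Rightarrow> 'v" where "Exists n \<phi> = opair (num 4) (opair n \<phi>)"

definition is_atomic :: "'v \<Rightarrow> 'v \<Rightarrow> bool" where
  "is_atomic S \<phi> \<longleftrightarrow>
    (\<exists>t\<in>elts (terms S). \<exists>u\<in>elts (terms S). \<phi> = Eq t u) \<or>
    (\<exists>r\<in>elts (rel_syms S). \<exists>ts. maps ts (rel_ar S \<cdot> r) (terms S) \<and> \<phi> = Rel r ts)"

definition formulas :: "'v \<Rightarrow> 'v" where
  "formulas S = mkset {\<phi>. \<forall>X.
    (\<forall>\<psi>. is_atomic S \<psi> \<longrightarrow> \<psi> \<in> elts X) \<and>
    (\<forall>\<psi>\<in>elts X. Neg \<psi> \<in> elts X) \<and>
    (\<forall>\<psi>\<in>elts X. \<forall>\<chi>\<in>elts X. Disj \<psi> \<chi> \<in> elts X) \<and>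
    (\<forall>n\<in>elts omega. \<forall>\<psi>\<in>elts X. Exists n \<psi> \<in> elts X)
    \<longrightarrow> \<phi> \<in> elts X}"

text \<open>Disjunctions of several formulas associate to the left: here \<open>g \<cdot> i\<close> is the
  disjunction of \<open>l \<cdot> 0, \<dots>, l \<cdot> i\<close>.\<close>

definition is_basic_Horn :: "'v \<Rightarrow> 'v \<Rightarrow> bool" where
  "is_basic_Horn S \<phi> \<longleftrightarrow> (\<exists>n\<in>elts omega. \<exists>l g.
    func_on l (succ n) \<and> func_on g (succ n) \<and>
    g \<cdot> num 0 = l \<cdot> num 0 \<and>
    (\<forall>i\<in>elts n. g \<cdot> succ i = Disj (g \<cdot> i) (l \<cdot> succ i)) \<and>
    \<phi> = g \<cdot> n \<and>
    (\<forall>i\<in>elts (succ n). is_atomic S (l \<cdot> i) \<or> (\<exists>\<psi>. is_atomic S \<psi> \<and> l \<cdot> i = Neg \<psi>)) \<and>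
    (\<forall>i\<in>elts (succ n). \<forall>j\<in>elts (succ n).
      is_atomic S (l \<cdot> i) \<and> is_atomic S (l \<cdot> j) \<longrightarrow> i = j))"


subsection \<open>Satisfaction\<close>

definition assignments :: "'v \<Rightarrow> 'v" where
  "assignments A = funspace omega (carrier A)"

definition update :: "'v \<Rightarrow> 'v \<Rightarrow> 'v \<Rightarrow> 'v" where
  "update e n d = lam omega (\<lambda>m. if m = n then d else e \<cdot> m)"

definition eval :: "'v \<Rightarrow> 'v \<Rightarrow> 'v \<Rightarrow> 'v \<Rightarrow> 'v" where
  "eval S A e t = (THE v. func_on v (terms S) \<and>
    (\<forall>n\<in>elts omega. v \<cdot> Var n = e \<cdot> n) \<and>
    (\<forall>f\<in>elts (fun_syms S). \<forall>ts. maps ts (fun_ar S \<cdot> f) (terms S) \<longrightarrow>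
      v \<cdot> Fn f ts = funs A \<cdot> f \<cdot> lam (fun_ar S \<cdot> f) (\<lambda>k. v \<cdot> (ts \<cdot> k)))) \<cdot> t"

text \<open>\<open>sat_sets S A\<close> maps each formula to the set of assignments satisfying it.\<close>

definition sat_sets :: "'v \<Rightarrow> 'v \<Rightarrow> 'v" where
  "sat_sets S A = (THE T. func_on T (formulas S) \<and>
    (\<forall>\<phi>\<in>elts (formulas S). elts (T \<cdot> \<phi>) \<subseteq> elts (assignments A)) \<and>
    (\<forall>e\<in>elts (assignments A).
      (\<forall>t\<in>elts (terms S). \<forall>u\<in>elts (terms S).
        e \<in> elts (T \<cdot> Eq t u) \<longleftrightarrow> eval S A e t = eval S A e u) \<and>
      (\<forall>r\<in>elts (rel_syms S). \<forall>ts. maps ts (rel_ar S \<cdot> r) (terms S) \<longrightarrow>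
        (e \<in> elts (T \<cdot> Rel r ts) \<longleftrightarrow>
          lam (rel_ar S \<cdot> r) (\<lambda>k. eval S A e (ts \<cdot> k)) \<in> elts (rels A \<cdot> r))) \<and>
      (\<forall>\<phi>\<in>elts (formulas S). e \<in> elts (T \<cdot> Neg \<phi>) \<longleftrightarrow> e \<notin> elts (T \<cdot> \<phi>)) \<and>
      (\<forall>\<phi>\<in>elts (formulas S). \<forall>\<psi>\<in>elts (formulas S).
        e \<in> elts (T \<cdot> Disj \<phi> \<psi>) \<longleftrightarrow> e \<in> elts (T \<cdot> \<phi>) \<or> e \<in> elts (T \<cdot> \<psi>)) \<and>
      (\<forall>n\<in>elts omega. \<forall>\<phi>\<in>elts (formulas S).
        e \<in> elts (T \<cdot> Exists n \<phi>) \<longleftrightarrow>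
          (\<exists>d\<in>elts (carrier A). update e n d \<in> elts (T \<cdot> \<phi>)))))"

text \<open>Assignments are total on the variables; as carriers are nonempty, every assignment to the
  free variables of a formula extends to a total one.\<close>

definition models :: "'v \<Rightarrow> 'v \<Rightarrow> 'v \<Rightarrow> bool" where
  "models S A \<phi> \<longleftrightarrow> (\<forall>e\<in>elts (assignments A). e \<in> elts (sat_sets S A \<cdot> \<phi>))"

definition axiomatized_by :: "'v \<Rightarrow> 'v set \<Rightarrow> 'v \<Rightarrow> bool" where
  "axiomatized_by S K \<Gamma> \<longleftrightarrow> K = {A. is_structure S A \<and> (\<forall>\<phi>\<in>elts \<Gamma>. models S A \<phi>)}"


subsection \<open>Closure properties\<close>

definition is_isomorphism :: "'v \<Rightarrow> 'v \<Rightarrow> 'v \<Rightarrow> 'v \<Rightarrow> bool" where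
  "is_isomorphism S h A B \<longleftrightarrow>
    maps h (carrier A) (carrier B) \<and>
    (\<forall>y\<in>elts (carrier B). \<exists>!x. x \<in> elts (carrier A) \<and> h \<cdot> x = y) \<and>
    (\<forall>r\<in>elts (rel_syms S). \<forall>a\<in>elts (funspace (rel_ar S \<cdot> r) (carrier A)).
      a \<in> elts (rels A \<cdot> r) \<longleftrightarrow> lam (rel_ar S \<cdot> r) (\<lambda>k. h \<cdot> (a \<cdot> k)) \<in> elts (rels B \<cdot> r)) \<and>
    (\<forall>f\<in>elts (fun_syms S). \<forall>a\<in>elts (funspace (fun_ar S \<cdot> f) (carrier A)).
      h \<cdot> (funs A \<cdot> f \<cdot> a) = funs B \<cdot> f \<cdot> lam (fun_ar S \<cdot> f) (\<lambda>k. h \<cdot> (a \<cdot> k)))"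

definition closed_isomorphisms :: "'v \<Rightarrow> 'v set \<Rightarrow> bool" where
  "closed_isomorphisms S K \<longleftrightarrow>
    (\<forall>A h B. is_structure S A \<and> B \<in> K \<and> is_isomorphism S h A B \<longrightarrow> A \<in> K)"

definition is_substructure :: "'v \<Rightarrow> 'v \<Rightarrow> 'v \<Rightarrow> bool" where
  "is_substructure S A B \<longleftrightarrow> is_structure S A \<and> is_structure S B \<and>
    elts (carrier A) \<subseteq> elts (carrier B) \<and>
    (\<forall>r\<in>elts (rel_syms S). \<forall>a\<in>elts (funspace (rel_ar S \<cdot> r) (carrier A)).
      a \<in> elts (rels A \<cdot> r) \<longleftrightarrow> a \<in> elts (rels B \<cdot> r)) \<and>
    (\<forall>f\<in>elts (fun_syms S). \<forall>a\<in>elts (funspace (fun_ar S \<cdot> f) (carrier A)).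
      funs A \<cdot> f \<cdot> a = funs B \<cdot> f \<cdot> a)"

definition closed_substructures :: "'v \<Rightarrow> 'v set \<Rightarrow> bool" where
  "closed_substructures S K \<longleftrightarrow> (\<forall>A B. B \<in> K \<and> is_substructure S A B \<longrightarrow> A \<in> K)"

definition proper_filter :: "'v \<Rightarrow> 'v \<Rightarrow> bool" where
  "proper_filter I F \<longleftrightarrow>
    (\<forall>X\<in>elts F. elts X \<subseteq> elts I) \<and>
    I \<in> elts F \<and> mkset {} \<notin> elts F \<and>
    (\<forall>X\<in>elts F. \<forall>Y. elts X \<subseteq> elts Y \<and> elts Y \<subseteq> elts I \<longrightarrow> Y \<in> elts F) \<and>
    (\<forall>X\<in>elts F. \<forall>Y\<in>elts F. mkset (elts X \<inter> elts Y) \<in> elts F)"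

definition product :: "'v \<Rightarrow> 'v \<Rightarrow> 'v" where
  "product I A = mkset {a. func_on a I \<and> (\<forall>i\<in>elts I. a \<cdot> i \<in> elts (carrier (A \<cdot> i)))}"

definition eq_class :: "'v \<Rightarrow> 'v \<Rightarrow> 'v \<Rightarrow> 'v \<Rightarrow> 'v" where
  "eq_class I F A a =
    mkset {b \<in> elts (product I A). mkset {i \<in> elts I. a \<cdot> i = b \<cdot> i} \<in> elts F}"

text \<open>In the two definitions below, \<open>u\<close> is a tuple of representatives and \<open>u \<cdot> k \<cdot> i\<close> is the
  \<open>i\<close>-th coordinate of its \<open>k\<close>-th entry.\<close>

definition redprod_rel :: "'v \<Rightarrow> 'v \<Rightarrow> 'v \<Rightarrow> 'v \<Rightarrow> 'v \<Rightarrow> 'v" where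
  "redprod_rel S I F A r = mkset {lam (rel_ar S \<cdot> r) (\<lambda>k. eq_class I F A (u \<cdot> k)) | u.
    maps u (rel_ar S \<cdot> r) (product I A) \<and>
    mkset {i \<in> elts I. lam (rel_ar S \<cdot> r) (\<lambda>k. u \<cdot> k \<cdot> i) \<in> elts (rels (A \<cdot> i) \<cdot> r)} \<in> elts F}"

definition redprod_fun :: "'v \<Rightarrow> 'v \<Rightarrow> 'v \<Rightarrow> 'v \<Rightarrow> 'v \<Rightarrow> 'v" where
  "redprod_fun S I F A f = mkset {opair
      (lam (fun_ar S \<cdot> f) (\<lambda>k. eq_class I F A (u \<cdot> k)))
      (eq_class I F A (lam I (\<lambda>i. funs (A \<cdot> i) \<cdot> f \<cdot> lam (fun_ar S \<cdot> f) (\<lambda>k. u \<cdot> k \<cdot> i)))) | u.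
    maps u (fun_ar S \<cdot> f) (product I A)}"

definition reduced_product :: "'v \<Rightarrow> 'v \<Rightarrow> 'v \<Rightarrow> 'v \<Rightarrow> 'v" where
  "reduced_product S I F A = mkstruct
    (mkset {eq_class I F A a | a. a \<in> elts (product I A)})
    (lam (rel_syms S) (redprod_rel S I F A))
    (lam (fun_syms S) (redprod_fun S I F A))"

definition closed_reduced_products :: "'v \<Rightarrow> 'v set \<Rightarrow> bool" where
  "closed_reduced_products S K \<longleftrightarrow>
    (\<forall>I F A. proper_filter I F \<and> func_on A I \<and> (\<forall>i\<in>elts I. A \<cdot> i \<in> K) \<and>
      elts (product I A) \<noteq> {} \<longrightarrow> reduced_product S I F A \<in> K)"

end

end

theory Submission
  imports Defs
begin

text \<open>Horn formulas pass to reduced products by the usual argument. Representatives of the values of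
  an assignment are chosen only for the finitely many variables that matter.

  For the converse, let \<open>A\<close> satisfy all basic Horn formulas that hold in \<open>K\<close>. The index set
  consists of all pairs of a structure \<open>B \<in> K\<close> and an arbitrary map \<open>h\<close> from \<open>A\<close> to \<open>B\<close>, and the filter is
  generated by the sets of those pairs whose map preserves a given atomic fact of \<open>A\<close>. The evaluation maps
  \<open>x \<mapsto> ((B, h) \<mapsto> h x)\<close> then embed \<open>A\<close> in the reduced product of the structures \<open>B\<close>, and no representatives have
  to be chosen. A Horn formula failing in \<open>A\<close> fails in some \<open>B \<in> K\<close>. This shows that the filter is proper and
  that false atomic facts stay false. Passing to the substructure generated by the assignment, and
  replacing its elements by sets of terms, bounds the structures \<open>B\<close> by a set.

  Everything takes place inside a model of ZF, so that each use of separation, replacement or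
  induction requires that the property in question is definable.\<close>

context membership
begin

subsection \<open>Definability\<close>

text \<open>The obstacle behind the construction is that the index set cannot consist of one
  counterexample per Horn formula: a structure and an assignment would have to be chosen for each.
  Taking all pairs, with arbitrary maps in place of homomorphisms, avoids this and leaves it to the
  filter to say which facts a map preserves. Properness and the reflection of false facts have a
  common source: if finitely many facts true in \<open>A\<close> entailed a false one, or a
  contradiction, throughout \<open>K\<close>, then this implication would be a basic Horn formula
  valid in \<open>K\<close> and false in \<open>A\<close>.

  The natural numbers of the model may be nonstandard, so finiteness and induction in HOL say
  nothing about its tuples, terms and formulas. Finiteness is therefore internal, and every
  induction runs over a set cut out by separation. Hence most arguments come with a
  \<open>dfn\<close> or \<open>dft\<close> obligation, and notions given by definite descriptions
  are first rewritten in a form that is definable for all arguments.\<close>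

primrec ren :: "(nat \<Rightarrow> nat) \<Rightarrow> set_fm \<Rightarrow> set_fm" where
  "ren r (SMem i j) = SMem (r i) (r j)"
| "ren r (SEq i j) = SEq (r i) (r j)"
| "ren r (SNot \<phi>) = SNot (ren r \<phi>)"
| "ren r (SAnd \<phi> \<psi>) = SAnd (ren r \<phi>) (ren r \<psi>)"
| "ren r (SEx i \<phi>) = SEx (r i) (ren r \<phi>)"

text \<open>Bound variables are renamed together with the free ones; injectivity keeps a quantifier
  from capturing a variable that was different from the bound one.\<close>

lemma holds_ren: "inj r \<Longrightarrow> holds mem s (ren r \<phi>) \<longleftrightarrow> holds mem (\<lambda>n. s (r n)) \<phi>"
proof (induction \<phi> arbitrary: s)
  case (SEx i \<phi>)
  have "(\<lambda>n. (s(r i := x)) (r n)) = (\<lambda>n. s (r n))(i := x)" for x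
    using SEx.prems by (auto simp: inj_eq)
  then show ?case using SEx by simp
qed auto

text \<open>A definable class comes with a whole environment of parameters. Finite dependence
  reduces it to finitely many of them, which can then be introduced one at a time.\<close>

lemma holds_finite_dependence:
  "\<exists>N. \<forall>s s'. (\<forall>n\<le>N. s n = s' n) \<longrightarrow> holds mem s \<phi> = holds mem s' \<phi>"
proof (induction \<phi>)
  case (SMem i j)
  then show ?case by (intro exI[of _ "max i j"]) simp
next
  case (SEq i j)
  then show ?case by (intro exI[of _ "max i j"]) simp
next
  case (SNot \<phi>)
  then show ?case by simp
next
  case (SAnd \<phi> \<psi>)
  then obtain N M where "\<forall>s s'. (\<forall>n\<le>N. s n = s' n) \<longrightarrow> holds mem s \<phi> = holds mem s' \<phi>"
    "\<forall>s s'. (\<forall>n\<le>M. s n = s' n) \<longrightarrow> holds mem s \<psi> = holds mem s' \<psi>" by blast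
  then have "holds mem s (SAnd \<phi> \<psi>) = holds mem s' (SAnd \<phi> \<psi>)" if "\<forall>n\<le>max N M. s n = s' n" for s s'
    using that by (metis holds.simps(4) le_max_iff_disj)
  then show ?case by blast
next
  case (SEx i \<phi>)
  then obtain N where N: "\<forall>s s'. (\<forall>n\<le>N. s n = s' n) \<longrightarrow> holds mem s \<phi> = holds mem s' \<phi>"
    by blast
  have "holds mem (s(i := x)) \<phi> = holds mem (s'(i := x)) \<phi>" if "\<forall>n\<le>N. s n = s' n" for s s' x
    by (rule N[rule_format]) (simp add: that)
  then have "holds mem s (SEx i \<phi>) = holds mem s' (SEx i \<phi>)" if "\<forall>n\<le>N. s n = s' n" for s s'
    unfolding holds.simps using that by blast
  then show ?case by blast
qed

text \<open>The predicates on environments definable with parameters, in de Bruijn style: the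
  variable bound by a quantifier is number \<open>0\<close>. The last rule introduces a parameter.\<close>

inductive dfn :: "((nat \<Rightarrow> 'v) \<Rightarrow> bool) \<Rightarrow> bool" where
  dfn_mem0: "dfn (\<lambda>s. mem (s i) (s j))"
| dfn_eq0: "dfn (\<lambda>s. s i = s j)"
| dfn_not: "dfn P \<Longrightarrow> dfn (\<lambda>s. \<not> P s)"
| dfn_and: "dfn P \<Longrightarrow> dfn Q \<Longrightarrow> dfn (\<lambda>s. P s \<and> Q s)"
| dfn_ex0: "dfn P \<Longrightarrow> dfn (\<lambda>s. \<exists>x. P (case_nat x s))"
| dfn_param: "dfn P \<Longrightarrow> dfn (\<lambda>s. P (case_nat c s))"

text \<open>Even slots hold the variables and odd slots the parameters, so that a single assignment
  for \<open>holds\<close> has unlimited room for both.\<close>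

definition mix :: "(nat \<Rightarrow> 'v) \<Rightarrow> (nat \<Rightarrow> 'v) \<Rightarrow> nat \<Rightarrow> 'v" where
  "mix s \<rho> n = (if even n then s (n div 2) else \<rho> (n div 2))"

text \<open>This compares the environment with one more variable to the environment with one more
  parameter: slot 0 goes to slot 1, even slots move down and odd slots move up by two. A bound
  variable thus lives in slot 1, the place of the first parameter, and the same map handles both
  \<open>dfn_ex0\<close> and \<open>dfn_param\<close>.\<close>

definition bind_slot :: "nat \<Rightarrow> nat" where
  "bind_slot n = (if n = 0 then 1 else if even n then n - 2 else n + 2)"

lemma inj_bind_slot: "inj bind_slot"
proof (rule injI)
  fix a b assume "bind_slot a = bind_slot b"
  then show "a = b" unfolding bind_slot_def by (auto split: if_splits elim!: evenE oddE) presburger+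
qed

lemma mix_bind_slot:
  "(\<lambda>n. ((mix s (case_nat y \<rho>))(1 := x)) (bind_slot n)) = mix (case_nat x s) \<rho>"
proof
  fix n
  show "((mix s (case_nat y \<rho>))(1 := x)) (bind_slot n) = mix (case_nat x s) \<rho> n"
  proof (cases "even n")
    case True
    then obtain k where "n = 2 * k" by (auto elim: evenE)
    then show ?thesis by (cases k) (auto simp: mix_def bind_slot_def)
  next
    case False
    then obtain k where "n = 2 * k + 1" by (auto elim: oddE)
    then show ?thesis by (auto simp: mix_def bind_slot_def)
  qed
qed

text \<open>Each closure rule of \<open>dfn\<close> corresponds to a formula constructor, up to
  moving slots. This turns the closure rules into actual instances of the separation and replacement
  schemas.\<close>

lemma dfn_sound: "dfn P \<Longrightarrow> \<exists>\<phi> \<rho>. \<forall>s. P s \<longleftrightarrow> holds mem (mix s \<rho>) \<phi>"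
proof (induction rule: dfn.induct)
  case (dfn_mem0 i j)
  show ?case by (intro exI[of _ "SMem (2*i) (2*j)"] exI) (simp add: mix_def)
next
  case (dfn_eq0 i j)
  show ?case by (intro exI[of _ "SEq (2*i) (2*j)"] exI) (simp add: mix_def)
next
  case (dfn_not P)
  then show ?case by (metis holds.simps(3))
next
  case (dfn_and P Q)
  then obtain \<phi> \<rho> \<psi> \<sigma> where h: "\<forall>s. P s \<longleftrightarrow> holds mem (mix s \<rho>) \<phi>" "\<forall>s. Q s \<longleftrightarrow> holds mem (mix s \<sigma>) \<psi>"
    by blast
  \<comment> \<open>The parameter lists of the two conjuncts are interleaved by another use of
    \<open>mix\<close>. The odd slot \<open>2 * k + 1\<close> goes to \<open>4 * k + 1\<close> or to
    \<open>4 * k + 3\<close>, according to which conjunct it comes from.\<close>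
  define r where "r b n = (if even n then n else 2 * n - 1 + 2 * b)" for b n :: nat
  have r: "inj (r b)" if "b < 2" for b
  proof (rule injI)
    fix x y assume "r b x = r b y"
    then show "x = y" unfolding r_def by (auto split: if_splits elim!: evenE oddE) presburger+
  qed
  have 0: "(\<lambda>n. mix s (mix \<rho> \<sigma>) (r 0 n)) = mix s \<rho>" for s
  proof
    fix n show "mix s (mix \<rho> \<sigma>) (r 0 n) = mix s \<rho> n"
    proof (cases "even n")
      case False
      then obtain k where "n = 2 * k + 1" by (auto elim: oddE)
      then show ?thesis by (auto simp: mix_def r_def)
    qed (simp add: mix_def r_def)
  qed
  have 1: "(\<lambda>n. mix s (mix \<rho> \<sigma>) (r 1 n)) = mix s \<sigma>" for s
  proof
    fix n show "mix s (mix \<rho> \<sigma>) (r 1 n) = mix s \<sigma> n"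
    proof (cases "even n")
      case False
      then obtain k where "n = 2 * k + 1" by (auto elim: oddE)
      then show ?thesis by (auto simp: mix_def r_def)
    qed (simp add: mix_def r_def)
  qed
  show ?case
    by (intro exI[of _ "SAnd (ren (r 0) \<phi>) (ren (r 1) \<psi>)"] exI[of _ "mix \<rho> \<sigma>"])
      (simp add: holds_ren r 0 1[unfolded One_nat_def] h)
next
  case (dfn_ex0 P)
  then obtain \<phi> \<rho> where h: "\<forall>s. P s \<longleftrightarrow> holds mem (mix s \<rho>) \<phi>" by blast
  \<comment> \<open>The value \<open>undefined\<close> only makes room at slot 1;
    \<open>SEx 1\<close> overwrites it before it can be read.\<close>
  have "holds mem (mix s (case_nat undefined \<rho>)) (SEx 1 (ren bind_slot \<phi>)) \<longleftrightarrow> (\<exists>x. P (case_nat x s))" for s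
    by (simp only: holds.simps holds_ren[OF inj_bind_slot] mix_bind_slot h)
  then show ?case by (intro exI allI) (rule sym)
next
  case (dfn_param P c)
  then obtain \<phi> \<rho> where h: "\<forall>s. P s \<longleftrightarrow> holds mem (mix s \<rho>) \<phi>" by blast
  have "(mix s (case_nat c \<rho>))(1 := c) = mix s (case_nat c \<rho>)" for s
    by (auto simp: mix_def)
  then have "(\<lambda>n. mix s (case_nat c \<rho>) (bind_slot n)) = mix (case_nat c s) \<rho>" for s
    using mix_bind_slot[of s c \<rho> c] by simp
  then show ?case
    by (intro exI[of _ "ren bind_slot \<phi>"] exI[of _ "case_nat c \<rho>"])
      (simp add: holds_ren inj_bind_slot h)
qed

lemma dfn_ren: "dfn P \<Longrightarrow> dfn (\<lambda>s. P (\<lambda>n. s (f n)))"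
proof (induction arbitrary: f rule: dfn.induct)
  case (dfn_ex0 P)
  have "(\<lambda>n. case_nat x s (case_nat 0 (\<lambda>k. Suc (f k)) n)) = case_nat x (\<lambda>n. s (f n))" for x :: 'v and s
    by (auto split: nat.split)
  then show ?case using dfn.dfn_ex0[OF dfn_ex0.IH[of "case_nat 0 (\<lambda>k. Suc (f k))"]] by simp
next
  case (dfn_param P c)
  have "(\<lambda>n. case_nat c s (case_nat 0 (\<lambda>k. Suc (f k)) n)) = case_nat c (\<lambda>n. s (f n))" for s
    by (auto split: nat.split)
  then show ?case using dfn.dfn_param[OF dfn_param.IH[of "case_nat 0 (\<lambda>k. Suc (f k))"], of c] by simp
qed (auto intro: dfn.intros)

lemma dfn_ex: "dfn (\<lambda>s. P (s 0) (\<lambda>n. s (Suc n))) \<Longrightarrow> dfn (\<lambda>s. \<exists>x. P x s)"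
  using dfn_ex0[of "\<lambda>s. P (s 0) (\<lambda>n. s (Suc n))"] by simp

lemma fun_upd_as_ren: "(\<lambda>n. case_nat c s (if n = m then 0 else Suc n)) = s(m := c)"
  by auto

lemma dfn_upd_ex: "dfn P \<Longrightarrow> dfn (\<lambda>s. \<exists>x. P (s(m := x)))"
  using dfn_ex0[OF dfn_ren[of P "\<lambda>n. if n = m then 0 else Suc n"]] by (simp add: fun_upd_as_ren)

lemma dfn_upd: "dfn P \<Longrightarrow> dfn (\<lambda>s. P (s(m := c)))"
  using dfn_param[OF dfn_ren[of P "\<lambda>n. if n = m then 0 else Suc n"], of c] by (simp add: fun_upd_as_ren)

lemma dfn_holds: "dfn (\<lambda>s. holds mem s \<phi>)"
  by (induction \<phi>) (auto intro: dfn.intros dfn_upd_ex)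

text \<open>Only the parameters in slots 1 to \<open>N\<close> matter, and they are fixed one after
  another by \<open>dfn_upd\<close>.\<close>

lemma dfn_class:
  assumes "definable_class K"
  shows "dfn (\<lambda>s. s 0 \<in> K)"
proof -
  obtain \<phi> c where h: "\<forall>x. x \<in> K \<longleftrightarrow> holds mem (c(0 := x)) \<phi>"
    using assms unfolding definable_class_def by blast
  obtain N where N: "\<forall>s s'. (\<forall>n\<le>N. s n = s' n) \<longrightarrow> holds mem s \<phi> = holds mem s' \<phi>"
    using holds_finite_dependence by blast
  \<comment> \<open>Slots above \<open>N\<close> keep the values of the surrounding environment,
    which cannot affect the truth of \<open>\<phi>\<close>.\<close>
  have "holds mem (\<lambda>n. if 0 < n \<and> n \<le> N then c n else s n) \<phi> \<longleftrightarrow> s 0 \<in> K" for s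
    unfolding h[rule_format] by (intro N[rule_format]) auto
  then have eq: "(\<lambda>s. holds mem (\<lambda>n. if 0 < n \<and> n \<le> N then c n else s n) \<phi>) = (\<lambda>s. s 0 \<in> K)"
    by (rule ext)
  moreover have "dfn (\<lambda>s. holds mem (\<lambda>n. if 0 < n \<and> n \<le> M then c n else s n) \<phi>)" for M
  proof (induction M)
    case (Suc M)
    have "(\<lambda>n. if 0 < n \<and> n \<le> M then c n else (s(Suc M := c (Suc M))) n)
      = (\<lambda>n. if 0 < n \<and> n \<le> Suc M then c n else s n)" for s
      by (auto simp: le_Suc_eq)
    then show ?case using dfn_upd[OF Suc, of "Suc M" "c (Suc M)"] by simp
  next
    case 0
    have "(\<lambda>n. if 0 < n \<and> n \<le> 0 then c n else s n) = s" for s by auto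
    then show ?case by (simp only: dfn_holds)
  qed
  ultimately show ?thesis unfolding eq[symmetric] by blast
qed

section \<open>Definable operations and substitution\<close>

definition dft :: "((nat \<Rightarrow> 'v) \<Rightarrow> 'v) \<Rightarrow> bool" where
  "dft t \<longleftrightarrow> dfn (\<lambda>s. s 0 = t (\<lambda>n. s (Suc n)))"

lemma dft_var: "dft (\<lambda>s. s i)"
  unfolding dft_def by (rule dfn_eq0)

lemma dft_const: "dft (\<lambda>s. c)"
  unfolding dft_def using dfn_param[OF dfn_eq0[of 1 0], of c] by simp

lemma dft_ren: "dft t \<Longrightarrow> dft (\<lambda>s. t (\<lambda>n. s (f n)))"
  unfolding dft_def using dfn_ren[of "\<lambda>s. s 0 = t (\<lambda>n. s (Suc n))" "case_nat 0 (\<lambda>k. Suc (f k))"] by simp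

text \<open>An argument place is filled by quantifying over its value and saying, through the graph
  of \<open>t\<close>, that it is the right one.\<close>

lemma dfn_subst:
  assumes "dfn (\<lambda>s. P (s 0) (\<lambda>n. s (Suc n)))" "dft t"
  shows "dfn (\<lambda>s. P (t s) s)"
proof -
  have "dfn (\<lambda>s. \<exists>x. x = t s \<and> P x s)"
    by (rule dfn_ex[OF dfn_and[OF assms(2)[unfolded dft_def] assms(1)]])
  then show ?thesis by simp
qed

lemma dfn1: "dfn (\<lambda>s. R (s 0)) \<Longrightarrow> dft t \<Longrightarrow> dfn (\<lambda>s. R (t s))"
  by (rule dfn_subst)

lemma dfn2:
  assumes "dfn (\<lambda>s. R (s 0) (s 1))" "dft t" "dft u"
  shows "dfn (\<lambda>s. R (t s) (u s))"
proof (rule dfn_subst[OF dfn_subst[of "\<lambda>y s. R (s 0) y" "\<lambda>s. u (\<lambda>n. s (Suc n))"] assms(2)])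
  show "dfn (\<lambda>s. R (s (Suc 0)) (s 0))"
    using dfn_ren[OF assms(1), of "\<lambda>n. if n = 0 then 1 else 0"] by simp
qed (rule dft_ren[OF assms(3)])

lemma dfn3:
  assumes R: "dfn (\<lambda>s. R (s 0) (s 1) (s 2))" and t: "dft t" "dft u" "dft v"
  shows "dfn (\<lambda>s. R (t s) (u s) (v s))"
proof (rule dfn_subst[OF _ t(1)])
  have "dfn (\<lambda>s. R (s 2) (s 1) (s 0))"
    \<comment> \<open>The three arguments are reversed so that they can be substituted from the last
      to the first. Truncated subtraction sends all later variables to 0, which is harmless as the
      predicate reads only three.\<close>
    using dfn_ren[OF R, of "\<lambda>n. 2 - n"] by simp
  then have "dfn (\<lambda>s. R (s 1) (s 0) (v (\<lambda>n. s (Suc (Suc n)))))"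
    using dfn_subst[of "\<lambda>y s. R (s 1) (s 0) y" "\<lambda>s. v (\<lambda>n. s (Suc (Suc n)))"] dft_ren[OF t(3), of "\<lambda>n. Suc (Suc n)"]
    by (simp add: numeral_2_eq_2)
  then show "dfn (\<lambda>s. R (s 0) (u (\<lambda>n. s (Suc n))) (v (\<lambda>n. s (Suc n))))"
    using dfn_subst[of "\<lambda>y s. R (s 0) y (v (\<lambda>n. s (Suc n)))" "\<lambda>s. u (\<lambda>n. s (Suc n))"] dft_ren[OF t(2), of Suc]
    by simp
qed

lemma dft_subst:
  assumes "dft (\<lambda>s. f (s 0) (\<lambda>n. s (Suc n)))" "dft t"
  shows "dft (\<lambda>s. f (t s) s)"
  unfolding dft_def
proof (rule dfn_subst[where P = "\<lambda>y s. s 0 = f y (\<lambda>n. s (Suc n))"])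
  show "dfn (\<lambda>s. s (Suc 0) = f (s 0) (\<lambda>n. s (Suc (Suc n))))"
    using dfn_ren[OF assms(1)[unfolded dft_def], of "\<lambda>n. if n = 0 then 1 else if n = 1 then 0 else n"]
    by simp
  show "dft (\<lambda>s. t (\<lambda>n. s (Suc n)))" by (rule dft_ren[OF assms(2)])
qed

lemma dft1: "dft (\<lambda>s. f (s 0)) \<Longrightarrow> dft t \<Longrightarrow> dft (\<lambda>s. f (t s))"
  by (rule dft_subst)

lemma dft2:
  assumes "dft (\<lambda>s. f (s 0) (s 1))" "dft t" "dft u"
  shows "dft (\<lambda>s. f (t s) (u s))"
proof (rule dft_subst[OF dft_subst[of "\<lambda>y s. f (s 0) y" "\<lambda>s. u (\<lambda>n. s (Suc n))"] assms(2)])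
  show "dft (\<lambda>s. f (s (Suc 0)) (s 0))"
    using dft_ren[OF assms(1), of "\<lambda>n. if n = 0 then 1 else 0"] by simp
qed (rule dft_ren[OF assms(3)])

lemma dfn_mem: "dft t \<Longrightarrow> dft u \<Longrightarrow> dfn (\<lambda>s. t s \<in> elts (u s))"
  unfolding elts_def mem_Collect_eq by (rule dfn2[where R = mem, OF dfn_mem0])

lemma dfn_eq: "dft t \<Longrightarrow> dft u \<Longrightarrow> dfn (\<lambda>s. t s = u s)"
  by (rule dfn2[where R = "(=)", OF dfn_eq0])

lemma dfn_or:
  assumes "dfn P" "dfn Q"
  shows "dfn (\<lambda>s. P s \<or> Q s)"
  using dfn_not[OF dfn_and[OF dfn_not[OF assms(1)] dfn_not[OF assms(2)]]] by simp

lemma dfn_imp: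
  assumes "dfn P" "dfn Q"
  shows "dfn (\<lambda>s. P s \<longrightarrow> Q s)"
  unfolding imp_conv_disj by (rule dfn_or[OF dfn_not[OF assms(1)] assms(2)])

lemma dfn_iff:
  assumes "dfn P" "dfn Q"
  shows "dfn (\<lambda>s. P s \<longleftrightarrow> Q s)"
proof -
  have "(\<lambda>s. P s \<longleftrightarrow> Q s) = (\<lambda>s. (P s \<longrightarrow> Q s) \<and> (Q s \<longrightarrow> P s))" by auto
  then show ?thesis using dfn_and[OF dfn_imp[OF assms] dfn_imp[OF assms(2,1)]] by (simp only:)
qed

lemma dfn_all:
  assumes "dfn (\<lambda>s. P (s 0) (\<lambda>n. s (Suc n)))"
  shows "dfn (\<lambda>s. \<forall>x. P x s)"
proof -
  have "dfn (\<lambda>s. \<not> (\<exists>x. \<not> P x s))" by (rule dfn_not[OF dfn_ex[OF dfn_not[OF assms]]])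
  then show ?thesis by simp
qed

lemma dfn_bex:
  assumes "dft t" "dfn (\<lambda>s. P (s 0) (\<lambda>n. s (Suc n)))"
  shows "dfn (\<lambda>s. \<exists>x\<in>elts (t s). P x s)"
proof -
  have "dfn (\<lambda>s. \<exists>x. x \<in> elts (t s) \<and> P x s)"
    by (rule dfn_ex, rule dfn_and[OF dfn_mem[OF dft_var dft_ren[OF assms(1)]] assms(2)])
  then show ?thesis by (simp add: Bex_def)
qed

lemma dfn_ball:
  assumes "dft t" "dfn (\<lambda>s. P (s 0) (\<lambda>n. s (Suc n)))"
  shows "dfn (\<lambda>s. \<forall>x\<in>elts (t s). P x s)"
proof -
  have "dfn (\<lambda>s. \<not> (\<exists>x\<in>elts (t s). \<not> P x s))"
    by (rule dfn_not[OF dfn_bex[OF assms(1) dfn_not[OF assms(2)]]])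
  then show ?thesis by simp
qed

lemma dfn_const: "dfn (\<lambda>s. Q)"
proof (cases Q)
  case True
  then show ?thesis using dfn_eq0[of 0 0] by simp
next
  case False
  then show ?thesis using dfn_not[OF dfn_eq0[of 0 0]] by simp
qed

lemma dfn_if:
  assumes "dfn P" "dfn Q" "dfn R"
  shows "dfn (\<lambda>s. if P s then Q s else R s)"
proof -
  have "(\<lambda>s. if P s then Q s else R s) = (\<lambda>s. (P s \<and> Q s) \<or> (\<not> P s \<and> R s))" by auto
  then show ?thesis using assms by (simp add: dfn_or dfn_and dfn_not)
qed

lemma dft_if:
  assumes "dfn P" "dft t" "dft u"
  shows "dft (\<lambda>s. if P s then t s else u s)"
proof -
  have "(\<lambda>s. s 0 = (if P (\<lambda>n. s (Suc n)) then t (\<lambda>n. s (Suc n)) else u (\<lambda>n. s (Suc n)))) =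
    (\<lambda>s. if P (\<lambda>n. s (Suc n)) then s 0 = t (\<lambda>n. s (Suc n)) else s 0 = u (\<lambda>n. s (Suc n)))"
    by (auto simp: fun_eq_iff)
  moreover have "dfn (\<lambda>s. if P (\<lambda>n. s (Suc n)) then s 0 = t (\<lambda>n. s (Suc n)) else s 0 = u (\<lambda>n. s (Suc n)))"
    by (rule dfn_if[OF dfn_ren[OF assms(1)] assms(2,3)[unfolded dft_def]])
  ultimately show ?thesis unfolding dft_def by (simp only:)
qed

text \<open>The collections \<open>D0\<close> to \<open>D3\<close> grow with each new definable
  notion. Used with \<open>intro\<close>, they settle definability by following the syntax of a
  predicate.\<close>

lemmas D0 = dft_var dft_const dfn_mem dfn_eq dfn_not dfn_and dfn_or dfn_imp dfn_iff dfn_ex dfn_all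
  dfn_bex dfn_ball dfn_const dft_if

lemma dfn_subset: "dft t \<Longrightarrow> dft u \<Longrightarrow> dfn (\<lambda>s. elts (t s) \<subseteq> elts (u s))"
  by (rule dfn2[where R = "\<lambda>a b. elts a \<subseteq> elts b"], unfold subset_eq, intro D0)

end

context ZF_model
begin

subsection \<open>Set theory in the model\<close>

lemma elts_ext: "elts a = elts b \<Longrightarrow> a = b"
  using extensionality by (auto simp: elts_def)

definition isset :: "'v set \<Rightarrow> bool" where
  "isset X \<longleftrightarrow> (\<exists>a. elts a = X)"

lemma mkset_elts [simp]: "mkset (elts a) = a"
  unfolding mkset_def by (auto intro: elts_ext)

lemma elts_mkset: "isset X \<Longrightarrow> elts (mkset X) = X"
  unfolding isset_def by auto

lemma isset_elts [simp]: "isset (elts a)"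
  unfolding isset_def by blast

text \<open>If no set has extension \<open>X\<close>, then \<open>mkset X\<close> is a fixed junk value; this makes
  \<open>mkset\<close> definable without any side condition.\<close>

lemma mkset_junk: "\<not> isset X \<Longrightarrow> mkset X = (THE a. False)"
  unfolding mkset_def isset_def by (metis (mono_tags, lifting))

lemma eq_mkset_iff:
  "y = mkset X \<longleftrightarrow> elts y = X \<or> (\<not> (\<exists>a. elts a = X) \<and> y = (THE a. False))"
  using elts_mkset mkset_elts mkset_junk unfolding isset_def by metis

lemma dft_mkset:
  assumes "dfn (\<lambda>s. P (s 0) (\<lambda>n. s (Suc n)))"
  shows "dft (\<lambda>s. mkset {x. P x s})"
proof -
  have 1: "dfn (\<lambda>s. P (s 0) (\<lambda>n. s (Suc (Suc n))))"
    using dfn_ren[OF assms, of "\<lambda>n. if n = 0 then 0 else Suc n"] by simp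
  have 2: "dfn (\<lambda>s. P (s 0) (\<lambda>n. s (Suc (Suc (Suc n)))))"
    using dfn_ren[OF assms, of "\<lambda>n. if n = 0 then 0 else Suc (Suc n)"] by simp
  show ?thesis
    unfolding dft_def eq_mkset_iff set_eq_iff mem_Collect_eq by (intro D0 1 2)
qed

lemma sepI:
  assumes "dfn (\<lambda>s. P (s 0))"
  shows "isset {x \<in> elts a. P x}"
proof -
  obtain \<phi> \<rho> where h: "\<forall>s. P (s 0) \<longleftrightarrow> holds mem (mix s \<rho>) \<phi>" using dfn_sound[OF assms] by blast
  \<comment> \<open>Slot 0 is even and hence belongs to the variables, so the update made by the
    separation axiom commutes with \<open>mix\<close>.\<close>
  have eq: "(mix undefined \<rho>)(0 := x) = mix (undefined(0 := x)) \<rho>" for x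
  proof
    fix n show "((mix undefined \<rho>)(0 := x)) n = mix (undefined(0 := x)) \<rho> n"
      by (auto simp: mix_def elim!: evenE)
  qed
  obtain b where "\<forall>x. mem x b \<longleftrightarrow> mem x a \<and> holds mem ((mix undefined \<rho>)(0 := x)) \<phi>"
    using separation by blast
  then have "elts b = {x \<in> elts a. P x}"
    unfolding eq by (auto simp: elts_def h[rule_format, symmetric])
  then show ?thesis unfolding isset_def by blast
qed

lemma isset_Collect:
  assumes "dfn (\<lambda>s. P (s 0))" "\<And>x. P x \<Longrightarrow> x \<in> elts a"
  shows "isset {x. P x}"
proof -
  have "{x. P x} = {x \<in> elts a. P x}" using assms(2) by blast
  then show ?thesis using sepI[OF assms(1)] by simp
qed

lemma replI:
  assumes "dft (\<lambda>s. g (s 0))"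
  shows "isset (g ` elts a)"
proof -
  have "dfn (\<lambda>s. s 1 = g (s 0))"
    using dfn_ren[OF assms[unfolded dft_def], of "\<lambda>n. if n = 0 then 1 else if n = 1 then 0 else n"] by simp
  from dfn_sound[OF this] obtain \<phi> \<rho> where h: "\<forall>s. s 1 = g (s 0) \<longleftrightarrow> holds mem (mix s \<rho>) \<phi>"
    by (elim exE) (rule that)
  \<comment> \<open>The replacement axiom puts argument and value into slots 0 and 1, whereas
    \<open>mix\<close> puts the first two variables into slots 0 and 2; \<open>r\<close> exchanges
    slots 1 and 2.\<close>
  define r where "r n = (if n = 1 then 2 else if n = 2 then 1 else n)" for n :: nat
  have "r (r n) = n" for n by (simp add: r_def)
  then have "inj r" by (rule inj_on_inverseI)
  define \<sigma> where "\<sigma> n = mix undefined \<rho> (r n)" for n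
  have "(\<lambda>n. (\<sigma>(0 := x, 1 := y)) (r n)) = mix (undefined(0 := x, 1 := y)) \<rho>" for x y
  proof
    fix n show "(\<sigma>(0 := x, 1 := y)) (r n) = mix (undefined(0 := x, 1 := y)) \<rho> n"
      by (auto simp: mix_def \<sigma>_def r_def elim!: evenE)
  qed
  then have g: "holds mem (\<sigma>(0 := x, 1 := y)) (ren r \<phi>) \<longleftrightarrow> y = g x" for x y
    using h[rule_format, of "undefined(0 := x, 1 := y)"] holds_ren[OF \<open>inj r\<close>] by simp
  have "\<exists>b. \<forall>y. mem y b \<longleftrightarrow> (\<exists>x. mem x a \<and> holds mem (\<sigma>(0 := x, 1 := y)) (ren r \<phi>))"
    by (rule replacement[rule_format]) (simp only: g, blast)
  then obtain b where "\<forall>y. mem y b \<longleftrightarrow> (\<exists>x. mem x a \<and> y = g x)" unfolding g by blast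
  then have "elts b = g ` elts a" unfolding elts_def by auto
  then show ?thesis unfolding isset_def by blast
qed

lemma isset_Collect_ex: "dft (\<lambda>s. g (s 0)) \<Longrightarrow> isset {g x | x. x \<in> elts a}"
  unfolding Setcompr_eq_image by (rule replI)

section \<open>Pairs, unions, power sets and cartesian products\<close>

definition emp :: 'v where "emp = mkset {}"

lemma elts_emp [simp]: "elts emp = {}"
proof -
  have "isset {}" using sepI[OF dfn_const[of False]] by simp
  then show ?thesis unfolding emp_def by (rule elts_mkset)
qed

lemma isset_two: "isset {a, b}"
proof -
  obtain c where "\<forall>x. mem x c \<longleftrightarrow> x = a \<or> x = b" using pairing by blast
  then have "elts c = {a, b}" unfolding elts_def by auto
  then show ?thesis unfolding isset_def by blast
qed

lemma elts_two [simp]: "elts (mkset {a, b}) = {a, b}"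
  by (rule elts_mkset[OF isset_two])

lemma elts_one [simp]: "elts (mkset {a}) = {a}"
  using elts_two[of a a] by simp

lemma opair_inject [simp]: "opair a b = opair c d \<longleftrightarrow> a = c \<and> b = d"
proof
  assume "opair a b = opair c d"
  then have "elts (mkset {mkset {a}, mkset {a, b}}) = elts (mkset {mkset {c}, mkset {c, d}})"
    unfolding opair_def by simp
  then have "elts ` {mkset {a}, mkset {a, b}} = elts ` {mkset {c}, mkset {c, d}}" by simp
  then have "{{a}, {a, b}} = {{c}, {c, d}}" by simp
  then show "a = c \<and> b = d" by (auto simp: doubleton_eq_iff)
qed auto

lemma pfst_opair [simp]: "pfst (opair a b) = a" and psnd_opair [simp]: "psnd (opair a b) = b"
  unfolding pfst_def psnd_def by auto

lemma dft_two: "dft t \<Longrightarrow> dft u \<Longrightarrow> dft (\<lambda>s. mkset {t s, u s})"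
  unfolding insert_compr empty_iff mem_Collect_eq simp_thms
  by (rule dft2[where f = "\<lambda>a b. mkset {x. x = a \<or> x = b}"]) (intro dft_mkset D0)

lemma dft_one: "dft t \<Longrightarrow> dft (\<lambda>s. mkset {t s})"
  unfolding insert_compr empty_iff mem_Collect_eq simp_thms
  by (rule dft1[where f = "\<lambda>a. mkset {x. x = a}"]) (intro dft_mkset D0)

lemma dft_opair: "dft t \<Longrightarrow> dft u \<Longrightarrow> dft (\<lambda>s. opair (t s) (u s))"
  unfolding opair_def by (intro dft_two dft_one)

text \<open>As with \<open>mkset\<close>, the description has no solution if \<open>p\<close> is not
  a pair, and then denotes the fixed value \<open>THE a. False\<close>. Spelling out both cases
  makes the projection definable everywhere.\<close>

lemma eq_pfst_iff: "y = pfst p \<longleftrightarrow> (\<exists>b. p = opair y b) \<or> (\<not> (\<exists>a b. p = opair a b) \<and> y = (THE a. False))"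
proof (cases "\<exists>a b. p = opair a b")
  case False
  then have "pfst p = (THE a. False)" unfolding pfst_def by metis
  then show ?thesis using False by auto
qed auto

lemma eq_psnd_iff: "y = psnd p \<longleftrightarrow> (\<exists>a. p = opair a y) \<or> (\<not> (\<exists>a b. p = opair a b) \<and> y = (THE a. False))"
proof (cases "\<exists>a b. p = opair a b")
  case False
  then have "psnd p = (THE a. False)" unfolding psnd_def by metis
  then show ?thesis using False by auto
qed auto

lemma dft_pfst: "dft t \<Longrightarrow> dft (\<lambda>s. pfst (t s))"
  by (rule dft1) (unfold dft_def eq_pfst_iff, intro D0 dft_opair)

lemma dft_psnd: "dft t \<Longrightarrow> dft (\<lambda>s. psnd (t s))"
  by (rule dft1) (unfold dft_def eq_psnd_iff, intro D0 dft_opair)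

lemmas D1 = D0 dfn_subset dft_mkset dft_two dft_one dft_opair dft_pfst dft_psnd

lemma isset_Union: "isset (\<Union>x\<in>elts a. elts x)"
proof -
  obtain u where "\<forall>x. mem x u \<longleftrightarrow> (\<exists>y. mem y a \<and> mem x y)" using union by blast
  then have "elts u = (\<Union>x\<in>elts a. elts x)" unfolding elts_def by auto
  then show ?thesis unfolding isset_def by blast
qed

lemma isset_Un: "isset A \<Longrightarrow> isset B \<Longrightarrow> isset (A \<union> B)"
  using isset_Union[of "mkset {mkset A, mkset B}"] by (simp add: elts_mkset)

lemma isset_one: "isset {a}" using isset_two[of a a] by simp

lemma isset_insert: "isset A \<Longrightarrow> isset (insert a A)"
  using isset_Un[OF isset_one] by simp

definition pow :: "'v \<Rightarrow> 'v" where "pow a = mkset {x. elts x \<subseteq> elts a}"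

lemma elts_pow [simp]: "elts (pow a) = {x. elts x \<subseteq> elts a}"
proof -
  obtain p where "\<forall>x. mem x p \<longleftrightarrow> (\<forall>y. mem y x \<longrightarrow> mem y a)" using powerset by blast
  then have "elts p = {x. elts x \<subseteq> elts a}" unfolding elts_def by auto
  then show ?thesis unfolding pow_def by (metis mkset_elts)
qed

definition cart :: "'v \<Rightarrow> 'v \<Rightarrow> 'v" where "cart a b = mkset {p. \<exists>x\<in>elts a. \<exists>y\<in>elts b. p = opair x y}"

lemma elts_cart: "elts (cart a b) = {p. \<exists>x\<in>elts a. \<exists>y\<in>elts b. p = opair x y}"
  unfolding cart_def
proof (intro elts_mkset isset_Collect[where a = "pow (pow (mkset (elts a \<union> elts b)))"])
  show "dfn (\<lambda>s. \<exists>x\<in>elts a. \<exists>y\<in>elts b. s 0 = opair x y)" by (intro D1)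
qed (auto simp: opair_def elts_mkset isset_Un)

lemma opair_in_cart [simp]: "opair x y \<in> elts (cart a b) \<longleftrightarrow> x \<in> elts a \<and> y \<in> elts b"
  by (auto simp: elts_cart)

definition ins :: "'v \<Rightarrow> 'v \<Rightarrow> 'v" where "ins x a = mkset {z. z = x \<or> z \<in> elts a}"

lemma elts_ins [simp]: "elts (ins x a) = insert x (elts a)"
  unfolding ins_def by (simp add: insert_compr[symmetric] elts_mkset isset_insert)

lemma succ_eq_ins: "succ n = ins n n"
  unfolding succ_def by (metis elts_ins mkset_elts)

definition un :: "'v \<Rightarrow> 'v \<Rightarrow> 'v" where "un a b = mkset {z. z \<in> elts a \<or> z \<in> elts b}"

lemma elts_un [simp]: "elts (un a b) = elts a \<union> elts b"
  unfolding un_def using elts_mkset[OF isset_Un[of "elts a" "elts b"]] by (simp add: Un_def)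

lemma dft_ins: "dft t \<Longrightarrow> dft u \<Longrightarrow> dft (\<lambda>s. ins (t s) (u s))"
  by (rule dft2) (unfold ins_def, intro D1)

lemma dft_un: "dft t \<Longrightarrow> dft u \<Longrightarrow> dft (\<lambda>s. un (t s) (u s))"
  by (rule dft2) (unfold un_def, intro D1)

lemma dft_pow: "dft t \<Longrightarrow> dft (\<lambda>s. pow (t s))"
  by (rule dft1) (unfold pow_def, intro D1)

lemma dft_cart: "dft t \<Longrightarrow> dft u \<Longrightarrow> dft (\<lambda>s. cart (t s) (u s))"
  by (rule dft2) (unfold cart_def, intro D1)

lemma dft_succ: "dft t \<Longrightarrow> dft (\<lambda>s. succ (t s))"
  unfolding succ_eq_ins by (intro dft_ins)

text \<open>A total version of application. The description in \<open>app\<close> yields an uncontrolled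
  value if it is not uniquely satisfied, hence \<open>app\<close> is not definable outside its domain.\<close>

definition ap :: "'v \<Rightarrow> 'v \<Rightarrow> 'v" where
  "ap f x = mkset {z. \<exists>y. opair x y \<in> elts f \<and> z \<in> elts y}"

lemma dft_ap: "dft t \<Longrightarrow> dft u \<Longrightarrow> dft (\<lambda>s. ap (t s) (u s))"
  by (rule dft2) (unfold ap_def, intro D1)

section \<open>Functions as sets of pairs\<close>

lemma dfn_func_on: "dft t \<Longrightarrow> dft u \<Longrightarrow> dfn (\<lambda>s. func_on (t s) (u s))"
  by (rule dfn2) (unfold func_on_def Ex1_def, intro D1)

lemma func_opair_app: "func_on f X \<Longrightarrow> x \<in> elts X \<Longrightarrow> opair x (f \<cdot> x) \<in> elts f"
  unfolding func_on_def app_def by (rule theI') blast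

lemma func_app_eq:
  assumes f: "func_on f X" and x: "x \<in> elts X"
  shows "opair x y \<in> elts f \<longleftrightarrow> f \<cdot> x = y"
proof
  assume "opair x y \<in> elts f"
  moreover have "\<exists>!y. opair x y \<in> elts f" using f x unfolding func_on_def by blast
  ultimately show "f \<cdot> x = y" using func_opair_app[OF f x] by blast
qed (use func_opair_app[OF f x] in auto)

text \<open>Inside the domain there is exactly one value, and the union that defines
  \<open>ap\<close> ranges over that value alone.\<close>

lemma app_ap: "func_on f X \<Longrightarrow> x \<in> elts X \<Longrightarrow> f \<cdot> x = ap f x"
  unfolding ap_def by (simp add: func_app_eq)

lemma func_elts:
  assumes f: "func_on f X"
  shows "elts f = {opair x (f \<cdot> x) | x. x \<in> elts X}"
proof (intro equalityI subsetI)
  fix p assume p: "p \<in> elts f"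
  then obtain x y where x: "x \<in> elts X" "p = opair x y" using f unfolding func_on_def by blast
  then have "f \<cdot> x = y" using func_app_eq[OF f x(1)] p by simp
  then show "p \<in> {opair x (f \<cdot> x) | x. x \<in> elts X}" using x by blast
qed (use func_opair_app[OF f] in blast)

lemma func_ext:
  assumes "func_on f X" "func_on g X" "\<And>x. x \<in> elts X \<Longrightarrow> f \<cdot> x = g \<cdot> x"
  shows "f = g"
proof (rule elts_ext)
  show "elts f = elts g" unfolding func_elts[OF assms(1)] func_elts[OF assms(2)] using assms(3) by metis
qed

text \<open>\<open>lam X g\<close> is meaningful only if the graph of \<open>g\<close> on
  \<open>X\<close> is a set of the model, which is not automatic for a HOL function
  \<open>g\<close>.\<close>

definition lam_ok :: "'v \<Rightarrow> ('v \<Rightarrow> 'v) \<Rightarrow> bool" where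
  "lam_ok X g \<longleftrightarrow> isset {opair x (g x) | x. x \<in> elts X}"

lemma lam_cong: "(\<And>x. x \<in> elts X \<Longrightarrow> g x = h x) \<Longrightarrow> lam X g = lam X h"
  unfolding lam_def by (rule arg_cong[where f = mkset]) auto

lemma lam_ok_cong: "(\<And>x. x \<in> elts X \<Longrightarrow> g x = h x) \<Longrightarrow> lam_ok X g = lam_ok X h"
  unfolding lam_ok_def by (rule arg_cong[where f = isset]) auto

lemma lam_okI: "dft (\<lambda>s. g (s 0)) \<Longrightarrow> lam_ok X g"
  unfolding lam_ok_def by (intro isset_Collect_ex D1)

text \<open>Functions written with application become sets in this way: \<open>h\<close> is the
  version with \<open>ap\<close>, definable everywhere and equal to \<open>g\<close> on
  \<open>X\<close>.\<close>

lemma lam_okI': "dft (\<lambda>s. h (s 0)) \<Longrightarrow> (\<And>x. x \<in> elts X \<Longrightarrow> g x = h x) \<Longrightarrow> lam_ok X g"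
  using lam_okI lam_ok_cong by blast

lemma
  assumes "lam_ok X g"
  shows func_lam: "func_on (lam X g) X" and lam_app: "x \<in> elts X \<Longrightarrow> lam X g \<cdot> x = g x"
proof -
  have e: "elts (lam X g) = {opair x (g x) | x. x \<in> elts X}"
    using assms unfolding lam_ok_def lam_def by (rule elts_mkset)
  show f: "func_on (lam X g) X" unfolding func_on_def e by auto
  show "x \<in> elts X \<Longrightarrow> lam X g \<cdot> x = g x"
    using func_app_eq[OF f] e by auto
qed

lemma func_lam_eta: "func_on f X \<Longrightarrow> lam X (\<lambda>x. f \<cdot> x) = f"
  unfolding lam_def func_elts[symmetric] by simp

lemma func_lam_eqI: "func_on f X \<Longrightarrow> (\<And>x. x \<in> elts X \<Longrightarrow> f \<cdot> x = g x) \<Longrightarrow> f = lam X g"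
  using lam_cong func_lam_eta by metis

lemma dft_lam:
  assumes "dft t" "dft (\<lambda>s. g (s 0) (\<lambda>n. s (Suc n)))"
  shows "dft (\<lambda>s. lam (t s) (\<lambda>x. g x s))"
proof -
  have "dft (\<lambda>s. g (s 0) (\<lambda>n. s (Suc (Suc n))))"
    using dft_ren[OF assms(2), of "\<lambda>n. if n = 0 then 0 else Suc n"] by simp
  moreover have "dft (\<lambda>s. t (\<lambda>n. s (Suc (Suc n))))" by (rule dft_ren[OF assms(1)])
  ultimately show ?thesis unfolding lam_def by (intro D1)
qed

lemma mapsI: "func_on f X \<Longrightarrow> (\<And>x. x \<in> elts X \<Longrightarrow> f \<cdot> x \<in> elts Y) \<Longrightarrow> maps f X Y"
  unfolding maps_def by blast

lemma maps_app: "maps f X Y \<Longrightarrow> x \<in> elts X \<Longrightarrow> f \<cdot> x \<in> elts Y"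
  unfolding maps_def by blast

lemma maps_func: "maps f X Y \<Longrightarrow> func_on f X"
  unfolding maps_def by blast

lemma maps_app_ap: "maps f X Y \<Longrightarrow> x \<in> elts X \<Longrightarrow> f \<cdot> x = ap f x"
  unfolding maps_def using app_ap by blast

lemma maps_mono: "maps f X Y \<Longrightarrow> elts Y \<subseteq> elts Z \<Longrightarrow> maps f X Z"
  unfolding maps_def by blast

lemma maps_lam: "lam_ok X g \<Longrightarrow> (\<And>x. x \<in> elts X \<Longrightarrow> g x \<in> elts Y) \<Longrightarrow> maps (lam X g) X Y"
  by (rule mapsI) (auto simp: func_lam lam_app)

lemma maps_ap: "maps f X Y \<longleftrightarrow> func_on f X \<and> (\<forall>x\<in>elts X. ap f x \<in> elts Y)"
  unfolding maps_def by (auto simp: app_ap)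

lemma dfn_maps: "dft t \<Longrightarrow> dft u \<Longrightarrow> dft v \<Longrightarrow> dfn (\<lambda>s. maps (t s) (u s) (v s))"
  by (rule dfn3) (unfold maps_ap, intro D1 dfn_func_on dft_ap)

lemma elts_funspace [simp]: "elts (funspace X Y) = {f. maps f X Y}"
  unfolding funspace_def
proof (intro elts_mkset isset_Collect[where a = "pow (cart X Y)"])
  show "dfn (\<lambda>s. maps (s 0) X Y)" by (intro D1 dfn_maps)
  show "x \<in> elts (pow (cart X Y))" if "maps x X Y" for x
    using that func_elts[OF maps_func[OF that]] maps_app[OF that] by auto
qed

lemma dft_funspace: "dft t \<Longrightarrow> dft u \<Longrightarrow> dft (\<lambda>s. funspace (t s) (u s))"
  by (rule dft2) (unfold funspace_def, intro D1 dfn_maps)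

lemma func_extend:
  assumes u: "func_on u Y" and x: "x \<notin> elts Y"
  shows "func_on (ins (opair x y) u) (ins x Y)" "ins (opair x y) u \<cdot> x = y"
    "k \<in> elts Y \<Longrightarrow> ins (opair x y) u \<cdot> k = u \<cdot> k"
proof -
  show f: "func_on (ins (opair x y) u) (ins x Y)"
    using u x unfolding func_on_def elts_ins
    by (smt (verit, best) insert_iff opair_inject)
  show "ins (opair x y) u \<cdot> x = y" using func_app_eq[OF f, of x y] by simp
  show "k \<in> elts Y \<Longrightarrow> ins (opair x y) u \<cdot> k = u \<cdot> k"
    using func_app_eq[OF f, of k "u \<cdot> k"] func_opair_app[OF u, of k] by simp
qed

lemmas D2 = D1 dft_ins dft_un dft_pow dft_cart dft_succ dft_ap dfn_func_on dfn_maps dft_funspace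
  dft_lam

subsection \<open>Natural numbers and finite sets\<close>

lemma num_0: "num 0 = emp" by (simp add: emp_def)

lemma omega_ex: "\<exists>w. emp \<in> elts w \<and> (\<forall>x\<in>elts w. succ x \<in> elts w)"
proof -
  obtain w where w: "\<exists>e. mem e w \<and> (\<forall>x. \<not> mem x e)"
    "\<forall>x. mem x w \<longrightarrow> (\<exists>y. mem y w \<and> (\<forall>z. mem z y \<longleftrightarrow> mem z x \<or> z = x))"
    using infinity by blast
  obtain e where "mem e w" "\<forall>x. \<not> mem x e" using w(1) by blast
  moreover have "e = emp" by (rule elts_ext) (use \<open>\<forall>x. \<not> mem x e\<close> in \<open>simp, simp add: elts_def\<close>)
  moreover have "succ x \<in> elts w" if x: "x \<in> elts w" for x
  proof -
    obtain y where y: "mem y w" "\<forall>z. mem z y \<longleftrightarrow> mem z x \<or> z = x" using w(2) x unfolding elts_def by blast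
    have "y = succ x" by (rule elts_ext) (use y(2) in \<open>auto simp: succ_eq_ins elts_def[of y] elts_def[of x]\<close>)
    then show ?thesis using y(1) by (simp add: elts_def)
  qed
  ultimately show ?thesis by (auto simp: elts_def)
qed

lemma elts_omega:
  "elts omega = {n. \<forall>w. emp \<in> elts w \<and> (\<forall>x\<in>elts w. succ x \<in> elts w) \<longrightarrow> n \<in> elts w}"
proof -
  obtain w where "emp \<in> elts w \<and> (\<forall>x\<in>elts w. succ x \<in> elts w)" using omega_ex by blast
  then show ?thesis unfolding omega_def emp_def[symmetric]
    by (intro elts_mkset isset_Collect[where a = w]) (intro D2, blast)
qed

lemma emp_in_omega [simp]: "emp \<in> elts omega"
  and succ_in_omega: "n \<in> elts omega \<Longrightarrow> succ n \<in> elts omega"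
  unfolding elts_omega by auto

text \<open>An arbitrary HOL predicate need not cut out a set of the model, whose numbers may be
  nonstandard; for a definable one, separation provides the set of numbers satisfying it, and this
  set is inductive.\<close>

lemma omega_induct:
  assumes "n \<in> elts omega" "dfn (\<lambda>s. P (s 0))" "P emp" "\<And>m. m \<in> elts omega \<Longrightarrow> P m \<Longrightarrow> P (succ m)"
  shows "P n"
proof -
  have e: "elts (mkset {x \<in> elts omega. P x}) = {x \<in> elts omega. P x}"
    by (intro elts_mkset sepI assms(2))
  have "emp \<in> elts (mkset {x \<in> elts omega. P x})"
    "\<forall>x\<in>elts (mkset {x \<in> elts omega. P x}). succ x \<in> elts (mkset {x \<in> elts omega. P x})"
    unfolding e using assms(3,4) succ_in_omega by auto
  then have "n \<in> elts (mkset {x \<in> elts omega. P x})" using assms(1) unfolding elts_omega by blast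
  then show ?thesis unfolding e by simp
qed

lemma elts_succ [simp]: "elts (succ n) = insert n (elts n)"
  by (simp add: succ_eq_ins)

lemma omega_trans: "n \<in> elts omega \<Longrightarrow> x \<in> elts n \<Longrightarrow> elts x \<subseteq> elts n \<and> x \<in> elts omega"
proof -
  assume n: "n \<in> elts omega"
  have "\<forall>x\<in>elts n. elts x \<subseteq> elts n \<and> x \<in> elts omega"
    by (rule omega_induct[OF n]) (intro D2, auto)
  then show "x \<in> elts n \<Longrightarrow> elts x \<subseteq> elts n \<and> x \<in> elts omega" by blast
qed

text \<open>Foundation is applied to the set with elements \<open>a\<close> and \<open>b\<close>;
  the case \<open>a = b\<close> yields irreflexivity.\<close>

lemma no_two_cycle: "a \<in> elts b \<Longrightarrow> b \<notin> elts a"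
  using foundation[rule_format, of "mkset {a, b}"]
  unfolding elts_def[symmetric] mem_Collect_eq
  by (metis elts_def elts_two insert_iff mem_Collect_eq singletonD)

lemma mem_irrefl [simp]: "a \<notin> elts a" using no_two_cycle by blast

lemma succ_inject [simp]: "succ a = succ b \<longleftrightarrow> a = b"
  using no_two_cycle elts_succ by (metis insert_iff)

lemma succ_neq_emp [simp]: "succ a \<noteq> emp" "emp \<noteq> succ a"
  using elts_succ elts_emp by (metis empty_iff insertI1)+

lemma num_inject [simp]: "num i = num j \<longleftrightarrow> i = j"
proof (induction i arbitrary: j)
  case 0
  show ?case by (cases j) (simp_all add: num_0 del: num.simps(1))
next
  case (Suc i)
  show ?case by (cases j) (simp_all add: Suc num_0 del: num.simps(1))
qed

declare num.simps [simp del]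

lemma emp_in_succ: "n \<in> elts omega \<Longrightarrow> emp \<in> elts (succ n)"
  by (rule omega_induct[of n "\<lambda>n. emp \<in> elts (succ n)"]) (assumption, intro D2, auto)

text \<open>Kuratowski finiteness in the sense of the model. No bijection with a number is involved,
  and induction along the adjunction of elements is built in.\<close>

definition fin :: "'v \<Rightarrow> bool" where
  "fin V \<longleftrightarrow> (\<forall>W. emp \<in> elts W \<and> (\<forall>Y\<in>elts W. \<forall>x\<in>elts V. ins x Y \<in> elts W) \<longrightarrow> V \<in> elts W)"

lemma dfn_fin: "dft t \<Longrightarrow> dfn (\<lambda>s. fin (t s))"
  by (rule dfn1) (unfold fin_def, intro D2)

text \<open>Separation takes place inside the power set of \<open>V\<close>; this is why the
  induction step may assume that \<open>Y\<close> is a subset of \<open>V\<close>.\<close>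

lemma fin_induct:
  assumes "fin V" "dfn (\<lambda>s. P (s 0))" "P emp"
    "\<And>Y x. elts Y \<subseteq> elts V \<Longrightarrow> x \<in> elts V \<Longrightarrow> P Y \<Longrightarrow> P (ins x Y)"
  shows "P V"
proof -
  let ?W = "mkset {Y \<in> elts (pow V). P Y}"
  have e: "elts ?W = {Y \<in> elts (pow V). P Y}" by (intro elts_mkset sepI assms(2))
  have "emp \<in> elts ?W \<and> (\<forall>Y\<in>elts ?W. \<forall>x\<in>elts V. ins x Y \<in> elts ?W)"
    unfolding e using assms(3,4) by auto
  then have "V \<in> elts ?W" using assms(1) unfolding fin_def by blast
  then show ?thesis unfolding e by simp
qed

lemma fin_emp: "fin emp" unfolding fin_def by blast

lemma fin_ins: "fin Y \<Longrightarrow> fin (ins x Y)"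
  unfolding fin_def by (metis elts_ins insertCI)

lemma fin_un: "fin X \<Longrightarrow> fin Y \<Longrightarrow> fin (un X Y)"
proof -
  assume X: "fin X" and Y: "fin Y"
  show "fin (un X Y)"
  proof (rule fin_induct[OF X, where P = "\<lambda>X. fin (un X Y)"])
    show "dfn (\<lambda>s. fin (un (s 0) Y))" by (intro D2 dfn_fin)
    have "un emp Y = Y" by (rule elts_ext) simp
    then show "fin (un emp Y)" using Y by simp
    show "fin (un (ins x Z) Y)" if "fin (un Z Y)" for Z x
    proof -
      have "un (ins x Z) Y = ins x (un Z Y)" by (rule elts_ext) simp
      then show ?thesis using fin_ins[OF that] by simp
    qed
  qed
qed

lemma fin_image:
  assumes X: "fin X" and g: "dft (\<lambda>s. g (s 0))"
  shows "fin (mkset (g ` elts X))"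
proof (rule fin_induct[OF X, where P = "\<lambda>X. fin (mkset (g ` elts X))"])
  show "dfn (\<lambda>s. fin (mkset (g ` elts (s 0))))"
    unfolding image_def by (intro D2 dfn_fin dft1[OF g])
  show "fin (mkset (g ` elts emp))" using fin_emp by (simp add: emp_def[symmetric])
  show "fin (mkset (g ` elts (ins x Z)))" if "fin (mkset (g ` elts Z))" for Z x
  proof -
    have "mkset (g ` elts (ins x Z)) = ins (g x) (mkset (g ` elts Z))"
      by (rule elts_ext) (simp add: elts_mkset replI[OF g] isset_insert)
    then show ?thesis using fin_ins[OF that] by simp
  qed
qed

lemma fin_omega: "n \<in> elts omega \<Longrightarrow> fin n"
  by (rule omega_induct[of n fin]) (assumption, intro dfn_fin D2, simp_all add: fin_emp fin_ins succ_eq_ins)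

text \<open>Finite choice is a theorem of ZF: a function on \<open>Y\<close> is extended by a single
  pair. The existence of the function is the predicate of the induction, so it is phrased with
  \<open>ap\<close> to be definable.\<close>

lemma fin_choice:
  assumes V: "fin V" and R: "dfn (\<lambda>s. R (s 0) (s 1))" and ex: "\<And>k. k \<in> elts V \<Longrightarrow> \<exists>y. R k y"
  shows "\<exists>u. func_on u V \<and> (\<forall>k\<in>elts V. R k (u \<cdot> k))"
proof -
  have "\<exists>u. func_on u V \<and> (\<forall>k\<in>elts V. R k (ap u k))"
  proof (rule fin_induct[OF V, where P = "\<lambda>V. \<exists>u. func_on u V \<and> (\<forall>k\<in>elts V. R k (ap u k))"])
    show "dfn (\<lambda>s. \<exists>u. func_on u (s 0) \<and> (\<forall>k\<in>elts (s 0). R k (ap u k)))"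
      by (intro D2 dfn2[OF R])
    show "\<exists>u. func_on u emp \<and> (\<forall>k\<in>elts emp. R k (ap u k))"
      by (intro exI[of _ emp]) (auto simp: func_on_def)
    fix Y x
    assume "x \<in> elts V" "\<exists>u. func_on u Y \<and> (\<forall>k\<in>elts Y. R k (ap u k))"
    then obtain u y where u: "func_on u Y" "\<forall>k\<in>elts Y. R k (u \<cdot> k)" and y: "R x y"
      using ex app_ap by metis
    show "\<exists>u. func_on u (ins x Y) \<and> (\<forall>k\<in>elts (ins x Y). R k (ap u k))"
    proof (cases "x \<in> elts Y")
      case True
      then have "ins x Y = Y" by (intro elts_ext) auto
      then show ?thesis using u app_ap by metis
    next
      case False
      have "func_on (ins (opair x y) u) (ins x Y)" by (rule func_extend[OF u(1) False])
      moreover have "\<forall>k\<in>elts (ins x Y). R k (ins (opair x y) u \<cdot> k)"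
        using func_extend[OF u(1) False] u(2) y by auto
      ultimately show ?thesis using app_ap by metis
    qed
  qed
  then show ?thesis using app_ap by metis
qed

text \<open>Finite sets that witness monotone conditions are united along a finite index set. It is
  used to find finitely many variables on which all entries of a tuple, or all literals of a
  formula, depend.\<close>

lemma fin_bound:
  assumes V: "fin V" and Q: "dfn (\<lambda>s. Q (s 0) (s 1))"
    and ex: "\<And>k. k \<in> elts V \<Longrightarrow> \<exists>W. fin W \<and> elts W \<subseteq> A \<and> Q k W"
    and A: "dfn (\<lambda>s. s 0 \<in> A)"
    and mono: "\<And>k W W'. Q k W \<Longrightarrow> elts W \<subseteq> elts W' \<Longrightarrow> elts W' \<subseteq> A \<Longrightarrow> Q k W'"
  shows "\<exists>W. fin W \<and> elts W \<subseteq> A \<and> (\<forall>k\<in>elts V. Q k W)"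
proof (rule fin_induct[OF V, where P = "\<lambda>V. \<exists>W. fin W \<and> elts W \<subseteq> A \<and> (\<forall>k\<in>elts V. Q k W)"])
  show "dfn (\<lambda>s. \<exists>W. fin W \<and> elts W \<subseteq> A \<and> (\<forall>k\<in>elts (s 0). Q k W))"
    unfolding subset_eq by (intro D2 dfn2[OF Q] dfn_fin dfn1[where R = "\<lambda>x. x \<in> A", OF A])
  show "\<exists>W. fin W \<and> elts W \<subseteq> A \<and> (\<forall>k\<in>elts emp. Q k W)" using fin_emp by (intro exI[of _ emp]) auto
  fix Y x
  assume "x \<in> elts V" "\<exists>W. fin W \<and> elts W \<subseteq> A \<and> (\<forall>k\<in>elts Y. Q k W)"
  then obtain W W' where W: "fin W" "elts W \<subseteq> A" "\<forall>k\<in>elts Y. Q k W" "fin W'" "elts W' \<subseteq> A" "Q x W'"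
    using ex by metis
  then show "\<exists>W. fin W \<and> elts W \<subseteq> A \<and> (\<forall>k\<in>elts (ins x Y). Q k W)"
    using mono[of _ W "un W W'"] mono[of x W' "un W W'"]
    by (intro exI[of _ "un W W'"]) (auto simp: fin_un)
qed

subsection \<open>Well-founded recursion\<close>

text \<open>Approximations are solutions on downward closed subsets of \<open>M\<close>. They agree
  where they overlap, so their union \<open>v0\<close> is again an approximation, and it is total
  because it could otherwise be extended by one point. Well-foundedness enters as an induction
  principle for definable predicates, the only form available inside the model.\<close>

lemma wf_rec:
  assumes R: "dfn (\<lambda>s. R (s 0) (s 1))" and H: "dft (\<lambda>s. H (s 0) (s 1))"
    and ind: "\<And>P. dfn (\<lambda>s. P (s 0)) \<Longrightarrow>
      (\<And>x. x \<in> elts M \<Longrightarrow> (\<And>y. y \<in> elts M \<Longrightarrow> R y x \<Longrightarrow> P y) \<Longrightarrow> P x) \<Longrightarrow> \<forall>x\<in>elts M. P x"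
    and local: "\<And>x w w'. x \<in> elts M \<Longrightarrow> (\<And>y. y \<in> elts M \<Longrightarrow> R y x \<Longrightarrow> ap w y = ap w' y) \<Longrightarrow> H x w = H x w'"
  shows "\<exists>v. func_on v M \<and> (\<forall>x\<in>elts M. v \<cdot> x = H x v)"
proof -
  define appr where "appr w D \<longleftrightarrow> elts D \<subseteq> elts M \<and> (\<forall>x\<in>elts D. \<forall>y\<in>elts M. R y x \<longrightarrow> y \<in> elts D) \<and>
    func_on w D \<and> (\<forall>x\<in>elts D. ap w x = H x w)" for w D
  have dappr: "dft t \<Longrightarrow> dft u \<Longrightarrow> dfn (\<lambda>s. appr (t s) (u s))" for t u
    by (rule dfn2) (unfold appr_def, intro D2 dfn2[OF R] dft2[OF H])
  have agree: "ap w x = ap w' x" if "appr w D" "appr w' D'" "x \<in> elts D" "x \<in> elts D'" for w D w' D' x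
  proof -
    have "\<forall>x\<in>elts M. x \<in> elts D \<and> x \<in> elts D' \<longrightarrow> ap w x = ap w' x"
    proof (rule ind)
      fix x assume x: "x \<in> elts M" and IH: "\<And>y. y \<in> elts M \<Longrightarrow> R y x \<Longrightarrow> y \<in> elts D \<and> y \<in> elts D' \<longrightarrow> ap w y = ap w' y"
      show "x \<in> elts D \<and> x \<in> elts D' \<longrightarrow> ap w x = ap w' x"
      proof
        assume D: "x \<in> elts D \<and> x \<in> elts D'"
        then have "H x w = H x w'" using that(1,2) x IH unfolding appr_def by (intro local) blast+
        then show "ap w x = ap w' x" using that(1,2) D unfolding appr_def by simp
      qed
    qed (intro D2)
    then show ?thesis using that unfolding appr_def by blast
  qed
  define D0 where "D0 = mkset {x \<in> elts M. \<exists>w D. appr w D \<and> x \<in> elts D}"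
  have eD0: "elts D0 = {x \<in> elts M. \<exists>w D. appr w D \<and> x \<in> elts D}"
    unfolding D0_def by (intro elts_mkset sepI D2 dappr)
  \<comment> \<open>All approximations defined at \<open>x\<close> have the same value there, so the
    union over all of them is this value and none has to be selected.\<close>
  define val where "val x = mkset {z. \<exists>w D. appr w D \<and> x \<in> elts D \<and> z \<in> elts (ap w x)}" for x
  have val: "val x = ap w x" if "appr w D" "x \<in> elts D" for x w D
  proof -
    have "{z. \<exists>w D. appr w D \<and> x \<in> elts D \<and> z \<in> elts (ap w x)} = elts (ap w x)"
    proof (intro equalityI subsetI)
      fix z assume "z \<in> {z. \<exists>w D. appr w D \<and> x \<in> elts D \<and> z \<in> elts (ap w x)}"
      then obtain w' D' where w': "appr w' D'" "x \<in> elts D'" "z \<in> elts (ap w' x)" by blast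
      then show "z \<in> elts (ap w x)" using agree[OF w'(1) that(1) w'(2) that(2)] by simp
    qed (use that in blast)
    then show ?thesis unfolding val_def by simp
  qed
  define v0 where "v0 = lam D0 val"
  have ok: "lam_ok D0 val" by (rule lam_okI, unfold val_def, intro D2 dappr)
  have fv0: "func_on v0 D0" and v0: "x \<in> elts D0 \<Longrightarrow> ap v0 x = val x" for x
    unfolding v0_def using func_lam[OF ok] lam_app[OF ok] app_ap by metis+
  have D0: "appr v0 D0"
    unfolding appr_def
  proof (intro conjI ballI impI)
    show "elts D0 \<subseteq> elts M" "func_on v0 D0" using eD0 fv0 by auto
    fix x assume "x \<in> elts D0"
    then obtain w D where w: "appr w D" "x \<in> elts D" "x \<in> elts M" using eD0 by auto
    show "y \<in> elts D0" if "y \<in> elts M" "R y x" for y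
      using that w unfolding eD0 appr_def by blast
    have "H x w = H x v0"
    proof (rule local[OF w(3)])
      fix y assume "y \<in> elts M" "R y x"
      then have "y \<in> elts D" using w unfolding appr_def by blast
      then have "y \<in> elts D0" using w(1) \<open>y \<in> elts M\<close> unfolding eD0 by blast
      show "ap w y = ap v0 y" unfolding v0[OF \<open>y \<in> elts D0\<close>] val[OF w(1) \<open>y \<in> elts D\<close>] ..
    qed
    then show "ap v0 x = H x v0"
      using w v0[OF \<open>x \<in> elts D0\<close>] val[OF w(1,2)] unfolding appr_def by simp
  qed
  have "\<forall>x\<in>elts M. x \<in> elts D0"
  proof (rule ind)
    fix x assume x: "x \<in> elts M" and IH: "\<And>y. y \<in> elts M \<Longrightarrow> R y x \<Longrightarrow> y \<in> elts D0"
    show "x \<in> elts D0"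
    proof (rule ccontr)
      assume nx: "x \<notin> elts D0"
      \<comment> \<open>If \<open>x\<close> is missed although all its predecessors are covered, one
        more pair gives an approximation that covers \<open>x\<close>.\<close>
      let ?v = "ins (opair x (H x v0)) v0"
      note ext = func_extend[OF fv0 nx, where y = "H x v0"]
      have same: "ap ?v k = ap v0 k" if "k \<in> elts D0" for k
        using ext(3)[OF that] app_ap[OF ext(1)] app_ap[OF fv0] that by simp
      have vx: "ap ?v x = H x v0" using ext(2) app_ap[OF ext(1), of x] by simp
      have R: "y \<in> elts D0" if "y \<in> elts M" "R y k" "k \<in> elts (ins x D0)" for y k
        using that IH D0 unfolding appr_def by auto
      have Hs: "H k ?v = H k v0" if "k \<in> elts (ins x D0)" for k
        using that R same x eD0 by (intro local) auto
      have "appr ?v (ins x D0)"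
        unfolding appr_def
        using ext(1) vx same Hs R x D0 unfolding appr_def by auto
      moreover have "x \<in> elts (ins x D0)" by simp
      ultimately have "x \<in> elts D0" unfolding eD0 using x by blast
      then show False using nx by blast
    qed
  qed (intro D2)
  then have "D0 = M" using eD0 by (intro elts_ext) blast
  then show ?thesis using D0 app_ap unfolding appr_def by metis
qed

section \<open>Recursion and closure along the natural numbers\<close>

lemma succ_mem_or_eq: "m \<in> elts omega \<Longrightarrow> n \<in> elts m \<Longrightarrow> succ n \<in> elts m \<or> succ n = m"
proof -
  assume m: "m \<in> elts omega"
  have "\<forall>n\<in>elts m. succ n \<in> elts m \<or> succ n = m"
    by (rule omega_induct[OF m]) (intro D2, auto)
  then show "n \<in> elts m \<Longrightarrow> succ n \<in> elts m \<or> succ n = m" by blast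
qed

lemma emp_mem: "m \<in> elts omega \<Longrightarrow> m = emp \<or> emp \<in> elts m"
  by (rule omega_induct[of m]) (assumption, intro D2, auto)

lemma omega_linear: "m \<in> elts omega \<Longrightarrow> n \<in> elts omega \<Longrightarrow> m \<in> elts n \<or> m = n \<or> n \<in> elts m"
proof -
  assume m: "m \<in> elts omega" and n: "n \<in> elts omega"
  show ?thesis
  proof (rule omega_induct[OF n, where P = "\<lambda>n. m \<in> elts n \<or> m = n \<or> n \<in> elts m"])
    show "m \<in> elts emp \<or> m = emp \<or> emp \<in> elts m" using emp_mem[OF m] by simp
    show "m \<in> elts (succ k) \<or> m = succ k \<or> succ k \<in> elts m"
      if "m \<in> elts k \<or> m = k \<or> k \<in> elts m" for k
      using that succ_mem_or_eq[OF m, of k] by auto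
  qed (intro D2)
qed

lemma omega_rec:
  assumes G: "dft (\<lambda>s. G (s 0))"
  shows "\<exists>v. func_on v omega \<and> ap v emp = a \<and> (\<forall>n\<in>elts omega. ap v (succ n) = G (ap v n))"
proof -
  \<comment> \<open>The distinction between zero and successor is made at the level of elements; in
    this form \<open>H\<close> is definable without a predecessor operation.\<close>
  define H where "H n w = mkset {z. (n = emp \<and> z \<in> elts a) \<or> (\<exists>m\<in>elts omega. n = succ m \<and> z \<in> elts (G (ap w m)))}"
    for n w
  have "\<exists>v. func_on v omega \<and> (\<forall>x\<in>elts omega. v \<cdot> x = H x v)"
  proof (rule wf_rec[where R = "\<lambda>y x. x = succ y"])
    show "dfn (\<lambda>s. s 1 = succ (s 0))" by (intro D2)
    show "dft (\<lambda>s. H (s 0) (s 1))" unfolding H_def by (intro D2 dft1[OF G])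
    fix P assume P: "dfn (\<lambda>s. P (s 0))" and step: "\<And>x. x \<in> elts omega \<Longrightarrow> (\<And>y. y \<in> elts omega \<Longrightarrow> x = succ y \<Longrightarrow> P y) \<Longrightarrow> P x"
    show "\<forall>x\<in>elts omega. P x"
    proof
      fix n assume "n \<in> elts omega"
      then show "P n"
      proof (rule omega_induct[OF _ P])
        show "P emp" by (rule step) auto
        show "P (succ m)" if "m \<in> elts omega" "P m" for m
          by (rule step[OF succ_in_omega[OF that(1)]]) (use that in simp)
      qed
    qed
  next
    fix x w w' assume "\<And>y. y \<in> elts omega \<Longrightarrow> x = succ y \<Longrightarrow> ap w y = ap w' y"
    then show "H x w = H x w'" unfolding H_def by (intro arg_cong[where f = mkset]) auto
  qed
  then obtain v where v: "func_on v omega" "\<forall>x\<in>elts omega. ap v x = H x v" using app_ap by auto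
  have "ap v emp = a" using v(2) by (simp add: H_def)
  moreover have "ap v (succ n) = G (ap v n)" if "n \<in> elts omega" for n
  proof -
    have "{z. \<exists>m\<in>elts omega. n = m \<and> z \<in> elts (G (ap v m))} = elts (G (ap v n))" using that by auto
    then show ?thesis using v(2) that succ_in_omega by (simp add: H_def)
  qed
  ultimately show ?thesis using v(1) by blast
qed

text \<open>\<open>Z\<close> is the \<open>\<omega>\<close>-th iterate of \<open>G\<close>; a finite subset is contained in one of the stages.\<close>

lemma finitary_closure:
  assumes G: "dft (\<lambda>s. G (s 0))" and inc: "\<And>X. elts X \<subseteq> elts (G X)"
  shows "\<exists>Z. elts a \<subseteq> elts Z \<and> (\<forall>V. fin V \<and> elts V \<subseteq> elts Z \<longrightarrow> (\<exists>X. elts V \<subseteq> elts X \<and> elts (G X) \<subseteq> elts Z))"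
proof -
  obtain v where v: "func_on v omega" "ap v emp = a" "\<And>n. n \<in> elts omega \<Longrightarrow> ap v (succ n) = G (ap v n)"
    using omega_rec[OF G] by blast
  have "isset (ap v ` elts omega)" by (intro replI D2)
  then have "isset (\<Union>x\<in>ap v ` elts omega. elts x)"
    using isset_Union[of "mkset (ap v ` elts omega)"] by (simp add: elts_mkset)
  then obtain Z where Z: "elts Z = (\<Union>n\<in>elts omega. elts (ap v n))" unfolding isset_def by auto
  have up: "\<forall>m\<in>elts n. elts (ap v m) \<subseteq> elts (ap v n)" if "n \<in> elts omega" for n
    by (rule omega_induct[OF that]) (intro D2, simp, use inc v(3) in auto)
  have chain: "elts (ap v m) \<subseteq> elts (ap v n) \<or> elts (ap v n) \<subseteq> elts (ap v m)"
    if "m \<in> elts omega" "n \<in> elts omega" for m n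
    using omega_linear[OF that] up that by auto
  have bound: "\<exists>n\<in>elts omega. elts V \<subseteq> elts (ap v n)" if V: "fin V" "elts V \<subseteq> elts Z" for V
  proof (rule fin_induct[OF V(1), where P = "\<lambda>V. \<exists>n\<in>elts omega. elts V \<subseteq> elts (ap v n)"])
    show "\<exists>n\<in>elts omega. elts emp \<subseteq> elts (ap v n)" by (rule bexI[of _ emp]) auto
    fix Y x assume "x \<in> elts V" "\<exists>n\<in>elts omega. elts Y \<subseteq> elts (ap v n)"
    then obtain n m where nm: "n \<in> elts omega" "m \<in> elts omega" "elts Y \<subseteq> elts (ap v n)" "x \<in> elts (ap v m)"
      using V(2) Z by auto
    then show "\<exists>n\<in>elts omega. elts (ins x Y) \<subseteq> elts (ap v n)"
      using chain[OF nm(1,2)] by auto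
  qed (intro D2)
  have "elts a \<subseteq> elts Z" using v(2) emp_in_omega unfolding Z by blast
  moreover have "\<exists>X. elts V \<subseteq> elts X \<and> elts (G X) \<subseteq> elts Z" if V: "fin V" "elts V \<subseteq> elts Z" for V
  proof -
    obtain n where n: "n \<in> elts omega" "elts V \<subseteq> elts (ap v n)" using bound[OF V] by blast
    have "elts (G (ap v n)) \<subseteq> elts Z" unfolding Z v(3)[OF n(1), symmetric] using succ_in_omega[OF n(1)] by blast
    then show ?thesis using n(2) by blast
  qed
  ultimately show ?thesis by blast
qed

section \<open>Composition and bounds for tuples\<close>

lemma lam_ok_comp: "maps u n X \<Longrightarrow> func_on h X \<Longrightarrow> lam_ok n (\<lambda>k. h \<cdot> (u \<cdot> k))"
  by (rule lam_okI'[where h = "\<lambda>k. ap h (ap u k)"], intro D2)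
    (metis maps_app_ap maps_app app_ap)

lemma maps_comp: "maps u n X \<Longrightarrow> maps h X Y \<Longrightarrow> maps (lam n (\<lambda>k. h \<cdot> (u \<cdot> k))) n Y"
  by (rule maps_lam) (auto intro: lam_ok_comp maps_func maps_app)

lemma maps_subset_cart: "maps f X Y \<Longrightarrow> elts f \<subseteq> elts (cart X Y)"
  using func_elts[OF maps_func] maps_app by fastforce

lemma cart_mono: "elts a \<subseteq> elts b \<Longrightarrow> elts (cart a c) \<subseteq> elts (cart b c)"
  by (auto simp: elts_cart)

lemma omega_subset: "n \<in> elts omega \<Longrightarrow> elts n \<subseteq> elts omega"
  using omega_trans by blast

lemma tuple_in_pow: "n \<in> elts omega \<Longrightarrow> maps ts n X \<Longrightarrow> ts \<in> elts (pow (cart omega X))"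
  using order_trans[OF maps_subset_cart cart_mono[OF omega_subset]] by simp

lemma fin_range: "n \<in> elts omega \<Longrightarrow> func_on ts n \<Longrightarrow> fin (mkset (ap ts ` elts n))"
  by (intro fin_image fin_omega D2)

lemma elts_range: "elts (mkset (ap ts ` elts n)) = ap ts ` elts n"
  by (intro elts_mkset replI D2)

subsection \<open>Terms\<close>

lemma Var_inject [simp]: "Var m = Var n \<longleftrightarrow> m = n"
  and Fn_inject [simp]: "Fn f ts = Fn g us \<longleftrightarrow> f = g \<and> ts = us"
  and Var_neq_Fn [simp]: "Var n \<noteq> Fn f ts" "Fn f ts \<noteq> Var n"
  by (auto simp: Var_def Fn_def)

lemma Eq_inject [simp]: "Eq t u = Eq t' u' \<longleftrightarrow> t = t' \<and> u = u'"
  and Rel_inject [simp]: "Rel r ts = Rel r' ts' \<longleftrightarrow> r = r' \<and> ts = ts'"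
  and Neg_inject [simp]: "Neg \<phi> = Neg \<phi>' \<longleftrightarrow> \<phi> = \<phi>'"
  and Disj_inject [simp]: "Disj \<phi> \<psi> = Disj \<phi>' \<psi>' \<longleftrightarrow> \<phi> = \<phi>' \<and> \<psi> = \<psi>'"
  and Exists_inject [simp]: "Exists n \<phi> = Exists n' \<phi>' \<longleftrightarrow> n = n' \<and> \<phi> = \<phi>'"
  by (auto simp: Eq_def Rel_def Neg_def Disj_def Exists_def)

lemma fm_distinct [simp]:
  "Eq t u \<noteq> Rel r ts" "Eq t u \<noteq> Neg \<phi>" "Eq t u \<noteq> Disj \<phi> \<psi>" "Eq t u \<noteq> Exists n \<phi>"
  "Rel r ts \<noteq> Eq t u" "Rel r ts \<noteq> Neg \<phi>" "Rel r ts \<noteq> Disj \<phi> \<psi>" "Rel r ts \<noteq> Exists n \<phi>"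
  "Neg \<phi>' \<noteq> Eq t u" "Neg \<phi>' \<noteq> Rel r ts" "Neg \<phi>' \<noteq> Disj \<phi> \<psi>" "Neg \<phi>' \<noteq> Exists n \<phi>"
  "Disj \<phi>' \<psi> \<noteq> Eq t u" "Disj \<phi>' \<psi> \<noteq> Rel r ts" "Disj \<phi>' \<psi> \<noteq> Neg \<phi>" "Disj \<phi>' \<psi> \<noteq> Exists n \<phi>"
  "Exists n \<phi>' \<noteq> Eq t u" "Exists n \<phi>' \<noteq> Rel r ts" "Exists n \<phi>' \<noteq> Neg \<phi>" "Exists n \<phi>' \<noteq> Disj \<phi> \<psi>"
  by (auto simp: Eq_def Rel_def Neg_def Disj_def Exists_def)

lemma dft_Var: "dft t \<Longrightarrow> dft (\<lambda>s. Var (t s))" unfolding Var_def by (intro D2)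
lemma dft_Fn: "dft t \<Longrightarrow> dft u \<Longrightarrow> dft (\<lambda>s. Fn (t s) (u s))" unfolding Fn_def by (intro D2)
lemma dft_Eq: "dft t \<Longrightarrow> dft u \<Longrightarrow> dft (\<lambda>s. Eq (t s) (u s))" unfolding Eq_def by (intro D2)
lemma dft_Rel: "dft t \<Longrightarrow> dft u \<Longrightarrow> dft (\<lambda>s. Rel (t s) (u s))" unfolding Rel_def by (intro D2)
lemma dft_Neg: "dft t \<Longrightarrow> dft (\<lambda>s. Neg (t s))" unfolding Neg_def by (intro D2)
lemma dft_Disj: "dft t \<Longrightarrow> dft u \<Longrightarrow> dft (\<lambda>s. Disj (t s) (u s))" unfolding Disj_def by (intro D2)
lemma dft_Exists: "dft t \<Longrightarrow> dft u \<Longrightarrow> dft (\<lambda>s. Exists (t s) (u s))" unfolding Exists_def by (intro D2)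
lemma dft_carrier: "dft t \<Longrightarrow> dft (\<lambda>s. carrier (t s))" unfolding carrier_def by (intro D2)
lemma dft_rels: "dft t \<Longrightarrow> dft (\<lambda>s. rels (t s))" unfolding rels_def by (intro D2)
lemma dft_funs: "dft t \<Longrightarrow> dft (\<lambda>s. funs (t s))" unfolding funs_def by (intro D2)

lemmas D3 = D2 dft_Var dft_Fn dft_Eq dft_Rel dft_Neg dft_Disj dft_Exists dft_carrier dft_rels dft_funs
  dfn_fin

end

locale ZF_signature = ZF_model +
  fixes S :: 'a
  assumes signature: "is_signature S"
begin

abbreviation "T \<equiv> terms S"
abbreviation "Fs \<equiv> fun_syms S"
abbreviation "Rs \<equiv> rel_syms S"
abbreviation "far f \<equiv> fun_ar S \<cdot> f"
abbreviation "rar r \<equiv> rel_ar S \<cdot> r"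

lemma far_omega: "f \<in> elts Fs \<Longrightarrow> far f \<in> elts omega"
  and rar_omega: "r \<in> elts Rs \<Longrightarrow> rar r \<in> elts omega"
  and far_ap: "f \<in> elts Fs \<Longrightarrow> far f = ap (fun_ar S) f"
  and rar_ap: "r \<in> elts Rs \<Longrightarrow> rar r = ap (rel_ar S) r"
  using signature unfolding is_signature_def by (auto simp: maps_def app_ap)

definition term_closed :: "'a \<Rightarrow> bool" where
  "term_closed X \<longleftrightarrow> (\<forall>n\<in>elts omega. Var n \<in> elts X) \<and>
    (\<forall>f\<in>elts Fs. \<forall>ts. maps ts (far f) X \<longrightarrow> Fn f ts \<in> elts X)"

lemma term_closed_ap: "term_closed X \<longleftrightarrow> (\<forall>n\<in>elts omega. Var n \<in> elts X) \<and>
    (\<forall>f\<in>elts Fs. \<forall>ts. maps ts (ap (fun_ar S) f) X \<longrightarrow> Fn f ts \<in> elts X)"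
  unfolding term_closed_def by (auto simp: far_ap)

text \<open>The intersection in \<open>terms\<close> is a set only if some closed set exists. One
  arises from the variables by adding one layer of function symbols again and again: the entries of
  a finite tuple from the union all appear at a common stage.\<close>

lemma term_closed_ex: "\<exists>X. term_closed X"
proof -
  define G where "G X = mkset {t. t \<in> elts X \<or> (\<exists>f\<in>elts Fs. \<exists>ts. maps ts (ap (fun_ar S) f) X \<and> t = Fn f ts)}" for X
  have G: "dft (\<lambda>s. G (s 0))" unfolding G_def by (intro D3)
  have eG: "elts (G X) = {t. t \<in> elts X \<or> (\<exists>f\<in>elts Fs. \<exists>ts. maps ts (ap (fun_ar S) f) X \<and> t = Fn f ts)}" for X
    unfolding G_def
  proof (rule elts_mkset, rule isset_Collect[where a = "un X (cart (mkset {num 1}) (cart Fs (pow (cart omega X))))"])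
    show "dfn (\<lambda>s. s 0 \<in> elts X \<or> (\<exists>f\<in>elts Fs. \<exists>ts. maps ts (ap (fun_ar S) f) X \<and> s 0 = Fn f ts))" by (intro D3)
    have ts: "ts \<in> elts (pow (cart omega X))" if "f \<in> elts Fs" "maps ts (ap (fun_ar S) f) X" for f ts
      using tuple_in_pow[OF far_omega[OF that(1)]] that far_ap by simp
    fix t assume "t \<in> elts X \<or> (\<exists>f\<in>elts Fs. \<exists>ts. maps ts (ap (fun_ar S) f) X \<and> t = Fn f ts)"
    then show "t \<in> elts (un X (cart (mkset {num 1}) (cart Fs (pow (cart omega X)))))"
      using ts by (auto simp: Fn_def simp del: elts_pow)
  qed
  have V: "elts (mkset (Var ` elts omega)) = Var ` elts omega" by (intro elts_mkset replI D3)
  have "elts X \<subseteq> elts (G X)" for X unfolding eG by blast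
  from finitary_closure[OF G this] obtain Z where Z: "elts (mkset (Var ` elts omega)) \<subseteq> elts Z"
    "\<forall>V. fin V \<and> elts V \<subseteq> elts Z \<longrightarrow> (\<exists>X. elts V \<subseteq> elts X \<and> elts (G X) \<subseteq> elts Z)"
    by blast
  have "Fn f ts \<in> elts Z" if f: "f \<in> elts Fs" and ts: "maps ts (far f) Z" for f ts
  proof -
    have "ap ts ` elts (far f) \<subseteq> elts Z" using ts unfolding maps_ap by auto
    then obtain X where X: "ap ts ` elts (far f) \<subseteq> elts X" "elts (G X) \<subseteq> elts Z"
      using Z(2)[rule_format, of "mkset (ap ts ` elts (far f))"] fin_range[OF far_omega[OF f] maps_func[OF ts]]
      unfolding elts_range by blast
    have "maps ts (ap (fun_ar S) f) X" using X(1) ts f unfolding maps_ap by (auto simp: far_ap)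
    then show ?thesis using f X(2) unfolding eG by blast
  qed
  then have "term_closed Z" unfolding term_closed_def using Z(1)[unfolded V] by blast
  then show ?thesis ..
qed

lemma elts_terms: "elts T = {t. \<forall>X. term_closed X \<longrightarrow> t \<in> elts X}"
proof -
  obtain X where "term_closed X" using term_closed_ex ..
  then show ?thesis unfolding terms_def term_closed_def[symmetric]
    by (intro elts_mkset isset_Collect[where a = X]) (unfold term_closed_ap, intro D3, blast)
qed

lemma Var_in_terms [simp]: "n \<in> elts omega \<Longrightarrow> Var n \<in> elts T"
  unfolding elts_terms term_closed_def by auto

lemma Fn_in_terms: "f \<in> elts Fs \<Longrightarrow> maps ts (far f) T \<Longrightarrow> Fn f ts \<in> elts T"
proof -
  assume f: "f \<in> elts Fs" and ts: "maps ts (far f) T"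
  have "Fn f ts \<in> elts X" if X: "term_closed X" for X
  proof -
    have "elts T \<subseteq> elts X" using X unfolding elts_terms by blast
    then have "maps ts (far f) X" using ts maps_mono by blast
    then show ?thesis using X f unfolding term_closed_def by blast
  qed
  then show ?thesis unfolding elts_terms by blast
qed

lemma term_induct:
  assumes P: "dfn (\<lambda>s. P (s 0))" and V: "\<And>n. n \<in> elts omega \<Longrightarrow> P (Var n)"
    and F: "\<And>f ts. f \<in> elts Fs \<Longrightarrow> maps ts (far f) T \<Longrightarrow> (\<And>k. k \<in> elts (far f) \<Longrightarrow> P (ts \<cdot> k)) \<Longrightarrow> P (Fn f ts)"
  shows "\<forall>t\<in>elts T. P t"
proof -
  let ?X = "mkset {t \<in> elts T. P t}"
  have e: "elts ?X = {t \<in> elts T. P t}" by (intro elts_mkset sepI P)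
  have "term_closed ?X" unfolding term_closed_def e
  proof (intro conjI ballI allI impI)
    fix f ts assume f: "f \<in> elts Fs" and ts: "maps ts (far f) ?X"
    have "maps ts (far f) T" using maps_mono[OF ts] e by auto
    moreover have "P (ts \<cdot> k)" if "k \<in> elts (far f)" for k using maps_app[OF ts that] e by simp
    ultimately show "Fn f ts \<in> {t \<in> elts T. P t}" using Fn_in_terms F f by blast
  qed (use V in simp)
  then have "elts T \<subseteq> elts ?X" unfolding elts_terms by blast
  then show ?thesis unfolding e by blast
qed

lemma structureD:
  assumes "is_structure S A"
  shows "func_on (rels A) Rs" "func_on (funs A) Fs" "elts (carrier A) \<noteq> {}"
    "r \<in> elts Rs \<Longrightarrow> a \<in> elts (rels A \<cdot> r) \<Longrightarrow> maps a (rar r) (carrier A)"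
    "f \<in> elts Fs \<Longrightarrow> maps (funs A \<cdot> f) (funspace (far f) (carrier A)) (carrier A)"
    "f \<in> elts Fs \<Longrightarrow> maps a (far f) (carrier A) \<Longrightarrow> funs A \<cdot> f \<cdot> a \<in> elts (carrier A)"
    "r \<in> elts Rs \<Longrightarrow> rels A \<cdot> r = ap (rels A) r"
    "f \<in> elts Fs \<Longrightarrow> maps a (far f) (carrier A) \<Longrightarrow> funs A \<cdot> f \<cdot> a = ap (ap (funs A) f) a"
proof -
  show *: "func_on (rels A) Rs" "func_on (funs A) Fs" "elts (carrier A) \<noteq> {}"
    "r \<in> elts Rs \<Longrightarrow> a \<in> elts (rels A \<cdot> r) \<Longrightarrow> maps a (rar r) (carrier A)"
    "f \<in> elts Fs \<Longrightarrow> maps (funs A \<cdot> f) (funspace (far f) (carrier A)) (carrier A)"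
    using assms unfolding is_structure_def by auto
  show "f \<in> elts Fs \<Longrightarrow> maps a (far f) (carrier A) \<Longrightarrow> funs A \<cdot> f \<cdot> a \<in> elts (carrier A)"
    using maps_app[OF *(5)] by simp
  show "r \<in> elts Rs \<Longrightarrow> rels A \<cdot> r = ap (rels A) r" using app_ap[OF *(1)] .
  show "funs A \<cdot> f \<cdot> a = ap (ap (funs A) f) a" if "f \<in> elts Fs" "maps a (far f) (carrier A)"
    using app_ap[OF *(2) that(1)] app_ap[OF maps_func[OF *(5)[OF that(1)]], of a] that(2) by simp
qed

subsection \<open>Evaluation of terms\<close>

definition is_eval :: "'a \<Rightarrow> 'a \<Rightarrow> 'a \<Rightarrow> bool" where
  "is_eval A e v \<longleftrightarrow> func_on v T \<and>
    (\<forall>n\<in>elts omega. v \<cdot> Var n = e \<cdot> n) \<and>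
    (\<forall>f\<in>elts Fs. \<forall>ts. maps ts (far f) T \<longrightarrow>
      v \<cdot> Fn f ts = funs A \<cdot> f \<cdot> lam (far f) (\<lambda>k. v \<cdot> (ts \<cdot> k)))"

text \<open>The definable twin of \<open>is_eval\<close>. The two agree only where all applications
  stay inside their domains, so the equivalence \<open>is_eval_iff\<close> presupposes a structure
  and an assignment into its carrier.\<close>

definition is_eval_ap :: "'a \<Rightarrow> 'a \<Rightarrow> 'a \<Rightarrow> bool" where
  "is_eval_ap A e v \<longleftrightarrow> func_on v T \<and>
    (\<forall>n\<in>elts omega. ap v (Var n) = ap e n) \<and>
    (\<forall>f\<in>elts Fs. \<forall>ts. maps ts (ap (fun_ar S) f) T \<longrightarrow>
      ap v (Fn f ts) = ap (ap (funs A) f) (lam (ap (fun_ar S) f) (\<lambda>k. ap v (ap ts k))))"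

text \<open>A structure and an assignment have exactly one evaluation, so the union of all
  evaluations is that one. In contrast to the description in \<open>eval\<close>, this expression is
  definable for all arguments.\<close>

definition ev :: "'a \<Rightarrow> 'a \<Rightarrow> 'a" where
  "ev A e = mkset {p. \<exists>v. is_eval_ap A e v \<and> p \<in> elts v}"

lemma dfn_is_eval_ap: "dft t \<Longrightarrow> dft u \<Longrightarrow> dft v \<Longrightarrow> dfn (\<lambda>s. is_eval_ap (t s) (u s) (v s))"
  by (rule dfn3) (unfold is_eval_ap_def, intro D3)

lemma dft_ev: "dft t \<Longrightarrow> dft u \<Longrightarrow> dft (\<lambda>s. ev (t s) (u s))"
  by (rule dft2) (unfold ev_def, intro D3 dfn_is_eval_ap)

lemma lam_comp_ap: "maps ts n X \<Longrightarrow> func_on v X \<Longrightarrow> lam n (\<lambda>k. v \<cdot> (ts \<cdot> k)) = lam n (\<lambda>k. ap v (ap ts k))"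
  by (rule lam_cong) (metis maps_app_ap maps_app app_ap)

context
  fixes A e
  assumes A: "is_structure S A" and e: "maps e omega (carrier A)"
begin

text \<open>Values must be known to lie in the carrier before \<open>app\<close> can be replaced by
  \<open>ap\<close> in the clause for function symbols. The same fact is therefore proved separately
  for each of the two notions of evaluation.\<close>

lemma is_eval_maps: "is_eval A e v \<Longrightarrow> maps v T (carrier A)"
proof -
  assume v: "is_eval A e v"
  then have f: "func_on v T" unfolding is_eval_def by blast
  \<comment> \<open>Membership in \<open>T\<close> is repeated in the predicate so that the
    induction hypothesis also places the arguments \<open>ts \<cdot> k\<close> in the domain of
    \<open>v\<close>.\<close>
  have "\<forall>t\<in>elts T. t \<in> elts T \<and> ap v t \<in> elts (carrier A)"
  proof (rule term_induct)
    fix g ts assume g: "g \<in> elts Fs" "maps ts (far g) T" "\<And>k. k \<in> elts (far g) \<Longrightarrow> ts \<cdot> k \<in> elts T \<and> ap v (ts \<cdot> k) \<in> elts (carrier A)"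
    have "maps (lam (far g) (\<lambda>k. v \<cdot> (ts \<cdot> k))) (far g) (carrier A)"
      using g f by (intro maps_lam lam_ok_comp) (auto simp: app_ap)
    then have "v \<cdot> Fn g ts \<in> elts (carrier A)" using v g structureD(6)[OF A] unfolding is_eval_def by simp
    then show "Fn g ts \<in> elts T \<and> ap v (Fn g ts) \<in> elts (carrier A)" using Fn_in_terms[OF g(1,2)] app_ap[OF f] by simp
  next
    fix n assume n: "n \<in> elts omega"
    then have "v \<cdot> Var n = e \<cdot> n" using v unfolding is_eval_def by blast
    then show "Var n \<in> elts T \<and> ap v (Var n) \<in> elts (carrier A)" using n maps_app[OF e n] app_ap[OF f, of "Var n"] by simp
  qed (intro D3)
  then show ?thesis using f unfolding maps_ap by blast
qed

lemma is_eval_ap_maps: "is_eval_ap A e v \<Longrightarrow> maps v T (carrier A)"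
proof -
  assume v: "is_eval_ap A e v"
  then have f: "func_on v T" unfolding is_eval_ap_def by blast
  have "\<forall>t\<in>elts T. t \<in> elts T \<and> ap v t \<in> elts (carrier A)"
  proof (rule term_induct)
    fix g ts assume g: "g \<in> elts Fs" "maps ts (far g) T" "\<And>k. k \<in> elts (far g) \<Longrightarrow> ts \<cdot> k \<in> elts T \<and> ap v (ts \<cdot> k) \<in> elts (carrier A)"
    have m: "maps (lam (far g) (\<lambda>k. v \<cdot> (ts \<cdot> k))) (far g) (carrier A)"
      using g f by (intro maps_lam lam_ok_comp) (auto simp: app_ap)
    have "ap v (Fn g ts) = ap (ap (funs A) g) (lam (far g) (\<lambda>k. v \<cdot> (ts \<cdot> k)))"
      using v g unfolding is_eval_ap_def lam_comp_ap[OF g(2) f] by (simp add: far_ap)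
    then show "Fn g ts \<in> elts T \<and> ap v (Fn g ts) \<in> elts (carrier A)"
      using Fn_in_terms[OF g(1,2)] structureD(6,8)[OF A g(1) m] by simp
  next
    fix n assume n: "n \<in> elts omega"
    then have "ap v (Var n) = ap e n" using v unfolding is_eval_ap_def by blast
    then show "Var n \<in> elts T \<and> ap v (Var n) \<in> elts (carrier A)" using n e unfolding maps_ap by simp
  qed (intro D3)
  then show ?thesis using f unfolding maps_ap by blast
qed

lemma is_eval_Fn_iff:
  assumes v: "maps v T (carrier A)" and g: "g \<in> elts Fs" "maps ts (far g) T"
  shows "v \<cdot> Fn g ts = funs A \<cdot> g \<cdot> lam (far g) (\<lambda>k. v \<cdot> (ts \<cdot> k)) \<longleftrightarrow>
    ap v (Fn g ts) = ap (ap (funs A) g) (lam (ap (fun_ar S) g) (\<lambda>k. ap v (ap ts k)))"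
  using app_ap[OF maps_func[OF v] Fn_in_terms[OF g]] structureD(8)[OF A g(1) maps_comp[OF g(2) v]]
    lam_comp_ap[OF g(2) maps_func[OF v]] far_ap[OF g(1)] by simp

lemma is_eval_iff: "is_eval A e v \<longleftrightarrow> is_eval_ap A e v"
proof -
  have "is_eval A e v \<longleftrightarrow> is_eval_ap A e v" if v: "maps v T (carrier A)"
    unfolding is_eval_def is_eval_ap_def
    using maps_func[OF v] maps_func[OF e] is_eval_Fn_iff[OF v] by (simp add: app_ap far_ap)
  then show ?thesis using is_eval_maps is_eval_ap_maps by blast
qed

lemma is_eval_unique: "is_eval A e v \<Longrightarrow> is_eval A e w \<Longrightarrow> v = w"
proof -
  assume v: "is_eval A e v" and w: "is_eval A e w"
  have f: "func_on v T" "func_on w T" using v w unfolding is_eval_def by auto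
  have "\<forall>t\<in>elts T. t \<in> elts T \<and> ap v t = ap w t"
  proof (rule term_induct)
    fix g ts assume g: "g \<in> elts Fs" "maps ts (far g) T" "\<And>k. k \<in> elts (far g) \<Longrightarrow> ts \<cdot> k \<in> elts T \<and> ap v (ts \<cdot> k) = ap w (ts \<cdot> k)"
    have "lam (far g) (\<lambda>k. v \<cdot> (ts \<cdot> k)) = lam (far g) (\<lambda>k. w \<cdot> (ts \<cdot> k))"
      using g f by (intro lam_cong) (auto simp: app_ap)
    then have "v \<cdot> Fn g ts = w \<cdot> Fn g ts" using v w g unfolding is_eval_def by simp
    then show "Fn g ts \<in> elts T \<and> ap v (Fn g ts) = ap w (Fn g ts)" using Fn_in_terms[OF g(1,2)] app_ap f by simp
  next
    fix n assume n: "n \<in> elts omega"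
    then have "v \<cdot> Var n = w \<cdot> Var n" using v w unfolding is_eval_def by simp
    then show "Var n \<in> elts T \<and> ap v (Var n) = ap w (Var n)" using n app_ap f by simp
  qed (intro D3)
  then show ?thesis using f by (intro func_ext[OF f]) (simp add: app_ap)
qed

lemma is_eval_ex: "\<exists>v. is_eval A e v"
proof -
  define H where "H t w = mkset {z. (\<exists>n\<in>elts omega. t = Var n \<and> z \<in> elts (ap e n)) \<or>
    (\<exists>f\<in>elts Fs. \<exists>ts. maps ts (ap (fun_ar S) f) T \<and> t = Fn f ts \<and>
      z \<in> elts (ap (ap (funs A) f) (lam (ap (fun_ar S) f) (\<lambda>k. ap w (ap ts k)))))}" for t w
  \<comment> \<open>\<open>R\<close> relates a term to its immediate subterms; term induction is the
    induction principle that \<open>wf_rec\<close> asks for.\<close>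
  define R where "R y x \<longleftrightarrow> (\<exists>f\<in>elts Fs. \<exists>ts. maps ts (ap (fun_ar S) f) T \<and> x = Fn f ts \<and>
      (\<exists>k\<in>elts (ap (fun_ar S) f). y = ap ts k))" for y x
  have "\<exists>v. func_on v T \<and> (\<forall>x\<in>elts T. v \<cdot> x = H x v)"
  proof (rule wf_rec)
    show "dfn (\<lambda>s. R (s 0) (s 1))" unfolding R_def by (intro D3)
    show "dft (\<lambda>s. H (s 0) (s 1))" unfolding H_def by (intro D3)
    fix P assume P: "dfn (\<lambda>s. P (s 0))" and step: "\<And>x. x \<in> elts T \<Longrightarrow> (\<And>y. y \<in> elts T \<Longrightarrow> R y x \<Longrightarrow> P y) \<Longrightarrow> P x"
    show "\<forall>x\<in>elts T. P x"
    proof (rule term_induct[OF P])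
      show "P (Var n)" if "n \<in> elts omega" for n
        by (rule step) (use that in \<open>auto simp: R_def\<close>)
      fix f ts assume f: "f \<in> elts Fs" "maps ts (far f) T" "\<And>k. k \<in> elts (far f) \<Longrightarrow> P (ts \<cdot> k)"
      show "P (Fn f ts)"
      proof (rule step[OF Fn_in_terms[OF f(1,2)]])
        fix y assume "R y (Fn f ts)"
        then obtain k where "k \<in> elts (far f)" "y = ap ts k" unfolding R_def using far_ap[OF f(1)] by auto
        then show "P y" using f(3)[of k] maps_app_ap[OF f(2)] by simp
      qed
    qed
  next
    fix x w w' assume w: "\<And>y. y \<in> elts T \<Longrightarrow> R y x \<Longrightarrow> ap w y = ap w' y"
    have eq: "lam (ap (fun_ar S) f) (\<lambda>k. ap w (ap ts k)) = lam (ap (fun_ar S) f) (\<lambda>k. ap w' (ap ts k))"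
      if "f \<in> elts Fs" "maps ts (ap (fun_ar S) f) T" "x = Fn f ts" for f ts
      using that by (intro lam_cong w) (auto simp: R_def maps_ap)
    show "H x w = H x w'" unfolding H_def
      by (intro arg_cong[where f = mkset] Collect_cong disj_cong refl bex_cong ex_cong1 conj_cong) (simp only: eq)
  qed
  then obtain v where v: "func_on v T" "\<forall>x\<in>elts T. ap v x = H x v" using app_ap by auto
  have "is_eval_ap A e v" unfolding is_eval_ap_def
  proof (intro conjI ballI allI impI v(1))
    fix n assume "n \<in> elts omega"
    moreover have "{z. \<exists>m\<in>elts omega. n = m \<and> z \<in> elts (ap e m)} = elts (ap e n)" if "n \<in> elts omega"
      using that by auto
    ultimately show "ap v (Var n) = ap e n" using v(2) by (simp add: H_def)
  next
    fix f ts assume f: "f \<in> elts Fs" "maps ts (ap (fun_ar S) f) T"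
    then have "{z. \<exists>g\<in>elts Fs. \<exists>us. maps us (ap (fun_ar S) g) T \<and> (f = g \<and> ts = us) \<and>
      z \<in> elts (ap (ap (funs A) g) (lam (ap (fun_ar S) g) (\<lambda>k. ap v (ap us k))))} =
      elts (ap (ap (funs A) f) (lam (ap (fun_ar S) f) (\<lambda>k. ap v (ap ts k))))" by auto
    then show "ap v (Fn f ts) = ap (ap (funs A) f) (lam (ap (fun_ar S) f) (\<lambda>k. ap v (ap ts k)))"
      using v(2) Fn_in_terms[of f ts] f by (simp add: H_def far_ap)
  qed
  then show ?thesis using is_eval_iff by blast
qed

lemma is_eval_ev: "is_eval A e (ev A e)"
proof -
  obtain v where v: "is_eval A e v" using is_eval_ex ..
  then have "{p. \<exists>v. is_eval_ap A e v \<and> p \<in> elts v} = elts v" using is_eval_unique is_eval_iff by blast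
  then show ?thesis using v unfolding ev_def by simp
qed

lemma ev_maps: "maps (ev A e) T (carrier A)"
  by (rule is_eval_maps[OF is_eval_ev])

lemma ev_Var [simp]: "n \<in> elts omega \<Longrightarrow> ev A e \<cdot> Var n = e \<cdot> n"
  and ev_Fn: "f \<in> elts Fs \<Longrightarrow> maps ts (far f) T \<Longrightarrow>
    ev A e \<cdot> Fn f ts = funs A \<cdot> f \<cdot> lam (far f) (\<lambda>k. ev A e \<cdot> (ts \<cdot> k))"
  using is_eval_ev unfolding is_eval_def by blast+

lemma eval_ev: "eval S A e t = ev A e \<cdot> t"
proof -
  have "(THE v. is_eval A e v) = ev A e" using is_eval_ev is_eval_unique by blast
  then show ?thesis unfolding eval_def is_eval_def by simp
qed

end

subsection \<open>Satisfaction\<close>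

abbreviation "Fm \<equiv> formulas S"

lemma is_atomic_ap: "is_atomic S \<phi> \<longleftrightarrow>
    (\<exists>t\<in>elts T. \<exists>u\<in>elts T. \<phi> = Eq t u) \<or>
    (\<exists>r\<in>elts Rs. \<exists>ts. maps ts (ap (rel_ar S) r) T \<and> \<phi> = Rel r ts)"
  unfolding is_atomic_def by (auto simp: rar_ap)

lemma dfn_is_atomic: "dft t \<Longrightarrow> dfn (\<lambda>s. is_atomic S (t s))"
  by (rule dfn1) (unfold is_atomic_ap, intro D3)

lemma atomic_cases:
  assumes "is_atomic S \<phi>"
  obtains t u where "t \<in> elts T" "u \<in> elts T" "\<phi> = Eq t u"
    | r ts where "r \<in> elts Rs" "maps ts (rar r) T" "\<phi> = Rel r ts"
  using assms unfolding is_atomic_def by blast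

lemma atomic_Eq: "t \<in> elts T \<Longrightarrow> u \<in> elts T \<Longrightarrow> is_atomic S (Eq t u)"
  and atomic_Rel: "r \<in> elts Rs \<Longrightarrow> maps ts (rar r) T \<Longrightarrow> is_atomic S (Rel r ts)"
  unfolding is_atomic_def by blast+

lemma not_atomic [simp]: "\<not> is_atomic S (Neg \<phi>)" "\<not> is_atomic S (Disj \<phi> \<psi>)" "\<not> is_atomic S (Exists n \<phi>)"
  unfolding is_atomic_def by auto

section \<open>The set of formulas\<close>

definition fm_closed :: "'a \<Rightarrow> bool" where
  "fm_closed X \<longleftrightarrow>
    (\<forall>\<psi>. is_atomic S \<psi> \<longrightarrow> \<psi> \<in> elts X) \<and>
    (\<forall>\<psi>\<in>elts X. Neg \<psi> \<in> elts X) \<and>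
    (\<forall>\<psi>\<in>elts X. \<forall>\<chi>\<in>elts X. Disj \<psi> \<chi> \<in> elts X) \<and>
    (\<forall>n\<in>elts omega. \<forall>\<psi>\<in>elts X. Exists n \<psi> \<in> elts X)"

lemma isset_atomic: "isset {\<phi>. is_atomic S \<phi>}"
proof (rule isset_Collect)
  show "dfn (\<lambda>s. is_atomic S (s 0))" by (intro dfn_is_atomic D3)
  fix \<phi> assume "is_atomic S \<phi>"
  then show "\<phi> \<in> elts (un (cart (mkset {num 0}) (cart T T)) (cart (mkset {num 1}) (cart Rs (pow (cart omega T)))))"
    by (rule atomic_cases) (use tuple_in_pow[OF rar_omega] in \<open>auto simp: Eq_def Rel_def simp del: elts_pow\<close>)
qed

lemma fm_closed_ex: "\<exists>X. fm_closed X"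
proof -
  define G where "G X = mkset {t. t \<in> elts X \<or> (\<exists>\<psi>\<in>elts X. t = Neg \<psi>) \<or>
    (\<exists>\<psi>\<in>elts X. \<exists>\<chi>\<in>elts X. t = Disj \<psi> \<chi>) \<or> (\<exists>n\<in>elts omega. \<exists>\<psi>\<in>elts X. t = Exists n \<psi>)}" for X
  have G: "dft (\<lambda>s. G (s 0))" unfolding G_def by (intro D3)
  have eG: "elts (G X) = {t. t \<in> elts X \<or> (\<exists>\<psi>\<in>elts X. t = Neg \<psi>) \<or>
    (\<exists>\<psi>\<in>elts X. \<exists>\<chi>\<in>elts X. t = Disj \<psi> \<chi>) \<or> (\<exists>n\<in>elts omega. \<exists>\<psi>\<in>elts X. t = Exists n \<psi>)}" for X
    unfolding G_def
    by (rule elts_mkset, rule isset_Collect[where a = "un X (un (cart (mkset {num 2}) X)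
        (un (cart (mkset {num 3}) (cart X X)) (cart (mkset {num 4}) (cart omega X))))"], intro D3)
      (auto simp: Neg_def Disj_def Exists_def)
  have "elts X \<subseteq> elts (G X)" for X unfolding eG by blast
  from finitary_closure[OF G this] obtain Z where Z: "elts (mkset {\<phi>. is_atomic S \<phi>}) \<subseteq> elts Z"
    "\<forall>V. fin V \<and> elts V \<subseteq> elts Z \<longrightarrow> (\<exists>X. elts V \<subseteq> elts X \<and> elts (G X) \<subseteq> elts Z)"
    by blast
  have 1: "\<forall>\<psi>. is_atomic S \<psi> \<longrightarrow> \<psi> \<in> elts Z" using Z(1) elts_mkset[OF isset_atomic] by blast
  have 2: "Neg \<psi> \<in> elts Z \<and> Disj \<psi> \<chi> \<in> elts Z \<and> (\<forall>n\<in>elts omega. Exists n \<psi> \<in> elts Z)"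
    if \<psi>\<chi>: "\<psi> \<in> elts Z" "\<chi> \<in> elts Z" for \<psi> \<chi>
  proof -
    \<comment> \<open>Two formulas suffice, since no constructor takes more than two formulas as
      arguments.\<close>
    have "fin (ins \<psi> (ins \<chi> emp))" by (intro fin_ins fin_emp)
    then obtain X where X: "\<psi> \<in> elts X" "\<chi> \<in> elts X" "elts (G X) \<subseteq> elts Z"
      using Z(2)[rule_format, of "ins \<psi> (ins \<chi> emp)"] \<psi>\<chi> by auto
    have "Neg \<psi> \<in> elts (G X)" "Disj \<psi> \<chi> \<in> elts (G X)" "\<forall>n\<in>elts omega. Exists n \<psi> \<in> elts (G X)"
      using X(1,2) unfolding eG by auto
    then show ?thesis using X(3) by blast
  qed
  have "fm_closed Z" unfolding fm_closed_def using 1 2 by blast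
  then show ?thesis ..
qed

lemma elts_formulas: "elts Fm = {\<phi>. \<forall>X. fm_closed X \<longrightarrow> \<phi> \<in> elts X}"
proof -
  obtain X where "fm_closed X" using fm_closed_ex ..
  then show ?thesis unfolding formulas_def fm_closed_def[symmetric]
    by (intro elts_mkset isset_Collect[where a = X]) (unfold fm_closed_def, intro D3 dfn_is_atomic, blast)
qed

lemma fm_closed_Fm: "fm_closed Fm"
proof -
  have sub: "\<phi> \<in> elts X" if "fm_closed X" "\<phi> \<in> elts Fm" for X \<phi> using that unfolding elts_formulas by blast
  show ?thesis
    unfolding fm_closed_def
  proof (intro conjI ballI allI impI)
    show "\<psi> \<in> elts Fm" if "is_atomic S \<psi>" for \<psi>
      using that unfolding elts_formulas fm_closed_def by blast
    show "Neg \<psi> \<in> elts Fm" if "\<psi> \<in> elts Fm" for \<psi>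
      using sub[OF _ that] unfolding elts_formulas[THEN eqset_imp_iff, of "Neg \<psi>", unfolded mem_Collect_eq]
      by (simp add: fm_closed_def)
    show "Disj \<psi> \<chi> \<in> elts Fm" if "\<psi> \<in> elts Fm" "\<chi> \<in> elts Fm" for \<psi> \<chi>
      using sub[OF _ that(1)] sub[OF _ that(2)]
      unfolding elts_formulas[THEN eqset_imp_iff, of "Disj \<psi> \<chi>", unfolded mem_Collect_eq]
      by (simp add: fm_closed_def)
    show "Exists n \<psi> \<in> elts Fm" if "\<psi> \<in> elts Fm" "n \<in> elts omega" for n \<psi>
      using sub[OF _ that(1)] that(2)
      unfolding elts_formulas[THEN eqset_imp_iff, of "Exists n \<psi>", unfolded mem_Collect_eq]
      by (simp add: fm_closed_def)
  qed
qed

lemma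
  shows atomic_Fm: "is_atomic S \<psi> \<Longrightarrow> \<psi> \<in> elts Fm"
    and Neg_Fm: "\<psi> \<in> elts Fm \<Longrightarrow> Neg \<psi> \<in> elts Fm"
    and Disj_Fm: "\<psi> \<in> elts Fm \<Longrightarrow> \<chi> \<in> elts Fm \<Longrightarrow> Disj \<psi> \<chi> \<in> elts Fm"
    and Exists_Fm: "n \<in> elts omega \<Longrightarrow> \<psi> \<in> elts Fm \<Longrightarrow> Exists n \<psi> \<in> elts Fm"
  using fm_closed_Fm unfolding fm_closed_def by blast+

lemma fm_induct:
  assumes P: "dfn (\<lambda>s. P (s 0))" and "\<And>\<psi>. is_atomic S \<psi> \<Longrightarrow> P \<psi>"
    "\<And>\<psi>. \<psi> \<in> elts Fm \<Longrightarrow> P \<psi> \<Longrightarrow> P (Neg \<psi>)"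
    "\<And>\<psi> \<chi>. \<psi> \<in> elts Fm \<Longrightarrow> \<chi> \<in> elts Fm \<Longrightarrow> P \<psi> \<Longrightarrow> P \<chi> \<Longrightarrow> P (Disj \<psi> \<chi>)"
    "\<And>n \<psi>. n \<in> elts omega \<Longrightarrow> \<psi> \<in> elts Fm \<Longrightarrow> P \<psi> \<Longrightarrow> P (Exists n \<psi>)"
  shows "\<forall>\<phi>\<in>elts Fm. P \<phi>"
proof -
  let ?X = "mkset {t \<in> elts Fm. P t}"
  have e: "elts ?X = {t \<in> elts Fm. P t}" by (intro elts_mkset sepI P)
  have "fm_closed ?X" unfolding fm_closed_def e
    using assms(2-5) atomic_Fm Neg_Fm Disj_Fm Exists_Fm by simp
  then have "elts Fm \<subseteq> elts ?X" unfolding elts_formulas by blast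
  then show ?thesis unfolding e by blast
qed

section \<open>Satisfaction sets\<close>

definition is_sat :: "'a \<Rightarrow> 'a \<Rightarrow> bool" where
  "is_sat A U \<longleftrightarrow> func_on U Fm \<and>
    (\<forall>\<phi>\<in>elts Fm. elts (U \<cdot> \<phi>) \<subseteq> elts (assignments A)) \<and>
    (\<forall>e\<in>elts (assignments A).
      (\<forall>t\<in>elts T. \<forall>u\<in>elts T.
        e \<in> elts (U \<cdot> Eq t u) \<longleftrightarrow> eval S A e t = eval S A e u) \<and>
      (\<forall>r\<in>elts Rs. \<forall>ts. maps ts (rar r) T \<longrightarrow>
        (e \<in> elts (U \<cdot> Rel r ts) \<longleftrightarrow>
          lam (rar r) (\<lambda>k. eval S A e (ts \<cdot> k)) \<in> elts (rels A \<cdot> r))) \<and>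
      (\<forall>\<phi>\<in>elts Fm. e \<in> elts (U \<cdot> Neg \<phi>) \<longleftrightarrow> e \<notin> elts (U \<cdot> \<phi>)) \<and>
      (\<forall>\<phi>\<in>elts Fm. \<forall>\<psi>\<in>elts Fm.
        e \<in> elts (U \<cdot> Disj \<phi> \<psi>) \<longleftrightarrow> e \<in> elts (U \<cdot> \<phi>) \<or> e \<in> elts (U \<cdot> \<psi>)) \<and>
      (\<forall>n\<in>elts omega. \<forall>\<phi>\<in>elts Fm.
        e \<in> elts (U \<cdot> Exists n \<phi>) \<longleftrightarrow>
          (\<exists>d\<in>elts (carrier A). update e n d \<in> elts (U \<cdot> \<phi>))))"

definition update_ap :: "'a \<Rightarrow> 'a \<Rightarrow> 'a \<Rightarrow> 'a" where
  "update_ap e n d = lam omega (\<lambda>m. if m = n then d else ap e m)"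

text \<open>The condition that determines \<open>sat_sets\<close>, with total application and with
  \<open>ev\<close> in place of \<open>eval\<close>; this makes it definable.\<close>

definition is_sat_ap :: "'a \<Rightarrow> 'a \<Rightarrow> bool" where
  "is_sat_ap A U \<longleftrightarrow> func_on U Fm \<and>
    (\<forall>\<phi>\<in>elts Fm. \<forall>e\<in>elts (ap U \<phi>). maps e omega (carrier A)) \<and>
    (\<forall>e. maps e omega (carrier A) \<longrightarrow>
      (\<forall>t\<in>elts T. \<forall>u\<in>elts T.
        e \<in> elts (ap U (Eq t u)) \<longleftrightarrow> ap (ev A e) t = ap (ev A e) u) \<and>
      (\<forall>r\<in>elts Rs. \<forall>ts. maps ts (ap (rel_ar S) r) T \<longrightarrow>
        (e \<in> elts (ap U (Rel r ts)) \<longleftrightarrow>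
          lam (ap (rel_ar S) r) (\<lambda>k. ap (ev A e) (ap ts k)) \<in> elts (ap (rels A) r))) \<and>
      (\<forall>\<phi>\<in>elts Fm. e \<in> elts (ap U (Neg \<phi>)) \<longleftrightarrow> e \<notin> elts (ap U \<phi>)) \<and>
      (\<forall>\<phi>\<in>elts Fm. \<forall>\<psi>\<in>elts Fm.
        e \<in> elts (ap U (Disj \<phi> \<psi>)) \<longleftrightarrow> e \<in> elts (ap U \<phi>) \<or> e \<in> elts (ap U \<psi>)) \<and>
      (\<forall>n\<in>elts omega. \<forall>\<phi>\<in>elts Fm.
        e \<in> elts (ap U (Exists n \<phi>)) \<longleftrightarrow>
          (\<exists>d\<in>elts (carrier A). update_ap e n d \<in> elts (ap U \<phi>))))"

lemma dfn_is_sat_ap: "dft t \<Longrightarrow> dft u \<Longrightarrow> dfn (\<lambda>s. is_sat_ap (t s) (u s))"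
  by (rule dfn2) (unfold is_sat_ap_def update_ap_def, intro D3 dft_ev)

lemma update_eq: "func_on e omega \<Longrightarrow> update e n d = update_ap e n d"
  unfolding update_def update_ap_def by (intro lam_cong) (simp add: app_ap)

lemma elts_assignments [simp]: "elts (assignments A) = {e. maps e omega (carrier A)}"
  unfolding assignments_def by simp

text \<open>Truth of atomic formulas without the detour through satisfaction sets. The literals of
  Horn formulas are treated through this notion, which is definable in the structure, the assignment
  and the formula together.\<close>

definition at_sat :: "'a \<Rightarrow> 'a \<Rightarrow> 'a \<Rightarrow> bool" where
  "at_sat A e \<phi> \<longleftrightarrow>
    (\<exists>t\<in>elts T. \<exists>u\<in>elts T. \<phi> = Eq t u \<and> ap (ev A e) t = ap (ev A e) u) \<or>
    (\<exists>r\<in>elts Rs. \<exists>ts. maps ts (ap (rel_ar S) r) T \<and> \<phi> = Rel r ts \<and>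
      lam (ap (rel_ar S) r) (\<lambda>k. ap (ev A e) (ap ts k)) \<in> elts (ap (rels A) r))"

lemma dfn_at_sat: "dft t \<Longrightarrow> dft u \<Longrightarrow> dft v \<Longrightarrow> dfn (\<lambda>s. at_sat (t s) (u s) (v s))"
  by (rule dfn3) (unfold at_sat_def, intro D3 dft_ev)

lemma at_sat_Eq_ap: "t \<in> elts T \<Longrightarrow> u \<in> elts T \<Longrightarrow> at_sat A e (Eq t u) \<longleftrightarrow> ap (ev A e) t = ap (ev A e) u"
  unfolding at_sat_def by auto

lemma at_sat_Rel_ap: "r \<in> elts Rs \<Longrightarrow> maps ts (rar r) T \<Longrightarrow> at_sat A e (Rel r ts) \<longleftrightarrow>
    lam (ap (rel_ar S) r) (\<lambda>k. ap (ev A e) (ap ts k)) \<in> elts (ap (rels A) r)"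
  unfolding at_sat_def by (auto simp: rar_ap)

lemma is_sat_ap_func: "is_sat_ap A U \<Longrightarrow> func_on U Fm"
  and is_sat_ap_maps: "is_sat_ap A U \<Longrightarrow> \<phi> \<in> elts Fm \<Longrightarrow> e \<in> elts (ap U \<phi>) \<Longrightarrow> maps e omega (carrier A)"
  unfolding is_sat_ap_def by (elim conjE, assumption) (elim conjE, drule (1) bspec, erule (1) bspec)

lemma is_sat_apD:
  assumes U: "is_sat_ap A U" and e: "maps e omega (carrier A)"
  shows "is_atomic S \<phi> \<Longrightarrow> e \<in> elts (ap U \<phi>) \<longleftrightarrow> at_sat A e \<phi>"
    "\<phi> \<in> elts Fm \<Longrightarrow> e \<in> elts (ap U (Neg \<phi>)) \<longleftrightarrow> e \<notin> elts (ap U \<phi>)"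
    "\<phi> \<in> elts Fm \<Longrightarrow> \<psi> \<in> elts Fm \<Longrightarrow> e \<in> elts (ap U (Disj \<phi> \<psi>)) \<longleftrightarrow> e \<in> elts (ap U \<phi>) \<or> e \<in> elts (ap U \<psi>)"
    "n \<in> elts omega \<Longrightarrow> \<phi> \<in> elts Fm \<Longrightarrow>
      e \<in> elts (ap U (Exists n \<phi>)) \<longleftrightarrow> (\<exists>d\<in>elts (carrier A). update_ap e n d \<in> elts (ap U \<phi>))"
proof -
  note c = U[unfolded is_sat_ap_def, THEN conjunct2, THEN conjunct2, THEN spec, THEN mp, OF e]
  show "is_atomic S \<phi> \<Longrightarrow> e \<in> elts (ap U \<phi>) \<longleftrightarrow> at_sat A e \<phi>"
  proof (erule atomic_cases)
    fix t u assume "t \<in> elts T" "u \<in> elts T" "\<phi> = Eq t u"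
    then show ?thesis using c[THEN conjunct1, THEN bspec, THEN bspec, of t u] at_sat_Eq_ap by simp
  next
    fix r ts assume r: "r \<in> elts Rs" "maps ts (rar r) T" "\<phi> = Rel r ts"
    have "e \<in> elts (ap U (Rel r ts)) \<longleftrightarrow>
        lam (ap (rel_ar S) r) (\<lambda>k. ap (ev A e) (ap ts k)) \<in> elts (ap (rels A) r)"
      by (rule c[THEN conjunct2, THEN conjunct1, THEN bspec, THEN spec, THEN mp, OF r(1) r(2)[unfolded rar_ap[OF r(1)]]])
    then show ?thesis unfolding at_sat_Rel_ap[OF r(1,2)] r(3) .
  qed
  note c = c[THEN conjunct2, THEN conjunct2]
  show "\<phi> \<in> elts Fm \<Longrightarrow> e \<in> elts (ap U (Neg \<phi>)) \<longleftrightarrow> e \<notin> elts (ap U \<phi>)"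
    by (rule c[THEN conjunct1, THEN bspec])
  show "\<phi> \<in> elts Fm \<Longrightarrow> \<psi> \<in> elts Fm \<Longrightarrow> e \<in> elts (ap U (Disj \<phi> \<psi>)) \<longleftrightarrow> e \<in> elts (ap U \<phi>) \<or> e \<in> elts (ap U \<psi>)"
    by (rule c[THEN conjunct2, THEN conjunct1, THEN bspec, THEN bspec])
  show "n \<in> elts omega \<Longrightarrow> \<phi> \<in> elts Fm \<Longrightarrow>
      e \<in> elts (ap U (Exists n \<phi>)) \<longleftrightarrow> (\<exists>d\<in>elts (carrier A). update_ap e n d \<in> elts (ap U \<phi>))"
    by (rule c[THEN conjunct2, THEN conjunct2, THEN bspec, THEN bspec])
qed

context
  fixes A
  assumes A: "is_structure S A"
begin

lemma at_sat_Eq: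
  assumes "maps e omega (carrier A)" "t \<in> elts T" "u \<in> elts T"
  shows "at_sat A e (Eq t u) \<longleftrightarrow> ev A e \<cdot> t = ev A e \<cdot> u"
  unfolding at_sat_Eq_ap[OF assms(2,3)] maps_app_ap[OF ev_maps[OF A assms(1)] assms(2)]
    maps_app_ap[OF ev_maps[OF A assms(1)] assms(3)] ..

lemma at_sat_Rel:
  assumes "maps e omega (carrier A)" "r \<in> elts Rs" "maps ts (rar r) T"
  shows "at_sat A e (Rel r ts) \<longleftrightarrow> lam (rar r) (\<lambda>k. ev A e \<cdot> (ts \<cdot> k)) \<in> elts (rels A \<cdot> r)"
  unfolding at_sat_Rel_ap[OF assms(2,3)] rar_ap[OF assms(2), symmetric]
    lam_comp_ap[OF assms(3) maps_func[OF ev_maps[OF A assms(1)]]] structureD(7)[OF A assms(2)] ..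

lemma is_sat_iff: "is_sat A U \<longleftrightarrow> is_sat_ap A U"
proof (cases "func_on U Fm")
  case True
  have U: "U \<cdot> \<phi> = ap U \<phi>" if "\<phi> \<in> elts Fm" for \<phi> by (rule app_ap[OF True that])
  have rel: "lam (ap (rel_ar S) r) (\<lambda>k. eval S A e (ts \<cdot> k)) \<in> elts (rels A \<cdot> r) \<longleftrightarrow>
      lam (ap (rel_ar S) r) (\<lambda>k. ap (ev A e) (ap ts k)) \<in> elts (ap (rels A) r)"
    if r: "r \<in> elts Rs" and e: "maps e omega (carrier A)" and ts: "maps ts (ap (rel_ar S) r) T" for r e ts
  proof -
    have ts': "maps ts (rar r) T" using ts rar_ap[OF r] by simp
    show ?thesis
      unfolding eval_ev[OF A e] at_sat_Rel_ap[OF r ts', symmetric] at_sat_Rel[OF e r ts'] rar_ap[OF r] ..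
  qed
  have Eq: "eval S A e t = ap (ev A e) t" if "maps e omega (carrier A)" "t \<in> elts T" for e t
    using eval_ev[OF A that(1)] maps_app_ap[OF ev_maps[OF A that(1)] that(2)] by simp
  show ?thesis
    unfolding is_sat_def is_sat_ap_def elts_assignments mem_Collect_eq subset_eq Ball_def
    by (intro conj_cong refl all_cong1 imp_cong)
      (simp_all add: U Eq rel rar_ap atomic_Fm atomic_Eq atomic_Rel Neg_Fm Disj_Fm Exists_Fm update_eq[OF maps_func])
qed (simp add: is_sat_def is_sat_ap_def)

lemma is_sat_unique: "is_sat_ap A U \<Longrightarrow> is_sat_ap A V \<Longrightarrow> U = V"
proof -
  assume U: "is_sat_ap A U" and V: "is_sat_ap A V"
  have f: "func_on U Fm" "func_on V Fm" using U V by (auto dest: is_sat_ap_func)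
  have "\<forall>\<phi>\<in>elts Fm. \<phi> \<in> elts Fm \<and> (\<forall>e. maps e omega (carrier A) \<longrightarrow> (e \<in> elts (ap U \<phi>) \<longleftrightarrow> e \<in> elts (ap V \<phi>)))"
  proof (rule fm_induct)
    fix \<psi> assume "is_atomic S \<psi>"
    then show "\<psi> \<in> elts Fm \<and> (\<forall>e. maps e omega (carrier A) \<longrightarrow> (e \<in> elts (ap U \<psi>) \<longleftrightarrow> e \<in> elts (ap V \<psi>)))"
      using atomic_Fm[of \<psi>] is_sat_apD(1)[OF U] is_sat_apD(1)[OF V] by simp
  next
    fix n \<psi> assume n: "n \<in> elts omega" "\<psi> \<in> elts Fm"
      and IH: "\<psi> \<in> elts Fm \<and> (\<forall>e. maps e omega (carrier A) \<longrightarrow> (e \<in> elts (ap U \<psi>) \<longleftrightarrow> e \<in> elts (ap V \<psi>)))"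
    have "maps (update_ap e n d) omega (carrier A)" if "maps e omega (carrier A)" "d \<in> elts (carrier A)" for e d
      unfolding update_ap_def using that by (intro maps_lam lam_okI D3) (auto simp: maps_ap)
    then show "Exists n \<psi> \<in> elts Fm \<and> (\<forall>e. maps e omega (carrier A) \<longrightarrow> (e \<in> elts (ap U (Exists n \<psi>)) \<longleftrightarrow> e \<in> elts (ap V (Exists n \<psi>))))"
      using IH is_sat_apD(4)[OF U _ n] is_sat_apD(4)[OF V _ n] Exists_Fm[OF n] by simp
  next
    show "dfn (\<lambda>s. s 0 \<in> elts Fm \<and> (\<forall>e. maps e omega (carrier A) \<longrightarrow> (e \<in> elts (ap U (s 0)) \<longleftrightarrow> e \<in> elts (ap V (s 0)))))"
      by (intro D3)
  qed (simp_all add: is_sat_apD(2,3)[OF U] is_sat_apD(2,3)[OF V] Neg_Fm Disj_Fm)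
  then have "ap U \<phi> = ap V \<phi>" if "\<phi> \<in> elts Fm" for \<phi>
    using is_sat_ap_maps[OF U that] is_sat_ap_maps[OF V that] that by (intro elts_ext) blast
  then show ?thesis using f by (intro func_ext[OF f]) (simp add: app_ap)
qed

text \<open>Recursion along immediate subformulas. A value is the set of all satisfying assignments,
  because the clause for a quantifier refers to updated assignments.\<close>

lemma is_sat_ex: "\<exists>U. is_sat_ap A U"
proof -
  define Q where "Q \<phi> w e \<longleftrightarrow> at_sat A e \<phi> \<or>
      (\<exists>\<psi>\<in>elts Fm. \<phi> = Neg \<psi> \<and> e \<notin> elts (ap w \<psi>)) \<or>
      (\<exists>\<psi>\<in>elts Fm. \<exists>\<chi>\<in>elts Fm. \<phi> = Disj \<psi> \<chi> \<and> (e \<in> elts (ap w \<psi>) \<or> e \<in> elts (ap w \<chi>))) \<or>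
      (\<exists>n\<in>elts omega. \<exists>\<psi>\<in>elts Fm. \<phi> = Exists n \<psi> \<and>
        (\<exists>d\<in>elts (carrier A). update_ap e n d \<in> elts (ap w \<psi>)))" for \<phi> w e
  define H where "H \<phi> w = mkset {e. e \<in> elts (assignments A) \<and> Q \<phi> w e}" for \<phi> w
  have dQ: "dft t \<Longrightarrow> dft u \<Longrightarrow> dft v \<Longrightarrow> dfn (\<lambda>s. Q (t s) (u s) (v s))" for t u v
    by (rule dfn3) (unfold Q_def update_ap_def, intro D3 dfn_at_sat)
  have eH: "elts (H \<phi> w) = {e \<in> elts (assignments A). Q \<phi> w e}" for \<phi> w
    unfolding H_def by (intro elts_mkset sepI dQ D3)
  define R where "R y x \<longleftrightarrow> x = Neg y \<or> (\<exists>z. x = Disj y z \<or> x = Disj z y) \<or> (\<exists>n. x = Exists n y)" for y x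
  have "\<exists>v. func_on v Fm \<and> (\<forall>x\<in>elts Fm. v \<cdot> x = H x v)"
  proof (rule wf_rec)
    show "dfn (\<lambda>s. R (s 0) (s 1))" unfolding R_def by (intro D3)
    show "dft (\<lambda>s. H (s 0) (s 1))" unfolding H_def by (intro D3 dQ)
    fix P assume P: "dfn (\<lambda>s. P (s 0))" and step: "\<And>x. x \<in> elts Fm \<Longrightarrow> (\<And>y. y \<in> elts Fm \<Longrightarrow> R y x \<Longrightarrow> P y) \<Longrightarrow> P x"
    show "\<forall>x\<in>elts Fm. P x"
    proof (rule fm_induct[OF P])
      show "P \<psi>" if "is_atomic S \<psi>" for \<psi>
        by (rule step[OF atomic_Fm[OF that]]) (use that in \<open>auto simp: R_def\<close>)
      show "P (Neg \<psi>)" if "\<psi> \<in> elts Fm" "P \<psi>" for \<psi>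
        by (rule step[OF Neg_Fm[OF that(1)]]) (use that in \<open>auto simp: R_def\<close>)
      show "P (Disj \<psi> \<chi>)" if "\<psi> \<in> elts Fm" "\<chi> \<in> elts Fm" "P \<psi>" "P \<chi>" for \<psi> \<chi>
        by (rule step[OF Disj_Fm[OF that(1,2)]]) (use that in \<open>auto simp: R_def\<close>)
      show "P (Exists n \<psi>)" if "n \<in> elts omega" "\<psi> \<in> elts Fm" "P \<psi>" for n \<psi>
        by (rule step[OF Exists_Fm[OF that(1,2)]]) (use that in \<open>auto simp: R_def\<close>)
    qed
  next
    fix x w w' assume w: "\<And>y. y \<in> elts Fm \<Longrightarrow> R y x \<Longrightarrow> ap w y = ap w' y"
    have "ap w \<psi> = ap w' \<psi>" if "\<psi> \<in> elts Fm" "x = Neg \<psi> \<or> x = Disj \<psi> \<chi> \<or> x = Disj \<chi> \<psi> \<or> x = Exists n \<psi>" for \<psi> \<chi> n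
      using that by (intro w) (auto simp: R_def)
    then have "Q x w e \<longleftrightarrow> Q x w' e" for e
      unfolding Q_def by (intro disj_cong bex_cong conj_cong refl) metis+
    then show "H x w = H x w'" unfolding H_def by simp
  qed
  then obtain v where v: "func_on v Fm" "\<And>\<phi>. \<phi> \<in> elts Fm \<Longrightarrow> elts (ap v \<phi>) = {e \<in> elts (assignments A). Q \<phi> v e}"
    using app_ap eH by metis
  have "is_sat_ap A v" unfolding is_sat_ap_def
  proof (intro conjI ballI allI impI v(1))
    show "maps e omega (carrier A)" if "\<phi> \<in> elts Fm" "e \<in> elts (ap v \<phi>)" for \<phi> e
      using v(2)[OF that(1)] that(2) by simp
  next
    fix e assume e: "maps e omega (carrier A)"
    show "e \<in> elts (ap v (Eq t u)) \<longleftrightarrow> ap (ev A e) t = ap (ev A e) u" if "t \<in> elts T" "u \<in> elts T" for t u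
      using v(2)[OF atomic_Fm[OF atomic_Eq[OF that]]] e that by (auto simp: Q_def at_sat_def)
    show "e \<in> elts (ap v (Rel r ts)) \<longleftrightarrow>
          lam (ap (rel_ar S) r) (\<lambda>k. ap (ev A e) (ap ts k)) \<in> elts (ap (rels A) r)"
      if "r \<in> elts Rs" "maps ts (ap (rel_ar S) r) T" for r ts
      using v(2)[OF atomic_Fm[OF atomic_Rel, of r ts]] e that by (auto simp: Q_def at_sat_def rar_ap)
    show "e \<in> elts (ap v (Neg \<phi>)) \<longleftrightarrow> e \<notin> elts (ap v \<phi>)" if "\<phi> \<in> elts Fm" for \<phi>
      using v(2)[OF Neg_Fm[OF that]] e that by (auto simp: Q_def at_sat_def)
    show "e \<in> elts (ap v (Disj \<phi> \<psi>)) \<longleftrightarrow> e \<in> elts (ap v \<phi>) \<or> e \<in> elts (ap v \<psi>)"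
      if "\<phi> \<in> elts Fm" "\<psi> \<in> elts Fm" for \<phi> \<psi>
      using v(2)[OF Disj_Fm[OF that]] e that by (auto simp: Q_def at_sat_def)
    show "e \<in> elts (ap v (Exists n \<phi>)) \<longleftrightarrow> (\<exists>d\<in>elts (carrier A). update_ap e n d \<in> elts (ap v \<phi>))"
      if "n \<in> elts omega" "\<phi> \<in> elts Fm" for n \<phi>
      using v(2)[OF Exists_Fm[OF that]] e that by (auto simp: Q_def at_sat_def)
  qed
  then show ?thesis by blast
qed

lemma sat_sets_spec: "is_sat_ap A (sat_sets S A)"
proof -
  have "\<exists>!U. is_sat_ap A U" using is_sat_ex is_sat_unique by blast
  then have "is_sat_ap A (THE U. is_sat_ap A U)" by (rule theI')
  moreover have "sat_sets S A = (THE U. is_sat A U)"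
    unfolding sat_sets_def is_sat_def ..
  ultimately show ?thesis unfolding is_sat_iff by simp
qed

definition sat where "sat e \<phi> \<longleftrightarrow> e \<in> elts (sat_sets S A \<cdot> \<phi>)"

lemma sat_ap: "\<phi> \<in> elts Fm \<Longrightarrow> sat e \<phi> \<longleftrightarrow> e \<in> elts (ap (sat_sets S A) \<phi>)"
  unfolding sat_def by (simp add: app_ap[OF is_sat_ap_func[OF sat_sets_spec]])

lemma sat_atomic: "maps e omega (carrier A) \<Longrightarrow> is_atomic S \<phi> \<Longrightarrow> sat e \<phi> \<longleftrightarrow> at_sat A e \<phi>"
  by (simp add: sat_ap atomic_Fm is_sat_apD(1)[OF sat_sets_spec])

lemma sat_Neg: "maps e omega (carrier A) \<Longrightarrow> \<phi> \<in> elts Fm \<Longrightarrow> sat e (Neg \<phi>) \<longleftrightarrow> \<not> sat e \<phi>"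
  and sat_Disj: "maps e omega (carrier A) \<Longrightarrow> \<phi> \<in> elts Fm \<Longrightarrow> \<psi> \<in> elts Fm \<Longrightarrow>
    sat e (Disj \<phi> \<psi>) \<longleftrightarrow> sat e \<phi> \<or> sat e \<psi>"
  by (simp_all add: sat_ap Neg_Fm Disj_Fm is_sat_apD(2,3)[OF sat_sets_spec])

end

lemma lam_comp_lam: "lam_ok n g \<Longrightarrow> lam n (\<lambda>k. h \<cdot> (lam n g \<cdot> k)) = lam n (\<lambda>k. h \<cdot> g k)"
  by (rule lam_cong) (simp add: lam_app)

subsection \<open>Embeddings\<close>

text \<open>Isomorphisms and inclusions of substructures are both embeddings, so one preservation
  argument covers the two. Conversely, \<open>closed_emb\<close> derives closure under embeddings
  from the two closure properties.\<close>

definition emb :: "'a \<Rightarrow> 'a \<Rightarrow> 'a \<Rightarrow> bool" where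
  "emb h A B \<longleftrightarrow> maps h (carrier A) (carrier B) \<and>
    (\<forall>x\<in>elts (carrier A). \<forall>y\<in>elts (carrier A). h \<cdot> x = h \<cdot> y \<longrightarrow> x = y) \<and>
    (\<forall>r\<in>elts Rs. \<forall>a. maps a (rar r) (carrier A) \<longrightarrow>
      (a \<in> elts (rels A \<cdot> r) \<longleftrightarrow> lam (rar r) (\<lambda>k. h \<cdot> (a \<cdot> k)) \<in> elts (rels B \<cdot> r))) \<and>
    (\<forall>f\<in>elts Fs. \<forall>a. maps a (far f) (carrier A) \<longrightarrow>
      h \<cdot> (funs A \<cdot> f \<cdot> a) = funs B \<cdot> f \<cdot> lam (far f) (\<lambda>k. h \<cdot> (a \<cdot> k)))"

lemma embD:
  assumes "emb h A B"
  shows "maps h (carrier A) (carrier B)"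
    "x \<in> elts (carrier A) \<Longrightarrow> y \<in> elts (carrier A) \<Longrightarrow> h \<cdot> x = h \<cdot> y \<longleftrightarrow> x = y"
    "r \<in> elts Rs \<Longrightarrow> maps a (rar r) (carrier A) \<Longrightarrow>
      a \<in> elts (rels A \<cdot> r) \<longleftrightarrow> lam (rar r) (\<lambda>k. h \<cdot> (a \<cdot> k)) \<in> elts (rels B \<cdot> r)"
    "f \<in> elts Fs \<Longrightarrow> maps a (far f) (carrier A) \<Longrightarrow>
      h \<cdot> (funs A \<cdot> f \<cdot> a) = funs B \<cdot> f \<cdot> lam (far f) (\<lambda>k. h \<cdot> (a \<cdot> k))"
  using assms unfolding emb_def by blast+

lemma iso_emb:
  assumes "is_isomorphism S h A B"
  shows "emb h A B"
proof -
  have h: "maps h (carrier A) (carrier B)"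
    and u: "\<And>y. y \<in> elts (carrier B) \<Longrightarrow> \<exists>!x. x \<in> elts (carrier A) \<and> h \<cdot> x = y"
    using assms unfolding is_isomorphism_def by auto
  have "x = y" if "x \<in> elts (carrier A)" "y \<in> elts (carrier A)" "h \<cdot> x = h \<cdot> y" for x y
    using u[OF maps_app[OF h that(2)]] that by blast
  then show ?thesis using assms unfolding emb_def is_isomorphism_def by simp
qed

lemma id_lam_ok: "lam_ok D (\<lambda>x. x)"
  by (intro lam_okI D3)

lemma lam_id_app: "maps a n D \<Longrightarrow> lam n (\<lambda>k. lam D (\<lambda>x. x) \<cdot> (a \<cdot> k)) = a"
  using lam_cong[of n "\<lambda>k. lam D (\<lambda>x. x) \<cdot> (a \<cdot> k)" "\<lambda>k. a \<cdot> k"] lam_app[OF id_lam_ok] maps_app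
    func_lam_eta[OF maps_func] by metis

lemma substructure_emb:
  assumes "is_substructure S A B"
  shows "emb (lam (carrier A) (\<lambda>x. x)) A B"
proof -
  have A: "is_structure S A" and sub: "elts (carrier A) \<subseteq> elts (carrier B)"
    using assms unfolding is_substructure_def by auto
  have "maps (lam (carrier A) (\<lambda>x. x)) (carrier A) (carrier B)"
    using sub by (intro maps_lam id_lam_ok) auto
  then show ?thesis
    using assms structureD(6)[OF A] unfolding emb_def is_substructure_def
    by (simp add: lam_app[OF id_lam_ok] lam_id_app)
qed

context
  fixes h A B e
  assumes A: "is_structure S A" and B: "is_structure S B" and h: "emb h A B"
    and e: "maps e omega (carrier A)"
begin

lemma emb_assignment: "maps (lam omega (\<lambda>n. h \<cdot> (e \<cdot> n))) omega (carrier B)"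
  by (rule maps_comp[OF e embD(1)[OF h]])

lemma emb_tuple:
  assumes "maps ts n T"
  shows "lam n (\<lambda>k. h \<cdot> (lam n (\<lambda>k. ev A e \<cdot> (ts \<cdot> k)) \<cdot> k)) = lam n (\<lambda>k. h \<cdot> (ev A e \<cdot> (ts \<cdot> k)))"
  by (rule lam_comp_lam[OF lam_ok_comp[OF assms maps_func[OF ev_maps[OF A e]]]])

lemma ev_emb:
  assumes "t \<in> elts T"
  shows "ev B (lam omega (\<lambda>n. h \<cdot> (e \<cdot> n))) \<cdot> t = h \<cdot> (ev A e \<cdot> t)"
proof -
  let ?e = "lam omega (\<lambda>n. h \<cdot> (e \<cdot> n))"
  note e' = emb_assignment
  note v = ev_maps[OF A e] and w = ev_maps[OF B e']
  have conv: "ap (ev B ?e) t = ap h (ap (ev A e) t) \<longleftrightarrow> ev B ?e \<cdot> t = h \<cdot> (ev A e \<cdot> t)" if "t \<in> elts T" for t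
    using maps_app_ap[OF w that] maps_app_ap[OF v that] maps_app_ap[OF embD(1)[OF h] maps_app[OF v that]] by simp
  have "\<forall>t\<in>elts T. t \<in> elts T \<and> ap (ev B ?e) t = ap h (ap (ev A e) t)"
  proof (rule term_induct)
    show "Var n \<in> elts T \<and> ap (ev B ?e) (Var n) = ap h (ap (ev A e) (Var n))" if n: "n \<in> elts omega" for n
      using lam_app[OF lam_ok_comp[OF e maps_func[OF embD(1)[OF h]]] n] ev_Var[OF A e n] ev_Var[OF B e' n] n
      by (simp add: conv)
  next
    fix f ts assume f: "f \<in> elts Fs" and ts: "maps ts (far f) T"
      and IH: "\<And>k. k \<in> elts (far f) \<Longrightarrow> ts \<cdot> k \<in> elts T \<and> ap (ev B ?e) (ts \<cdot> k) = ap h (ap (ev A e) (ts \<cdot> k))"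
    have "lam (far f) (\<lambda>k. ev B ?e \<cdot> (ts \<cdot> k)) = lam (far f) (\<lambda>k. h \<cdot> (lam (far f) (\<lambda>k. ev A e \<cdot> (ts \<cdot> k)) \<cdot> k))"
      unfolding emb_tuple[OF ts] by (rule lam_cong) (use IH conv in blast)
    then show "Fn f ts \<in> elts T \<and> ap (ev B ?e) (Fn f ts) = ap h (ap (ev A e) (Fn f ts))"
      using Fn_in_terms[OF f ts] conv[OF Fn_in_terms[OF f ts]] ev_Fn[OF A e f ts] ev_Fn[OF B e' f ts]
        embD(4)[OF h f maps_comp[OF ts v]] by simp
  qed (intro D3)
  then show ?thesis using conv assms by blast
qed

lemma at_sat_emb:
  assumes "is_atomic S \<phi>"
  shows "at_sat B (lam omega (\<lambda>n. h \<cdot> (e \<cdot> n))) \<phi> \<longleftrightarrow> at_sat A e \<phi>"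
  using assms
proof (cases rule: atomic_cases)
  case (1 t u)
  then show ?thesis
    using embD(2)[OF h maps_app[OF ev_maps[OF A e]] maps_app[OF ev_maps[OF A e]]]
    by (simp add: at_sat_Eq[OF A e] at_sat_Eq[OF B emb_assignment] ev_emb)
next
  case (2 r ts)
  have "lam (rar r) (\<lambda>k. ev B (lam omega (\<lambda>n. h \<cdot> (e \<cdot> n))) \<cdot> (ts \<cdot> k)) =
      lam (rar r) (\<lambda>k. h \<cdot> (lam (rar r) (\<lambda>k. ev A e \<cdot> (ts \<cdot> k)) \<cdot> k))"
    unfolding emb_tuple[OF 2(2)] by (rule lam_cong) (use ev_emb maps_app[OF 2(2)] in blast)
  then show ?thesis
    using embD(3)[OF h 2(1) maps_comp[OF 2(2) ev_maps[OF A e]]] 2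
    by (simp add: at_sat_Rel[OF A e] at_sat_Rel[OF B emb_assignment])
qed

end

section \<open>Structures pulled back along injections\<close>

lemma mkstruct_sel [simp]: "carrier (mkstruct D R G) = D" "rels (mkstruct D R G) = R" "funs (mkstruct D R G) = G"
  unfolding mkstruct_def carrier_def rels_def funs_def by simp_all

text \<open>The relations and functions of \<open>B\<close> are read through the injection
  \<open>h\<close>, whose image is closed under the functions by \<open>cl\<close>. With
  \<open>h\<close> an inclusion this gives a substructure; with another set \<open>D\<close> it
  gives a copy of one on a prescribed carrier.\<close>

lemma pullback_structure:
  assumes B: "is_structure S B" and h: "maps h D (carrier B)" and D: "elts D \<noteq> {}"
    and inj: "\<And>x y. x \<in> elts D \<Longrightarrow> y \<in> elts D \<Longrightarrow> h \<cdot> x = h \<cdot> y \<Longrightarrow> x = y"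
    and cl: "\<And>f a. f \<in> elts Fs \<Longrightarrow> maps a (far f) D \<Longrightarrow>
      \<exists>d\<in>elts D. h \<cdot> d = funs B \<cdot> f \<cdot> lam (far f) (\<lambda>k. h \<cdot> (a \<cdot> k))"
  shows "\<exists>A. is_structure S A \<and> carrier A = D \<and> emb h A B"
proof -
  define Rr where "Rr r = mkset {a. maps a (ap (rel_ar S) r) D \<and>
      lam (ap (rel_ar S) r) (\<lambda>k. ap h (ap a k)) \<in> elts (ap (rels B) r)}" for r
  define Gf where "Gf f = mkset {p. \<exists>a d. maps a (ap (fun_ar S) f) D \<and> d \<in> elts D \<and> p = opair a d \<and>
      ap h d = ap (ap (funs B) f) (lam (ap (fun_ar S) f) (\<lambda>k. ap h (ap a k)))}" for f
  define A where "A = mkstruct D (lam Rs Rr) (lam Fs Gf)"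
  have okR: "lam_ok Rs Rr" by (rule lam_okI, unfold Rr_def, intro D3)
  have okG: "lam_ok Fs Gf" by (rule lam_okI, unfold Gf_def, intro D3)
  note hl = lam_comp_ap[OF _ maps_func[OF h]]
  have Rr: "elts (Rr r) = {a. maps a (rar r) D \<and> lam (rar r) (\<lambda>k. h \<cdot> (a \<cdot> k)) \<in> elts (rels B \<cdot> r)}"
    if r: "r \<in> elts Rs" for r
  proof -
    have "elts (Rr r) = {a. maps a (ap (rel_ar S) r) D \<and>
      lam (ap (rel_ar S) r) (\<lambda>k. ap h (ap a k)) \<in> elts (ap (rels B) r)}"
      unfolding Rr_def by (rule elts_mkset, rule isset_Collect[where a = "funspace (ap (rel_ar S) r) D"], intro D3) simp
    also have "\<dots> = {a. maps a (rar r) D \<and> lam (rar r) (\<lambda>k. h \<cdot> (a \<cdot> k)) \<in> elts (rels B \<cdot> r)}"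
      unfolding rar_ap[OF r, symmetric] structureD(7)[OF B r] by (intro Collect_cong conj_cong refl) (simp only: hl)
    finally show ?thesis .
  qed
  have Gf: "opair a d \<in> elts (Gf f) \<longleftrightarrow> maps a (far f) D \<and> d \<in> elts D \<and> h \<cdot> d = funs B \<cdot> f \<cdot> lam (far f) (\<lambda>k. h \<cdot> (a \<cdot> k))"
    and Gf_pair: "p \<in> elts (Gf f) \<Longrightarrow> \<exists>a d. maps a (far f) D \<and> p = opair a d"
    if f: "f \<in> elts Fs" for f a d p
  proof -
    have e: "elts (Gf f) = {p. \<exists>a d. maps a (ap (fun_ar S) f) D \<and> d \<in> elts D \<and> p = opair a d \<and>
      ap h d = ap (ap (funs B) f) (lam (ap (fun_ar S) f) (\<lambda>k. ap h (ap a k)))}"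
      unfolding Gf_def
      by (rule elts_mkset, rule isset_Collect[where a = "cart (funspace (ap (fun_ar S) f) D) D"], intro D3) auto
    have "ap h d = ap (ap (funs B) f) (lam (ap (fun_ar S) f) (\<lambda>k. ap h (ap a k))) \<longleftrightarrow>
        h \<cdot> d = funs B \<cdot> f \<cdot> lam (far f) (\<lambda>k. h \<cdot> (a \<cdot> k))" if "maps a (far f) D" "d \<in> elts D"
      unfolding far_ap[OF f, symmetric] maps_app_ap[OF h that(2)]
      unfolding structureD(8)[OF B f maps_comp[OF that(1) h]] unfolding hl[OF that(1)] ..
    then show "opair a d \<in> elts (Gf f) \<longleftrightarrow> maps a (far f) D \<and> d \<in> elts D \<and> h \<cdot> d = funs B \<cdot> f \<cdot> lam (far f) (\<lambda>k. h \<cdot> (a \<cdot> k))"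
      unfolding e by (auto simp: far_ap[OF f])
    show "p \<in> elts (Gf f) \<Longrightarrow> \<exists>a d. maps a (far f) D \<and> p = opair a d" unfolding e far_ap[OF f] by auto
  qed
  have fG: "func_on (Gf f) (funspace (far f) D)" if f: "f \<in> elts Fs" for f
    unfolding func_on_def
  proof (intro conjI ballI)
    fix a assume "a \<in> elts (funspace (far f) D)"
    then have a: "maps a (far f) D" by simp
    obtain d where "d \<in> elts D" "h \<cdot> d = funs B \<cdot> f \<cdot> lam (far f) (\<lambda>k. h \<cdot> (a \<cdot> k))" using cl[OF f a] by blast
    then show "\<exists>!d. opair a d \<in> elts (Gf f)" unfolding Gf[OF f] using a inj by metis
  qed (use Gf_pair[OF f] in auto)
  have G: "Gf f \<cdot> a \<in> elts D \<and> h \<cdot> (Gf f \<cdot> a) = funs B \<cdot> f \<cdot> lam (far f) (\<lambda>k. h \<cdot> (a \<cdot> k))"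
    if "f \<in> elts Fs" "maps a (far f) D" for f a
    using func_opair_app[OF fG[OF that(1)], of a] that by (simp add: Gf)
  have "is_structure S A"
    unfolding is_structure_def A_def mkstruct_sel
    using D func_lam[OF okR] func_lam[OF okG] fG G by (auto simp: lam_app[OF okR] lam_app[OF okG] Rr maps_def)
  moreover have "carrier A = D" by (simp add: A_def)
  moreover have "emb h A B"
    unfolding emb_def A_def mkstruct_sel
    using h inj G by (auto simp: lam_app[OF okR] lam_app[OF okG] Rr)
  ultimately show ?thesis by blast
qed

text \<open>\<open>A\<close> is isomorphic to the image of \<open>h\<close>, which carries a
  substructure of \<open>B\<close>.\<close>

lemma closed_emb:
  assumes iso: "closed_isomorphisms S K" and sub: "closed_substructures S K"
    and K: "\<forall>A\<in>K. is_structure S A" and B: "B \<in> K" and A: "is_structure S A" and h: "emb h A B"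
  shows "A \<in> K"
proof -
  note BS = K[rule_format, OF B] and hm = embD(1)[OF h]
  define D where "D = mkset (ap h ` elts (carrier A))"
  have "elts D = ap h ` elts (carrier A)" unfolding D_def by (intro elts_mkset replI D3)
  then have D: "elts D = (\<lambda>x. h \<cdot> x) ` elts (carrier A)" using maps_app_ap[OF hm] by auto
  have DB: "elts D \<subseteq> elts (carrier B)" using D maps_app[OF hm] by auto
  have hD: "maps h (carrier A) D" using maps_func[OF hm] D by (auto intro: mapsI)
  let ?id = "lam D (\<lambda>x. x)"
  have id: "maps ?id D (carrier B)" using DB by (intro maps_lam id_lam_ok) auto
  have "\<exists>d\<in>elts D. ?id \<cdot> d = funs B \<cdot> f \<cdot> lam (far f) (\<lambda>k. ?id \<cdot> (a \<cdot> k))"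
    if f: "f \<in> elts Fs" and a: "maps a (far f) D" for f a
  proof -
    have "\<exists>y. y \<in> elts (carrier A) \<and> ap h y = ap a k" if "k \<in> elts (far f)" for k
      using maps_app[OF a that] maps_app_ap[OF a that] maps_app_ap[OF hm] unfolding D by auto
    moreover have "dfn (\<lambda>s. s 1 \<in> elts (carrier A) \<and> ap h (s 1) = ap a (s 0))" by (intro D3)
    ultimately obtain b where b: "func_on b (far f)" "\<forall>k\<in>elts (far f). b \<cdot> k \<in> elts (carrier A) \<and> ap h (b \<cdot> k) = ap a k"
      using fin_choice[OF fin_omega[OF far_omega[OF f]], of "\<lambda>k y. y \<in> elts (carrier A) \<and> ap h y = ap a k"]
      by blast
    have bm: "maps b (far f) (carrier A)" using b by (auto intro: mapsI)
    have "a = lam (far f) (\<lambda>k. h \<cdot> (b \<cdot> k))"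
      using b(2) maps_app_ap[OF a] maps_app_ap[OF hm] by (intro func_lam_eqI[OF maps_func[OF a]]) simp
    then have "funs B \<cdot> f \<cdot> a = h \<cdot> (funs A \<cdot> f \<cdot> b)" using embD(4)[OF h f bm] by simp
    moreover have "h \<cdot> (funs A \<cdot> f \<cdot> b) \<in> elts D" using structureD(6)[OF A f bm] D by blast
    ultimately show ?thesis unfolding lam_id_app[OF a] using lam_app[OF id_lam_ok] by metis
  qed
  moreover have "elts D \<noteq> {}" using structureD(3)[OF A] D by simp
  ultimately obtain C where C: "is_structure S C" "carrier C = D" "emb ?id C B"
    using pullback_structure[OF BS id] lam_app[OF id_lam_ok] by metis
  have "is_substructure S C B"
    unfolding is_substructure_def C(2)
    using C(1) BS DB embD(3,4)[OF C(3)] structureD(6)[OF C(1)]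
    by (auto simp: C(2) lam_id_app lam_app[OF id_lam_ok])
  then have CK: "C \<in> K" using sub B unfolding closed_substructures_def by blast
  have "is_isomorphism S h A C"
    unfolding is_isomorphism_def C(2)
  proof (intro conjI ballI hD)
    show "\<exists>!x. x \<in> elts (carrier A) \<and> h \<cdot> x = y" if "y \<in> elts D" for y
      using that embD(2)[OF h] unfolding D by blast
    show "a \<in> elts (rels A \<cdot> r) \<longleftrightarrow> lam (rar r) (\<lambda>k. h \<cdot> (a \<cdot> k)) \<in> elts (rels C \<cdot> r)"
      if r: "r \<in> elts Rs" and "a \<in> elts (funspace (rar r) (carrier A))" for r a
    proof -
      have a: "maps a (rar r) (carrier A)" using that(2) by simp
      note m = maps_comp[OF a hD]
      show ?thesis using embD(3)[OF h r a] embD(3)[OF C(3) r] m lam_id_app[OF m] C(2) by simp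
    qed
    show "h \<cdot> (funs A \<cdot> f \<cdot> a) = funs C \<cdot> f \<cdot> lam (far f) (\<lambda>k. h \<cdot> (a \<cdot> k))"
      if f: "f \<in> elts Fs" and "a \<in> elts (funspace (far f) (carrier A))" for f a
    proof -
      have a: "maps a (far f) (carrier A)" using that(2) by simp
      note m = maps_comp[OF a hD]
      have "funs C \<cdot> f \<cdot> lam (far f) (\<lambda>k. h \<cdot> (a \<cdot> k)) \<in> elts D" using structureD(6)[OF C(1) f] m C(2) by simp
      then have "funs C \<cdot> f \<cdot> lam (far f) (\<lambda>k. h \<cdot> (a \<cdot> k)) = ?id \<cdot> (funs C \<cdot> f \<cdot> lam (far f) (\<lambda>k. h \<cdot> (a \<cdot> k)))"
        using lam_app[OF id_lam_ok] by simp
      also have "\<dots> = funs B \<cdot> f \<cdot> lam (far f) (\<lambda>k. h \<cdot> (a \<cdot> k))"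
        using embD(4)[OF C(3) f, of "lam (far f) (\<lambda>k. h \<cdot> (a \<cdot> k))"] m lam_id_app[OF m] C(2) by simp
      finally show ?thesis using embD(4)[OF h f a] by simp
    qed
  qed
  then show ?thesis using iso CK A unfolding closed_isomorphisms_def by blast
qed

subsection \<open>Basic Horn formulas\<close>

definition literal :: "'a \<Rightarrow> bool" where
  "literal l \<longleftrightarrow> is_atomic S l \<or> (\<exists>\<psi>. is_atomic S \<psi> \<and> l = Neg \<psi>)"

definition lit_sat :: "'a \<Rightarrow> 'a \<Rightarrow> 'a \<Rightarrow> bool" where
  "lit_sat A e l \<longleftrightarrow> (is_atomic S l \<and> at_sat A e l) \<or> (\<exists>\<psi>. is_atomic S \<psi> \<and> l = Neg \<psi> \<and> \<not> at_sat A e \<psi>)"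

lemma dfn_lit_sat: "dft t \<Longrightarrow> dft u \<Longrightarrow> dft v \<Longrightarrow> dfn (\<lambda>s. lit_sat (t s) (u s) (v s))"
  by (rule dfn3) (unfold lit_sat_def, intro D3 dfn_at_sat dfn_is_atomic)

lemma lit_sat_atomic [simp]: "is_atomic S \<psi> \<Longrightarrow> lit_sat A e \<psi> \<longleftrightarrow> at_sat A e \<psi>"
  and lit_sat_Neg [simp]: "is_atomic S \<psi> \<Longrightarrow> lit_sat A e (Neg \<psi>) \<longleftrightarrow> \<not> at_sat A e \<psi>"
  unfolding lit_sat_def by auto

lemma literal_Fm: "literal l \<Longrightarrow> l \<in> elts Fm"
  unfolding literal_def by (auto intro: atomic_Fm Neg_Fm)

lemma sat_literal:
  assumes "is_structure S A" "maps e omega (carrier A)" "literal l"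
  shows "sat A e l \<longleftrightarrow> lit_sat A e l"
  using assms(3) unfolding literal_def
  by (auto simp: sat_atomic[OF assms(1,2)] sat_Neg[OF assms(1,2)] atomic_Fm)

text \<open>The witnesses hidden in \<open>is_basic_Horn\<close>, in definable form. They stay
  explicit because satisfaction is computed from the list \<open>l\<close> of literals.\<close>

definition horn_seq :: "'a \<Rightarrow> 'a \<Rightarrow> 'a \<Rightarrow> 'a \<Rightarrow> bool" where
  "horn_seq n l g \<phi> \<longleftrightarrow> n \<in> elts omega \<and>
    func_on l (succ n) \<and> func_on g (succ n) \<and>
    ap g emp = ap l emp \<and>
    (\<forall>i\<in>elts n. ap g (succ i) = Disj (ap g i) (ap l (succ i))) \<and>
    \<phi> = ap g n \<and>
    (\<forall>i\<in>elts (succ n). literal (ap l i)) \<and>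
    (\<forall>i\<in>elts (succ n). \<forall>j\<in>elts (succ n).
      is_atomic S (ap l i) \<and> is_atomic S (ap l j) \<longrightarrow> i = j)"

lemma horn_seqD:
  assumes "horn_seq n l g \<phi>"
  shows "n \<in> elts omega" "ap g emp = ap l emp" "i \<in> elts n \<Longrightarrow> ap g (succ i) = Disj (ap g i) (ap l (succ i))"
    "\<phi> = ap g n" "i \<in> elts (succ n) \<Longrightarrow> literal (ap l i)"
    "i \<in> elts (succ n) \<Longrightarrow> j \<in> elts (succ n) \<Longrightarrow> is_atomic S (ap l i) \<Longrightarrow> is_atomic S (ap l j) \<Longrightarrow> i = j"
  using assms unfolding horn_seq_def by blast+

lemma is_basic_Horn_iff: "is_basic_Horn S \<phi> \<longleftrightarrow> (\<exists>n l g. horn_seq n l g \<phi>)"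
proof -
  have "func_on l (succ n) \<and> func_on g (succ n) \<and>
    g \<cdot> num 0 = l \<cdot> num 0 \<and>
    (\<forall>i\<in>elts n. g \<cdot> succ i = Disj (g \<cdot> i) (l \<cdot> succ i)) \<and>
    \<phi> = g \<cdot> n \<and>
    (\<forall>i\<in>elts (succ n). is_atomic S (l \<cdot> i) \<or> (\<exists>\<psi>. is_atomic S \<psi> \<and> l \<cdot> i = Neg \<psi>)) \<and>
    (\<forall>i\<in>elts (succ n). \<forall>j\<in>elts (succ n).
      is_atomic S (l \<cdot> i) \<and> is_atomic S (l \<cdot> j) \<longrightarrow> i = j) \<longleftrightarrow> horn_seq n l g \<phi>"
    if n: "n \<in> elts omega" for n l g
  proof (cases "func_on l (succ n) \<and> func_on g (succ n)")
    case True
    have l: "l \<cdot> i = ap l i" "g \<cdot> i = ap g i" if "i \<in> elts (succ n)" for i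
      using True app_ap that by auto
    have s: "succ i \<in> elts (succ n)" if "i \<in> elts n" for i
      using succ_mem_or_eq[OF n that] by auto
    show ?thesis
      unfolding horn_seq_def literal_def[symmetric] num_0
      using True n emp_in_succ[OF n] l l[OF s] by simp
  next
    case False
    then show ?thesis unfolding horn_seq_def by (intro iffI; elim conjE; blast)
  qed
  then show ?thesis unfolding is_basic_Horn_def by (auto simp: horn_seq_def)
qed

lemma dfn_horn_seq: "dfn (\<lambda>s. horn_seq (s i) (s j) (s k) (s m))"
  unfolding horn_seq_def literal_def by (intro D3 dfn_is_atomic)

lemma dfn_is_basic_Horn: "dft t \<Longrightarrow> dfn (\<lambda>s. is_basic_Horn S (t s))"
  by (rule dfn1) (unfold is_basic_Horn_iff, intro D3 dfn_horn_seq)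

lemma horn_Fm:
  assumes "horn_seq n l g \<phi>"
  shows "\<phi> \<in> elts Fm"
proof -
  note H = horn_seqD[OF assms]
  have "i \<in> elts (succ n) \<longrightarrow> ap g i \<in> elts Fm" if "i \<in> elts omega" for i
  proof (rule omega_induct[OF that, where P = "\<lambda>i. i \<in> elts (succ n) \<longrightarrow> ap g i \<in> elts Fm"])
    show "emp \<in> elts (succ n) \<longrightarrow> ap g emp \<in> elts Fm"
      unfolding H(2) using literal_Fm[OF H(5)] by blast
    show "succ m \<in> elts (succ n) \<longrightarrow> ap g (succ m) \<in> elts Fm"
      if m: "m \<in> elts omega" "m \<in> elts (succ n) \<longrightarrow> ap g m \<in> elts Fm" for m
    proof
      assume s: "succ m \<in> elts (succ n)"
      then have mn: "m \<in> elts n" using omega_trans[OF H(1), of "succ m"] by auto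
      then show "ap g (succ m) \<in> elts Fm" unfolding H(3)[OF mn] using Disj_Fm literal_Fm[OF H(5)[OF s]] m(2) by simp
    qed
  qed (intro D3)
  then show ?thesis using H(1) unfolding H(4) by simp
qed

text \<open>Induction along the partial disjunctions \<open>ap g i\<close>, as long as
  \<open>i\<close> is a position of the list. From here on, the way the disjunction is bracketed no
  longer matters.\<close>

lemma horn_sat:
  assumes A: "is_structure S A" and e: "maps e omega (carrier A)" and H: "horn_seq n l g \<phi>"
  shows "sat A e \<phi> \<longleftrightarrow> (\<exists>i\<in>elts (succ n). lit_sat A e (ap l i))"
proof -
  note n = horn_seqD(1)[OF H] and lit = horn_seqD(5)[OF H]
  let ?U = "sat_sets S A"
  let ?P = "\<lambda>i. i \<in> elts (succ n) \<longrightarrow> ap g i \<in> elts Fm \<and>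
      (e \<in> elts (ap ?U (ap g i)) \<longleftrightarrow> (\<exists>j\<in>elts (succ i). lit_sat A e (ap l j)))"
  have P: "?P i" if "i \<in> elts omega" for i
  proof (rule omega_induct[OF that, where P = ?P])
    show "?P emp"
      using literal_Fm[OF lit] sat_literal[OF A e lit] sat_ap[OF A literal_Fm[OF lit]]
      unfolding horn_seqD(2)[OF H] by simp
    show "?P (succ m)" if m: "m \<in> elts omega" "?P m" for m
    proof
      assume s: "succ m \<in> elts (succ n)"
      then have mn: "m \<in> elts n" using omega_trans[OF n, of "succ m"] by auto
      then have g: "ap g (succ m) = Disj (ap g m) (ap l (succ m))" by (rule horn_seqD(3)[OF H])
      have IH: "ap g m \<in> elts Fm" "e \<in> elts (ap ?U (ap g m)) \<longleftrightarrow> (\<exists>j\<in>elts (succ m). lit_sat A e (ap l j))"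
        using m(2) mn by auto
      show "ap g (succ m) \<in> elts Fm \<and>
        (e \<in> elts (ap ?U (ap g (succ m))) \<longleftrightarrow> (\<exists>j\<in>elts (succ (succ m)). lit_sat A e (ap l j)))"
        unfolding g sat_ap[OF A Disj_Fm[OF IH(1) literal_Fm[OF lit[OF s]]], symmetric]
          sat_Disj[OF A e IH(1) literal_Fm[OF lit[OF s]]] sat_ap[OF A IH(1)] IH(2) sat_literal[OF A e lit[OF s]]
        using Disj_Fm[OF IH(1) literal_Fm[OF lit[OF s]]] by auto
    qed
  qed (intro D3 dfn_lit_sat)
  show ?thesis using P[OF n] sat_ap[OF A horn_Fm[OF H]] horn_seqD(4)[OF H] by simp
qed

lemma models_horn:
  assumes A: "is_structure S A" and H: "horn_seq n l g \<phi>"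
  shows "models S A \<phi> \<longleftrightarrow> (\<forall>e. maps e omega (carrier A) \<longrightarrow> (\<exists>i\<in>elts (succ n). lit_sat A e (ap l i)))"
  unfolding models_def sat_def[OF A, symmetric] using horn_sat[OF A _ H] by auto

text \<open>Basic Horn formulas are quantifier free: pushing an assignment forward along
  \<open>h\<close> preserves the truth value of every literal.\<close>

lemma emb_models:
  assumes A: "is_structure S A" and B: "is_structure S B" and h: "emb h A B"
    and \<phi>: "is_basic_Horn S \<phi>" and m: "models S B \<phi>"
  shows "models S A \<phi>"
proof -
  obtain n l g where H: "horn_seq n l g \<phi>" using \<phi> is_basic_Horn_iff by blast
  show ?thesis
    unfolding models_horn[OF A H]
  proof (intro allI impI)
    fix e assume e: "maps e omega (carrier A)"
    obtain i where i: "i \<in> elts (succ n)" "lit_sat B (lam omega (\<lambda>n. h \<cdot> (e \<cdot> n))) (ap l i)"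
      using m[unfolded models_horn[OF B H]] emb_assignment[OF A B h e] by blast
    then show "\<exists>i\<in>elts (succ n). lit_sat A e (ap l i)"
      using at_sat_emb[OF A B h e] unfolding lit_sat_def by blast
  qed
qed

text \<open>A finite set of premises is turned into the list that the definition of basic Horn
  formulas requires, starting from \<open>\<sigma>\<close> alone and appending one negated atom at a
  time. Appended literals are never atomic, so at most the initial one is.\<close>

lemma horn_exists:
  assumes L: "fin L" "\<And>\<alpha>. \<alpha> \<in> elts L \<Longrightarrow> is_atomic S \<alpha>" and \<sigma>: "literal \<sigma>"
  shows "\<exists>n l g \<phi>. horn_seq n l g \<phi> \<and>
    (\<forall>x. (\<exists>i\<in>elts (succ n). ap l i = x) \<longleftrightarrow> x = \<sigma> \<or> (\<exists>\<alpha>\<in>elts L. x = Neg \<alpha>))"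
proof (rule fin_induct[OF L(1), where P = "\<lambda>L. \<exists>n l g \<phi>. horn_seq n l g \<phi> \<and>
    (\<forall>x. (\<exists>i\<in>elts (succ n). ap l i = x) \<longleftrightarrow> x = \<sigma> \<or> (\<exists>\<alpha>\<in>elts L. x = Neg \<alpha>))"])
  show "dfn (\<lambda>s. \<exists>n l g \<phi>. horn_seq n l g \<phi> \<and>
    (\<forall>x. (\<exists>i\<in>elts (succ n). ap l i = x) \<longleftrightarrow> x = \<sigma> \<or> (\<exists>\<alpha>\<in>elts (s 0). x = Neg \<alpha>)))"
    by (intro D3 dfn_horn_seq)
  have ok: "lam_ok (succ emp) (\<lambda>_. \<sigma>)" by (intro lam_okI D3)
  have v: "ap (lam (succ emp) (\<lambda>_. \<sigma>)) emp = \<sigma>"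
    using lam_app[OF ok, of emp] app_ap[OF func_lam[OF ok], of emp] by simp
  show "\<exists>n l g \<phi>. horn_seq n l g \<phi> \<and>
    (\<forall>x. (\<exists>i\<in>elts (succ n). ap l i = x) \<longleftrightarrow> x = \<sigma> \<or> (\<exists>\<alpha>\<in>elts emp. x = Neg \<alpha>))"
    by (rule exI[of _ emp], rule exI[of _ "lam (succ emp) (\<lambda>_. \<sigma>)"], rule exI[of _ "lam (succ emp) (\<lambda>_. \<sigma>)"],
      rule exI[of _ \<sigma>]) (auto simp: horn_seq_def func_lam[OF ok] v \<sigma>)
  fix L' \<alpha> assume \<alpha>: "\<alpha> \<in> elts L" and "\<exists>n l g \<phi>. horn_seq n l g \<phi> \<and>
    (\<forall>x. (\<exists>i\<in>elts (succ n). ap l i = x) \<longleftrightarrow> x = \<sigma> \<or> (\<exists>\<alpha>\<in>elts L'. x = Neg \<alpha>))"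
  then obtain n l g \<phi> where H: "horn_seq n l g \<phi>"
    and x: "\<And>x. (\<exists>i\<in>elts (succ n). ap l i = x) \<longleftrightarrow> x = \<sigma> \<or> (\<exists>\<alpha>\<in>elts L'. x = Neg \<alpha>)" by blast
  have n: "n \<in> elts omega" and fl: "func_on l (succ n)" and fg: "func_on g (succ n)"
    using H unfolding horn_seq_def by auto
  have new: "succ n \<notin> elts (succ n)" by (rule mem_irrefl)
  have ins_eq: "ins (succ n) (succ n) = succ (succ n)" by (simp add: succ_eq_ins)
  define l' where "l' = ins (opair (succ n) (Neg \<alpha>)) l"
  define g' where "g' = ins (opair (succ n) (Disj \<phi> (Neg \<alpha>))) g"
  have f': "func_on l' (succ (succ n))" "func_on g' (succ (succ n))"
    unfolding l'_def g'_def using func_extend(1)[OF fl new] func_extend(1)[OF fg new] ins_eq by auto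
  have "l' \<cdot> succ n = Neg \<alpha>" "g' \<cdot> succ n = Disj \<phi> (Neg \<alpha>)"
    unfolding l'_def g'_def by (rule func_extend(2)[OF fl new], rule func_extend(2)[OF fg new])
  then have l'1: "ap l' (succ n) = Neg \<alpha>" and g'1: "ap g' (succ n) = Disj \<phi> (Neg \<alpha>)"
    using app_ap[OF f'(1), of "succ n"] app_ap[OF f'(2), of "succ n"] by simp_all
  have l'2: "ap l' i = ap l i" and g'2: "ap g' i = ap g i" if i: "i \<in> elts (succ n)" for i
  proof -
    have "l' \<cdot> i = l \<cdot> i" "g' \<cdot> i = g \<cdot> i"
      unfolding l'_def g'_def by (rule func_extend(3)[OF fl new i], rule func_extend(3)[OF fg new i])
    moreover have "i \<in> elts (succ (succ n))" using i unfolding elts_succ[of "succ n"] by blast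
    ultimately show "ap l' i = ap l i" "ap g' i = ap g i"
      using app_ap[OF f'(1), of i] app_ap[OF f'(2), of i] app_ap[OF fl i] app_ap[OF fg i] by simp_all
  qed
  have "horn_seq (succ n) l' g' (Disj \<phi> (Neg \<alpha>))"
    unfolding horn_seq_def
  proof (intro conjI ballI impI f')
    show "succ n \<in> elts omega" by (rule succ_in_omega[OF n])
    show "ap g' emp = ap l' emp" using l'2 g'2 emp_in_succ[OF n] horn_seqD(2)[OF H] by simp
    show "ap g' (succ i) = Disj (ap g' i) (ap l' (succ i))" if i: "i \<in> elts (succ n)" for i
    proof (cases "i = n")
      case True
      then show ?thesis using g'1 l'1 g'2[OF i] horn_seqD(4)[OF H] by simp
    next
      case False
      then have "i \<in> elts n" "succ i \<in> elts (succ n)" using i succ_mem_or_eq[OF n, of i] by auto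
      then show ?thesis using g'2 l'2 i horn_seqD(3)[OF H] by simp
    qed
    show "Disj \<phi> (Neg \<alpha>) = ap g' (succ n)" using g'1 by simp
    show "literal (ap l' i)" if i: "i \<in> elts (succ (succ n))" for i
    proof (cases "i = succ n")
      case True
      then show ?thesis using l'1 L(2)[OF \<alpha>] unfolding literal_def by auto
    next
      case False
      then have "i \<in> elts (succ n)" using i unfolding elts_succ[of "succ n"] by blast
      then show ?thesis using l'2 horn_seqD(5)[OF H] by simp
    qed
    show "i = j" if ij: "i \<in> elts (succ (succ n))" "j \<in> elts (succ (succ n))" "is_atomic S (ap l' i) \<and> is_atomic S (ap l' j)" for i j
    proof -
      have "i \<noteq> succ n" "j \<noteq> succ n" using ij(3) l'1 by auto
      then have "i \<in> elts (succ n)" "j \<in> elts (succ n)"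
        using ij(1,2) unfolding elts_succ[of "succ n"] by blast+
      then show ?thesis using ij(3) l'2 horn_seqD(6)[OF H, of i j] by simp
    qed
  qed
  moreover have "(\<exists>i\<in>elts (succ (succ n)). ap l' i = x) \<longleftrightarrow> x = \<sigma> \<or> (\<exists>\<alpha>\<in>elts (ins \<alpha> L'). x = Neg \<alpha>)" for x
  proof -
    have "(\<exists>i\<in>elts (succ (succ n)). ap l' i = x) \<longleftrightarrow> x = Neg \<alpha> \<or> (\<exists>i\<in>elts (succ n). ap l i = x)"
      using l'1 l'2 unfolding elts_succ[of "succ n"] by auto
    then show ?thesis unfolding x by auto
  qed
  ultimately show "\<exists>n l g \<phi>. horn_seq n l g \<phi> \<and>
    (\<forall>x. (\<exists>i\<in>elts (succ n). ap l i = x) \<longleftrightarrow> x = \<sigma> \<or> (\<exists>\<alpha>\<in>elts (ins \<alpha> L'). x = Neg \<alpha>))" by blast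
qed

lemma lam_ap: "lam_ok X g \<Longrightarrow> x \<in> elts X \<Longrightarrow> ap (lam X g) x = g x"
  using lam_app[of X g x] app_ap[OF func_lam, of X g x] by simp

subsection \<open>Reduced products\<close>

lemma elts_product_of:
  assumes A: "func_on A I"
  shows "elts (product I A) = {a. func_on a I \<and> (\<forall>i\<in>elts I. ap a i \<in> elts (carrier (ap A i)))}"
proof -
  have "isset ((\<lambda>i. carrier (ap A i)) ` elts I)" by (intro replI D3)
  then have "isset (\<Union>x\<in>(\<lambda>i. carrier (ap A i)) ` elts I. elts x)"
    using isset_Union[of "mkset ((\<lambda>i. carrier (ap A i)) ` elts I)"] by (simp add: elts_mkset)
  then obtain U where U: "elts U = (\<Union>i\<in>elts I. elts (carrier (ap A i)))" unfolding isset_def by auto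
  have eq: "{a. func_on a I \<and> (\<forall>i\<in>elts I. a \<cdot> i \<in> elts (carrier (A \<cdot> i)))} =
      {a. func_on a I \<and> (\<forall>i\<in>elts I. ap a i \<in> elts (carrier (ap A i)))}"
    by (auto simp: app_ap[OF A] app_ap)
  show ?thesis unfolding product_def eq
  proof (rule elts_mkset, rule isset_Collect[where a = "pow (cart I U)"])
    show "dfn (\<lambda>s. func_on (s 0) I \<and> (\<forall>i\<in>elts I. ap (s 0) i \<in> elts (carrier (ap A i))))" by (intro D3)
    fix a assume a: "func_on a I \<and> (\<forall>i\<in>elts I. ap a i \<in> elts (carrier (ap A i)))"
    then have "maps a I U" unfolding maps_ap U by blast
    then show "a \<in> elts (pow (cart I U))" using maps_subset_cart by simp
  qed
qed

context
  fixes I F A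
  assumes F: "proper_filter I F" and A: "func_on A I"
    and A_struct: "\<forall>i\<in>elts I. is_structure S (A \<cdot> i)"
    and nonempty: "elts (product I A) \<noteq> {}"
begin

lemma A_ap: "i \<in> elts I \<Longrightarrow> A \<cdot> i = ap A i"
  by (rule app_ap[OF A])

lemma ap_struct: "i \<in> elts I \<Longrightarrow> is_structure S (ap A i)"
  using A_struct A_ap by metis

text \<open>Truth at almost all indices. For a predicate that is not definable, \<open>mkset\<close>
  may produce junk, hence the definability premises in the rules that compare or combine large
  sets.\<close>

definition big :: "('a \<Rightarrow> bool) \<Rightarrow> bool" where
  "big Q \<longleftrightarrow> mkset {i \<in> elts I. Q i} \<in> elts F"

lemma big_cong: "(\<And>i. i \<in> elts I \<Longrightarrow> Q i \<longleftrightarrow> Q' i) \<Longrightarrow> big Q \<longleftrightarrow> big Q'"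
  unfolding big_def by (metis (mono_tags, lifting) Collect_cong)

lemma big_mono:
  assumes "dfn (\<lambda>s. Q (s 0))" "dfn (\<lambda>s. Q' (s 0))" "big Q" "\<And>i. i \<in> elts I \<Longrightarrow> Q i \<Longrightarrow> Q' i"
  shows "big Q'"
proof -
  have "elts (mkset {i \<in> elts I. Q i}) \<subseteq> elts (mkset {i \<in> elts I. Q' i})"
    "elts (mkset {i \<in> elts I. Q' i}) \<subseteq> elts I"
    unfolding elts_mkset[OF sepI[OF assms(1)]] elts_mkset[OF sepI[OF assms(2)]] using assms(4) by auto
  then show ?thesis using F assms(3) unfolding big_def proper_filter_def by blast
qed

lemma big_conj:
  assumes "dfn (\<lambda>s. Q (s 0))" "dfn (\<lambda>s. Q' (s 0))" "big Q" "big Q'"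
  shows "big (\<lambda>i. Q i \<and> Q' i)"
proof -
  have "mkset (elts (mkset {i \<in> elts I. Q i}) \<inter> elts (mkset {i \<in> elts I. Q' i})) \<in> elts F"
    using F assms(3,4) unfolding big_def proper_filter_def by blast
  moreover have "{i \<in> elts I. Q i} \<inter> {i \<in> elts I. Q' i} = {i \<in> elts I. Q i \<and> Q' i}" by blast
  ultimately show ?thesis
    unfolding big_def elts_mkset[OF sepI[OF assms(1)]] elts_mkset[OF sepI[OF assms(2)]] by simp
qed

lemma big_all: "(\<And>i. i \<in> elts I \<Longrightarrow> Q i) \<Longrightarrow> big Q"
proof -
  assume "\<And>i. i \<in> elts I \<Longrightarrow> Q i"
  then have "{i \<in> elts I. Q i} = elts I" by blast
  then show ?thesis using F unfolding big_def proper_filter_def by simp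
qed

lemma big_ex: "big Q \<Longrightarrow> \<exists>i\<in>elts I. Q i"
proof (rule ccontr)
  assume b: "big Q" and "\<not> (\<exists>i\<in>elts I. Q i)"
  then have e: "{i \<in> elts I. Q i} = {}" by blast
  have "mkset {} \<in> elts F" using b unfolding big_def e .
  then show False using F unfolding proper_filter_def by blast
qed

lemma dfn_big:
  assumes "dfn (\<lambda>s. Q (s 0) (\<lambda>n. s (Suc n)))"
  shows "dfn (\<lambda>s. big (\<lambda>i. Q i s))"
  unfolding big_def by (intro D3 assms)

text \<open>The families to be intersected are finite in the sense of the model, so closure under
  binary intersections is iterated by internal induction.\<close>

lemma big_fin:
  assumes V: "fin V" and Q: "dfn (\<lambda>s. Q (s 0) (s 1))" and b: "\<And>k. k \<in> elts V \<Longrightarrow> big (Q k)"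
  shows "big (\<lambda>i. \<forall>k\<in>elts V. Q k i)"
proof (rule fin_induct[OF V, where P = "\<lambda>V. big (\<lambda>i. \<forall>k\<in>elts V. Q k i)"])
  show "dfn (\<lambda>s. big (\<lambda>i. \<forall>k\<in>elts (s 0). Q k i))" by (intro dfn_big D3 dfn2[OF Q])
  show "big (\<lambda>i. \<forall>k\<in>elts emp. Q k i)" by (rule big_all) simp
  fix Y x assume x: "x \<in> elts V" and IH: "big (\<lambda>i. \<forall>k\<in>elts Y. Q k i)"
  have "big (\<lambda>i. Q x i \<and> (\<forall>k\<in>elts Y. Q k i))"
    by (rule big_conj[OF _ _ b[OF x] IH]) (intro D3 dfn2[OF Q])+
  then show "big (\<lambda>i. \<forall>k\<in>elts (ins x Y). Q k i)" by simp
qed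

abbreviation "Pr \<equiv> product I A"

lemmas elts_product = elts_product_of[OF A]

lemma Pr_ap: "a \<in> elts Pr \<Longrightarrow> i \<in> elts I \<Longrightarrow> ap a i \<in> elts (carrier (ap A i))"
  and Pr_func: "a \<in> elts Pr \<Longrightarrow> func_on a I"
  unfolding elts_product by auto

definition ecl :: "'a \<Rightarrow> 'a" where
  "ecl a = mkset {b. b \<in> elts Pr \<and> big (\<lambda>i. ap a i = ap b i)}"

lemma dft_ecl: "dft t \<Longrightarrow> dft (\<lambda>s. ecl (t s))"
  by (rule dft1) (unfold ecl_def, intro D3 dfn_big)

lemma eq_class_ecl:
  assumes "a \<in> elts Pr"
  shows "eq_class I F A a = ecl a"
proof -
  have "{i \<in> elts I. a \<cdot> i = b \<cdot> i} = {i \<in> elts I. ap a i = ap b i}" if "b \<in> elts Pr" for b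
    using app_ap[OF Pr_func[OF assms]] app_ap[OF Pr_func[OF that]] by auto
  then show ?thesis unfolding eq_class_def ecl_def big_def
    by (intro arg_cong[where f = mkset] Collect_cong conj_cong refl) simp
qed

lemma elts_ecl: "elts (ecl a) = {b. b \<in> elts Pr \<and> big (\<lambda>i. ap a i = ap b i)}"
  unfolding ecl_def by (intro elts_mkset sepI dfn_big D3)

lemma big_eq_trans:
  assumes "big (\<lambda>i. ap a i = ap b i)" "big (\<lambda>i. ap b i = ap c i)"
  shows "big (\<lambda>i. ap a i = ap c i)"
proof (rule big_mono[OF _ _ big_conj[OF _ _ assms]])
qed (intro D3 | simp)+

lemma big_eq_sym: "big (\<lambda>i. ap a i = ap b i) \<longleftrightarrow> big (\<lambda>i. ap b i = ap a i)"
  by (rule big_cong) auto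

lemma ecl_eq_iff:
  assumes a: "a \<in> elts Pr" and b: "b \<in> elts Pr"
  shows "ecl a = ecl b \<longleftrightarrow> big (\<lambda>i. ap a i = ap b i)"
proof
  assume "ecl a = ecl b"
  moreover have "b \<in> elts (ecl b)" unfolding elts_ecl using b big_all[of "\<lambda>i. ap b i = ap b i"] by simp
  ultimately have "b \<in> elts (ecl a)" by simp
  then show "big (\<lambda>i. ap a i = ap b i)" unfolding elts_ecl by simp
next
  assume ab: "big (\<lambda>i. ap a i = ap b i)"
  show "ecl a = ecl b"
    using big_eq_trans[OF ab] big_eq_trans[OF ab[unfolded big_eq_sym[of a b]]]
    by (intro elts_ext) (auto simp: elts_ecl)
qed

abbreviation "RP \<equiv> reduced_product S I F A"

lemma carrier_P: "elts (carrier RP) = ecl ` elts Pr"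
proof -
  have "{eq_class I F A a | a. a \<in> elts Pr} = ecl ` elts Pr"
    unfolding Setcompr_eq_image by (rule image_cong) (simp_all add: eq_class_ecl)
  then show ?thesis
    unfolding reduced_product_def mkstruct_sel by (simp add: elts_mkset replI dft_ecl D3)
qed

lemma ecl_in_P: "a \<in> elts Pr \<Longrightarrow> ecl a \<in> elts (carrier RP)"
  unfolding carrier_P by blast

lemma lam_ecl_maps: "maps u n Pr \<Longrightarrow> maps (lam n (\<lambda>k. ecl (u \<cdot> k))) n (carrier RP)"
proof (rule maps_lam)
  assume u: "maps u n Pr"
  show "lam_ok n (\<lambda>k. ecl (u \<cdot> k))"
    by (rule lam_okI'[where h = "\<lambda>k. ecl (ap u k)"], intro dft_ecl D3) (simp add: maps_app_ap[OF u])
qed (use ecl_in_P maps_app in blast)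

lemma lam_ok_ecl: "maps u n Pr \<Longrightarrow> lam_ok n (\<lambda>k. ecl (u \<cdot> k))"
  by (rule lam_okI'[where h = "\<lambda>k. ecl (ap u k)"], intro dft_ecl D3) (simp add: maps_app_ap)

text \<open>An arbitrary family of classes need not have representatives in ZF; for a finite one
  \<open>fin_choice\<close> finds them.\<close>

lemma representatives:
  assumes V: "fin V" and y: "maps y V (carrier RP)"
  shows "\<exists>u. maps u V Pr \<and> y = lam V (\<lambda>k. ecl (u \<cdot> k))"
proof -
  have "\<exists>z. z \<in> elts Pr \<and> ecl z = ap y k" if "k \<in> elts V" for k
    using maps_app[OF y that] maps_app_ap[OF y that] unfolding carrier_P by auto
  moreover have "dfn (\<lambda>s. s 1 \<in> elts Pr \<and> ecl (s 1) = ap y (s 0))" by (intro D3 dft_ecl)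
  ultimately obtain u where u: "func_on u V" "\<forall>k\<in>elts V. u \<cdot> k \<in> elts Pr \<and> ecl (u \<cdot> k) = ap y k"
    using fin_choice[OF V, of "\<lambda>k z. z \<in> elts Pr \<and> ecl z = ap y k"] by blast
  then have "maps u V Pr" by (auto intro: mapsI)
  moreover have "y = lam V (\<lambda>k. ecl (u \<cdot> k))"
    using u(2) maps_app_ap[OF y] by (intro func_lam_eqI[OF maps_func[OF y]]) simp
  ultimately show ?thesis by blast
qed

text \<open>Each entry agrees on a large set of its own; as the tuple is finite, all entries agree
  on a common large set. Independence of representatives for relations and functions rests on
  this.\<close>

lemma representatives_big:
  assumes V: "fin V" and u: "maps u V Pr" and w: "maps w V Pr"
    and eq: "lam V (\<lambda>k. ecl (u \<cdot> k)) = lam V (\<lambda>k. ecl (w \<cdot> k))"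
  shows "big (\<lambda>i. \<forall>k\<in>elts V. ap (ap u k) i = ap (ap w k) i)"
proof (rule big_fin[OF V])
  show "dfn (\<lambda>s. ap (ap u (s 0)) (s 1) = ap (ap w (s 0)) (s 1))" by (intro D3)
  fix k assume k: "k \<in> elts V"
  have "ecl (u \<cdot> k) = ecl (w \<cdot> k)"
    using lam_app[OF lam_ok_ecl[OF u] k] lam_app[OF lam_ok_ecl[OF w] k] eq by simp
  then show "big (\<lambda>i. ap (ap u k) i = ap (ap w k) i)"
    using ecl_eq_iff[OF maps_app[OF u k] maps_app[OF w k]] maps_app_ap[OF u k] maps_app_ap[OF w k] by simp
qed

lemma lam_ok_coord: "lam_ok n (\<lambda>k. ap (ap u k) i)"
  by (intro lam_okI D3)

lemma coord_maps: "maps u n Pr \<Longrightarrow> i \<in> elts I \<Longrightarrow> maps (lam n (\<lambda>k. ap (ap u k) i)) n (carrier (ap A i))"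
  by (rule maps_lam[OF lam_ok_coord]) (metis Pr_ap maps_app maps_app_ap)

lemma coord_eq: "maps u n Pr \<Longrightarrow> i \<in> elts I \<Longrightarrow> lam n (\<lambda>k. u \<cdot> k \<cdot> i) = lam n (\<lambda>k. ap (ap u k) i)"
  by (rule lam_cong) (metis app_ap maps_app maps_app_ap Pr_func)

section \<open>Relations of the reduced product\<close>

definition rel_big :: "'a \<Rightarrow> 'a \<Rightarrow> bool" where
  "rel_big r u \<longleftrightarrow> big (\<lambda>i. lam (ap (rel_ar S) r) (\<lambda>k. ap (ap u k) i) \<in> elts (ap (rels (ap A i)) r))"

lemma redprod_rel_eq:
  assumes r: "r \<in> elts Rs"
  shows "redprod_rel S I F A r = mkset {y. \<exists>u. maps u (ap (rel_ar S) r) Pr \<and> rel_big r u \<and>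
    y = lam (ap (rel_ar S) r) (\<lambda>k. ecl (ap u k))}"
proof -
  have 1: "mkset {i \<in> elts I. lam (rar r) (\<lambda>k. u \<cdot> k \<cdot> i) \<in> elts (rels (A \<cdot> i) \<cdot> r)} \<in> elts F \<longleftrightarrow> rel_big r u"
    if u: "maps u (rar r) Pr" for u
  proof -
    have "lam (rar r) (\<lambda>k. u \<cdot> k \<cdot> i) \<in> elts (rels (A \<cdot> i) \<cdot> r) \<longleftrightarrow>
        lam (ap (rel_ar S) r) (\<lambda>k. ap (ap u k) i) \<in> elts (ap (rels (ap A i)) r)" if i: "i \<in> elts I" for i
      unfolding rar_ap[OF r, symmetric] coord_eq[OF u i] A_ap[OF i] structureD(7)[OF ap_struct[OF i] r] ..
    then show ?thesis unfolding rel_big_def big_def[symmetric] by (intro big_cong) simp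
  qed
  have 2: "lam (rar r) (\<lambda>k. eq_class I F A (u \<cdot> k)) = lam (rar r) (\<lambda>k. ecl (ap u k))" if u: "maps u (rar r) Pr" for u
    by (rule lam_cong) (metis eq_class_ecl u maps_app maps_app_ap)
  have "{lam (rar r) (\<lambda>k. eq_class I F A (u \<cdot> k)) | u. maps u (rar r) Pr \<and>
     mkset {i \<in> elts I. lam (rar r) (\<lambda>k. u \<cdot> k \<cdot> i) \<in> elts (rels (A \<cdot> i) \<cdot> r)} \<in> elts F} =
    {y. \<exists>u. maps u (rar r) Pr \<and> rel_big r u \<and> y = lam (rar r) (\<lambda>k. ecl (ap u k))}"
    by (intro Collect_cong ex_cong1) (auto simp: 1 2)
  then show ?thesis unfolding redprod_rel_def rar_ap[OF r] by simp
qed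

lemma lam_ecl_ap: "maps u n Pr \<Longrightarrow> lam n (\<lambda>k. ecl (u \<cdot> k)) = lam n (\<lambda>k. ecl (ap u k))"
  by (rule lam_cong) (simp add: maps_app_ap)

lemma rels_P: "r \<in> elts Rs \<Longrightarrow> rels RP \<cdot> r = redprod_rel S I F A r"
  and func_rels_P: "func_on (rels RP) Rs"
proof -
  have ok: "lam_ok Rs (redprod_rel S I F A)"
    by (rule lam_okI'[OF _ redprod_rel_eq], unfold rel_big_def, intro D3 dfn_big dft_ecl)
  show "r \<in> elts Rs \<Longrightarrow> rels RP \<cdot> r = redprod_rel S I F A r" "func_on (rels RP) Rs"
    unfolding reduced_product_def mkstruct_sel using lam_app[OF ok] func_lam[OF ok] by auto
qed

lemma elts_rels_P:
  assumes r: "r \<in> elts Rs"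
  shows "elts (rels RP \<cdot> r) = {y. \<exists>u. maps u (rar r) Pr \<and> rel_big r u \<and> y = lam (rar r) (\<lambda>k. ecl (u \<cdot> k))}"
proof -
  have "elts (rels RP \<cdot> r) = {y. \<exists>u. maps u (ap (rel_ar S) r) Pr \<and> rel_big r u \<and>
    y = lam (ap (rel_ar S) r) (\<lambda>k. ecl (ap u k))}"
    unfolding rels_P[OF r] redprod_rel_eq[OF r]
  proof (rule elts_mkset, rule isset_Collect[where a = "funspace (rar r) (carrier RP)"])
    show "dfn (\<lambda>s. \<exists>u. maps u (ap (rel_ar S) r) Pr \<and> rel_big r u \<and> s 0 = lam (ap (rel_ar S) r) (\<lambda>k. ecl (ap u k)))"
      unfolding rel_big_def by (intro D3 dfn_big dft_ecl)
  qed (use lam_ecl_maps lam_ecl_ap in \<open>auto simp: rar_ap[OF r]\<close>)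
  then show ?thesis unfolding rar_ap[OF r, symmetric] using lam_ecl_ap by auto
qed

lemma dfn_rel_coord: "dfn (\<lambda>s. lam n (\<lambda>k. ap (ap u k) (s 0)) \<in> elts (ap (rels (ap A (s 0))) r))"
  by (intro D3)

text \<open>The definition asks for some suitable tuple of representatives; by
  \<open>representatives_big\<close>, every tuple representing the same classes is then
  suitable.\<close>

lemma rel_P_iff:
  assumes r: "r \<in> elts Rs" and u: "maps u (rar r) Pr"
  shows "lam (rar r) (\<lambda>k. ecl (u \<cdot> k)) \<in> elts (rels RP \<cdot> r) \<longleftrightarrow> rel_big r u"
proof
  assume "lam (rar r) (\<lambda>k. ecl (u \<cdot> k)) \<in> elts (rels RP \<cdot> r)"
  then obtain w where w: "maps w (rar r) Pr" "rel_big r w"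
    "lam (rar r) (\<lambda>k. ecl (w \<cdot> k)) = lam (rar r) (\<lambda>k. ecl (u \<cdot> k))" unfolding elts_rels_P[OF r] by auto
  note b = representatives_big[OF fin_omega[OF rar_omega[OF r]] w(1) u w(3)]
  show "rel_big r u"
    unfolding rel_big_def
  proof (rule big_mono[OF _ dfn_rel_coord big_conj[OF _ dfn_rel_coord b w(2)[unfolded rel_big_def]]])
    show "dfn (\<lambda>s. (\<forall>k\<in>elts (rar r). ap (ap w k) (s 0) = ap (ap u k) (s 0)) \<and>
        lam (ap (rel_ar S) r) (\<lambda>k. ap (ap w k) (s 0)) \<in> elts (ap (rels (ap A (s 0))) r))"
      "dfn (\<lambda>s. \<forall>k\<in>elts (rar r). ap (ap w k) (s 0) = ap (ap u k) (s 0))" by (intro D3)+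
    fix i assume i: "(\<forall>k\<in>elts (rar r). ap (ap w k) i = ap (ap u k) i) \<and>
        lam (ap (rel_ar S) r) (\<lambda>k. ap (ap w k) i) \<in> elts (ap (rels (ap A i)) r)"
    then have "lam (ap (rel_ar S) r) (\<lambda>k. ap (ap w k) i) = lam (ap (rel_ar S) r) (\<lambda>k. ap (ap u k) i)"
      by (intro lam_cong) (simp add: rar_ap[OF r])
    then show "lam (ap (rel_ar S) r) (\<lambda>k. ap (ap u k) i) \<in> elts (ap (rels (ap A i)) r)" using i by simp
  qed
qed (use u elts_rels_P[OF r] in blast)

section \<open>Functions of the reduced product\<close>

definition fval :: "'a \<Rightarrow> 'a \<Rightarrow> 'a" where
  "fval f u = lam I (\<lambda>i. ap (ap (funs (ap A i)) f) (lam (ap (fun_ar S) f) (\<lambda>k. ap (ap u k) i)))"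

lemma dft_fval: "dft t \<Longrightarrow> dft u \<Longrightarrow> dft (\<lambda>s. fval (t s) (u s))"
  by (rule dft2) (unfold fval_def, intro D3)

lemma fval_ok: "lam_ok I (\<lambda>i. ap (ap (funs (ap A i)) f) (lam (ap (fun_ar S) f) (\<lambda>k. ap (ap u k) i)))"
  by (intro lam_okI D3)

lemma fval_ap: "i \<in> elts I \<Longrightarrow> ap (fval f u) i = ap (ap (funs (ap A i)) f) (lam (ap (fun_ar S) f) (\<lambda>k. ap (ap u k) i))"
  unfolding fval_def by (rule lam_ap[OF fval_ok])

lemma fval_Pr: "f \<in> elts Fs \<Longrightarrow> maps u (far f) Pr \<Longrightarrow> fval f u \<in> elts Pr"
proof -
  assume f: "f \<in> elts Fs" and u: "maps u (far f) Pr"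
  have "ap (fval f u) i \<in> elts (carrier (ap A i))" if i: "i \<in> elts I" for i
    unfolding fval_ap[OF i] far_ap[OF f, symmetric]
    using structureD(6,8)[OF ap_struct[OF i] f coord_maps[OF u i]] by simp
  then show ?thesis unfolding elts_product using func_lam[OF fval_ok] by (auto simp: fval_def)
qed

lemma fval_cong:
  assumes f: "f \<in> elts Fs" and u: "maps u (far f) Pr" and w: "maps w (far f) Pr"
    and eq: "lam (far f) (\<lambda>k. ecl (u \<cdot> k)) = lam (far f) (\<lambda>k. ecl (w \<cdot> k))"
  shows "ecl (fval f u) = ecl (fval f w)"
  unfolding ecl_eq_iff[OF fval_Pr[OF f u] fval_Pr[OF f w]]
proof (rule big_mono[OF _ _ representatives_big[OF fin_omega[OF far_omega[OF f]] u w eq]])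
  show "dfn (\<lambda>s. \<forall>k\<in>elts (far f). ap (ap u k) (s 0) = ap (ap w k) (s 0))"
    "dfn (\<lambda>s. ap (fval f u) (s 0) = ap (fval f w) (s 0))" by (intro D3)+
  fix i assume i: "i \<in> elts I" "\<forall>k\<in>elts (far f). ap (ap u k) i = ap (ap w k) i"
  then have "lam (ap (fun_ar S) f) (\<lambda>k. ap (ap u k) i) = lam (ap (fun_ar S) f) (\<lambda>k. ap (ap w k) i)"
    by (intro lam_cong) (simp add: far_ap[OF f])
  then show "ap (fval f u) i = ap (fval f w) i" using fval_ap[OF i(1)] by simp
qed

lemma redprod_fun_eq:
  assumes f: "f \<in> elts Fs"
  shows "redprod_fun S I F A f = mkset {p. \<exists>u. maps u (ap (fun_ar S) f) Pr \<and>
    p = opair (lam (ap (fun_ar S) f) (\<lambda>k. ecl (ap u k))) (ecl (fval f u))}"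
proof -
  have 1: "eq_class I F A (lam I (\<lambda>i. funs (A \<cdot> i) \<cdot> f \<cdot> lam (far f) (\<lambda>k. u \<cdot> k \<cdot> i))) = ecl (fval f u)"
    if u: "maps u (far f) Pr" for u
  proof -
    have "lam I (\<lambda>i. funs (A \<cdot> i) \<cdot> f \<cdot> lam (far f) (\<lambda>k. u \<cdot> k \<cdot> i)) = fval f u"
      unfolding fval_def
    proof (rule lam_cong)
      fix i assume i: "i \<in> elts I"
      show "funs (A \<cdot> i) \<cdot> f \<cdot> lam (far f) (\<lambda>k. u \<cdot> k \<cdot> i) =
          ap (ap (funs (ap A i)) f) (lam (ap (fun_ar S) f) (\<lambda>k. ap (ap u k) i))"
        unfolding far_ap[OF f, symmetric] coord_eq[OF u i] A_ap[OF i]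
          structureD(8)[OF ap_struct[OF i] f coord_maps[OF u i]] ..
    qed
    then show ?thesis using eq_class_ecl[OF fval_Pr[OF f u]] by simp
  qed
  have 2: "lam (far f) (\<lambda>k. eq_class I F A (u \<cdot> k)) = lam (far f) (\<lambda>k. ecl (ap u k))" if u: "maps u (far f) Pr" for u
    by (rule lam_cong) (metis eq_class_ecl u maps_app maps_app_ap)
  have "{opair (lam (far f) (\<lambda>k. eq_class I F A (u \<cdot> k)))
      (eq_class I F A (lam I (\<lambda>i. funs (A \<cdot> i) \<cdot> f \<cdot> lam (far f) (\<lambda>k. u \<cdot> k \<cdot> i)))) | u. maps u (far f) Pr} =
    {p. \<exists>u. maps u (far f) Pr \<and> p = opair (lam (far f) (\<lambda>k. ecl (ap u k))) (ecl (fval f u))}"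
    by (intro Collect_cong ex_cong1) (auto simp: 1 2)
  then show ?thesis unfolding redprod_fun_def far_ap[OF f] by simp
qed

lemma funs_P: "f \<in> elts Fs \<Longrightarrow> funs RP \<cdot> f = redprod_fun S I F A f"
  and func_funs_P: "func_on (funs RP) Fs"
proof -
  have ok: "lam_ok Fs (redprod_fun S I F A)"
    by (rule lam_okI'[OF _ redprod_fun_eq], intro D3 dft_ecl dft_fval)
  show "f \<in> elts Fs \<Longrightarrow> funs RP \<cdot> f = redprod_fun S I F A f" "func_on (funs RP) Fs"
    unfolding reduced_product_def mkstruct_sel using lam_app[OF ok] func_lam[OF ok] by auto
qed

lemma elts_funs_P:
  assumes f: "f \<in> elts Fs"
  shows "elts (funs RP \<cdot> f) = {p. \<exists>u. maps u (far f) Pr \<and> p = opair (lam (far f) (\<lambda>k. ecl (u \<cdot> k))) (ecl (fval f u))}"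
proof -
  have "elts (funs RP \<cdot> f) = {p. \<exists>u. maps u (ap (fun_ar S) f) Pr \<and>
    p = opair (lam (ap (fun_ar S) f) (\<lambda>k. ecl (ap u k))) (ecl (fval f u))}"
    unfolding funs_P[OF f] redprod_fun_eq[OF f]
  proof (rule elts_mkset, rule isset_Collect[where a = "cart (funspace (far f) (carrier RP)) (carrier RP)"])
    show "dfn (\<lambda>s. \<exists>u. maps u (ap (fun_ar S) f) Pr \<and>
        s 0 = opair (lam (ap (fun_ar S) f) (\<lambda>k. ecl (ap u k))) (ecl (fval f u)))"
      by (intro D3 dft_ecl dft_fval)
  qed (use lam_ecl_maps lam_ecl_ap ecl_in_P[OF fval_Pr[OF f]] in \<open>auto simp: far_ap[OF f]\<close>)
  then show ?thesis unfolding far_ap[OF f, symmetric] using lam_ecl_ap by auto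
qed

lemma funs_P_maps:
  assumes f: "f \<in> elts Fs"
  shows "maps (funs RP \<cdot> f) (funspace (far f) (carrier RP)) (carrier RP)"
    and fun_P_app: "maps u (far f) Pr \<Longrightarrow> funs RP \<cdot> f \<cdot> lam (far f) (\<lambda>k. ecl (u \<cdot> k)) = ecl (fval f u)"
proof -
  have fn: "func_on (funs RP \<cdot> f) (funspace (far f) (carrier RP))"
    unfolding func_on_def
  proof (intro conjI ballI)
    fix p assume "p \<in> elts (funs RP \<cdot> f)"
    then show "\<exists>x\<in>elts (funspace (far f) (carrier RP)). \<exists>y. p = opair x y"
      unfolding elts_funs_P[OF f] using lam_ecl_maps by auto
  next
    fix x assume "x \<in> elts (funspace (far f) (carrier RP))"
    then obtain u where u: "maps u (far f) Pr" "x = lam (far f) (\<lambda>k. ecl (u \<cdot> k))"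
      using representatives[OF fin_omega[OF far_omega[OF f]]] by auto
    show "\<exists>!y. opair x y \<in> elts (funs RP \<cdot> f)"
    proof (rule ex1I[of _ "ecl (fval f u)"])
      show "opair x (ecl (fval f u)) \<in> elts (funs RP \<cdot> f)" unfolding elts_funs_P[OF f] u(2) using u(1) by blast
      fix y assume "opair x y \<in> elts (funs RP \<cdot> f)"
      then obtain w where "maps w (far f) Pr" "x = lam (far f) (\<lambda>k. ecl (w \<cdot> k))" "y = ecl (fval f w)"
        unfolding elts_funs_P[OF f] by auto
      then show "y = ecl (fval f u)" using fval_cong[OF f _ u(1)] u(2) by simp
    qed
  qed
  show app: "funs RP \<cdot> f \<cdot> lam (far f) (\<lambda>k. ecl (u \<cdot> k)) = ecl (fval f u)" if u: "maps u (far f) Pr" for u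
  proof -
    have "opair (lam (far f) (\<lambda>k. ecl (u \<cdot> k))) (ecl (fval f u)) \<in> elts (funs RP \<cdot> f)"
      unfolding elts_funs_P[OF f] using u by blast
    then show ?thesis using func_app_eq[OF fn] lam_ecl_maps[OF u] by simp
  qed
  show "maps (funs RP \<cdot> f) (funspace (far f) (carrier RP)) (carrier RP)"
  proof (rule mapsI[OF fn])
    fix x assume "x \<in> elts (funspace (far f) (carrier RP))"
    then obtain u where "maps u (far f) Pr" "x = lam (far f) (\<lambda>k. ecl (u \<cdot> k))"
      using representatives[OF fin_omega[OF far_omega[OF f]]] by auto
    then show "funs RP \<cdot> f \<cdot> x \<in> elts (carrier RP)" using app ecl_in_P[OF fval_Pr[OF f]] by simp
  qed
qed

lemma P_structure: "is_structure S RP"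
  unfolding is_structure_def
proof (intro conjI ballI func_rels_P func_funs_P funs_P_maps)
  show "RP = mkstruct (carrier RP) (rels RP) (funs RP)" unfolding reduced_product_def mkstruct_sel ..
  show "elts (carrier RP) \<noteq> {}" unfolding carrier_P using nonempty by simp
  show "elts (rels RP \<cdot> r) \<subseteq> elts (funspace (rar r) (carrier RP))" if "r \<in> elts Rs" for r
    unfolding elts_rels_P[OF that] using lam_ecl_maps by auto
qed

section \<open>Terms and atomic formulas in the reduced product\<close>

context
  fixes e
  assumes e: "maps e omega Pr"
begin

definition ecoord :: "'a \<Rightarrow> 'a" where "ecoord i = lam omega (\<lambda>n. ap (ap e n) i)"

text \<open>Only assignments that arise from an assignment \<open>e\<close> of representatives are
  considered. Lifting an arbitrary assignment to the product would mean choosing representatives for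
  infinitely many variables.\<close>

definition ebar :: 'a where "ebar = lam omega (\<lambda>n. ecl (e \<cdot> n))"

lemma dft_ecoord: "dft t \<Longrightarrow> dft (\<lambda>s. ecoord (t s))"
  by (rule dft1) (unfold ecoord_def, intro D3)

lemma ecoord_maps: "i \<in> elts I \<Longrightarrow> maps (ecoord i) omega (carrier (ap A i))"
  unfolding ecoord_def by (rule coord_maps[OF e])

lemma ebar_maps: "maps ebar omega (carrier RP)"
  unfolding ebar_def by (rule lam_ecl_maps[OF e])

definition vt :: "'a \<Rightarrow> 'a" where "vt t = lam I (\<lambda>i. ap (ev (ap A i) (ecoord i)) t)"

lemma dft_vt: "dft t \<Longrightarrow> dft (\<lambda>s. vt (t s))"
  by (rule dft1) (unfold vt_def, intro D3 dft_ecoord dft_ev)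

lemma vt_ok: "lam_ok I (\<lambda>i. ap (ev (ap A i) (ecoord i)) t)"
  by (intro lam_okI D3 dft_ecoord dft_ev)

lemma vt_ap: "i \<in> elts I \<Longrightarrow> ap (vt t) i = ap (ev (ap A i) (ecoord i)) t"
  unfolding vt_def by (rule lam_ap[OF vt_ok])

lemma ev_coord_maps: "i \<in> elts I \<Longrightarrow> maps (ev (ap A i) (ecoord i)) T (carrier (ap A i))"
  by (rule ev_maps[OF ap_struct ecoord_maps])

lemma vt_Pr: "t \<in> elts T \<Longrightarrow> vt t \<in> elts Pr"
  unfolding elts_product using vt_ap ev_coord_maps func_lam[OF vt_ok]
  by (auto simp: vt_def[symmetric] maps_ap)

text \<open>The class of \<open>vt t\<close> is the value because both sides respect variables and
  function symbols: \<open>vt\<close> is computed coordinatewise, and so are the functions of the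
  reduced product.\<close>

lemma ev_P:
  assumes "t \<in> elts T"
  shows "ev RP ebar \<cdot> t = ecl (vt t)"
proof -
  note v = ev_maps[OF P_structure ebar_maps]
  have "\<forall>t\<in>elts T. t \<in> elts T \<and> ap (ev RP ebar) t = ecl (vt t)"
  proof (rule term_induct)
    show "dfn (\<lambda>s. s 0 \<in> elts T \<and> ap (ev RP ebar) (s 0) = ecl (vt (s 0)))" by (intro D3 dft_ecl dft_vt)
    fix n assume n: "n \<in> elts omega"
    have "vt (Var n) = e \<cdot> n"
    proof (rule func_ext[of _ I])
      show "func_on (vt (Var n)) I" "func_on (e \<cdot> n) I" using Pr_func vt_Pr n maps_app[OF e n] by auto
      fix i assume i: "i \<in> elts I"
      have "ap (vt (Var n)) i = ecoord i \<cdot> n"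
        unfolding vt_ap[OF i] using ev_Var[OF ap_struct[OF i] ecoord_maps[OF i] n]
          maps_app_ap[OF ev_coord_maps[OF i], of "Var n"] n by simp
      also have "\<dots> = ap (e \<cdot> n) i"
        unfolding ecoord_def using lam_app[OF lam_ok_coord n] maps_app_ap[OF e n] by simp
      finally show "vt (Var n) \<cdot> i = e \<cdot> n \<cdot> i"
        using app_ap[OF Pr_func[OF vt_Pr[OF Var_in_terms[OF n]]] i] app_ap[OF Pr_func[OF maps_app[OF e n]] i] by simp
    qed
    moreover have "ebar \<cdot> n = ecl (e \<cdot> n)" unfolding ebar_def using lam_app[OF lam_ok_ecl[OF e] n] .
    ultimately show "Var n \<in> elts T \<and> ap (ev RP ebar) (Var n) = ecl (vt (Var n))"
      using n ev_Var[OF P_structure ebar_maps n] maps_app_ap[OF v, of "Var n"] by simp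
  next
    fix f ts assume f: "f \<in> elts Fs" and ts: "maps ts (far f) T"
      and IH: "\<And>k. k \<in> elts (far f) \<Longrightarrow> ts \<cdot> k \<in> elts T \<and> ap (ev RP ebar) (ts \<cdot> k) = ecl (vt (ts \<cdot> k))"
    define u where "u = lam (far f) (\<lambda>k. vt (ts \<cdot> k))"
    have ok: "lam_ok (far f) (\<lambda>k. vt (ts \<cdot> k))"
      by (rule lam_okI'[where h = "\<lambda>k. vt (ap ts k)"], intro dft_vt D3) (simp add: maps_app_ap[OF ts])
    have u: "maps u (far f) Pr" unfolding u_def using maps_app[OF ts] vt_Pr by (intro maps_lam[OF ok]) blast
    have uk: "u \<cdot> k = vt (ts \<cdot> k)" if "k \<in> elts (far f)" for k unfolding u_def by (rule lam_app[OF ok that])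
    have "lam (far f) (\<lambda>k. ev RP ebar \<cdot> (ts \<cdot> k)) = lam (far f) (\<lambda>k. ecl (u \<cdot> k))"
    proof (rule lam_cong)
      fix k assume k: "k \<in> elts (far f)"
      show "ev RP ebar \<cdot> (ts \<cdot> k) = ecl (u \<cdot> k)"
        using IH[OF k] maps_app_ap[OF v maps_app[OF ts k]] uk[OF k] by simp
    qed
    then have "ev RP ebar \<cdot> Fn f ts = ecl (fval f u)"
      using ev_Fn[OF P_structure ebar_maps f ts] fun_P_app[OF f u] by simp
    moreover have "fval f u = vt (Fn f ts)"
    proof (rule func_ext[of _ I])
      show fn: "func_on (fval f u) I" "func_on (vt (Fn f ts)) I"
        using Pr_func fval_Pr[OF f u] vt_Pr[OF Fn_in_terms[OF f ts]] by auto
      fix i assume i: "i \<in> elts I"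
      have "lam (far f) (\<lambda>k. ap (ap u k) i) = lam (far f) (\<lambda>k. ev (ap A i) (ecoord i) \<cdot> (ts \<cdot> k))"
      proof (rule lam_cong)
        fix k assume k: "k \<in> elts (far f)"
        show "ap (ap u k) i = ev (ap A i) (ecoord i) \<cdot> (ts \<cdot> k)"
          using uk[OF k] maps_app_ap[OF u k] vt_ap[OF i] maps_app_ap[OF ev_coord_maps[OF i] maps_app[OF ts k]] by simp
      qed
      then have "ap (fval f u) i = ap (vt (Fn f ts)) i"
        unfolding fval_ap[OF i] vt_ap[OF i]
        using ev_Fn[OF ap_struct[OF i] ecoord_maps[OF i] f ts]
          maps_app_ap[OF ev_coord_maps[OF i] Fn_in_terms[OF f ts]]
          structureD(8)[OF ap_struct[OF i] f maps_comp[OF ts ev_coord_maps[OF i]]]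
        by (simp add: far_ap[OF f, symmetric])
      then show "fval f u \<cdot> i = vt (Fn f ts) \<cdot> i" using app_ap[OF fn(1) i] app_ap[OF fn(2) i] by simp
    qed
    ultimately show "Fn f ts \<in> elts T \<and> ap (ev RP ebar) (Fn f ts) = ecl (vt (Fn f ts))"
      using Fn_in_terms[OF f ts] maps_app_ap[OF v, of "Fn f ts"] by simp
  qed
  then show ?thesis using assms maps_app_ap[OF v] by simp
qed

text \<open>The atomic case of the theorem of Los, which is valid for every filter.\<close>

lemma at_sat_P:
  assumes "is_atomic S \<phi>"
  shows "at_sat RP ebar \<phi> \<longleftrightarrow> big (\<lambda>i. at_sat (ap A i) (ecoord i) \<phi>)"
  using assms
proof (cases rule: atomic_cases)
  case (1 t u)
  have "at_sat (ap A i) (ecoord i) \<phi> \<longleftrightarrow> ap (vt t) i = ap (vt u) i" if i: "i \<in> elts I" for i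
    using at_sat_Eq[OF ap_struct[OF i] ecoord_maps[OF i] 1(1,2)] vt_ap[OF i] maps_app_ap[OF ev_coord_maps[OF i]] 1
    by simp
  then have "big (\<lambda>i. at_sat (ap A i) (ecoord i) \<phi>) \<longleftrightarrow> big (\<lambda>i. ap (vt t) i = ap (vt u) i)"
    by (rule big_cong)
  then show ?thesis
    using ecl_eq_iff[OF vt_Pr[OF 1(1)] vt_Pr[OF 1(2)]] at_sat_Eq[OF P_structure ebar_maps 1(1,2)] ev_P 1 by simp
next
  case (2 r ts)
  define u where "u = lam (rar r) (\<lambda>k. vt (ts \<cdot> k))"
  have ok: "lam_ok (rar r) (\<lambda>k. vt (ts \<cdot> k))"
    by (rule lam_okI'[where h = "\<lambda>k. vt (ap ts k)"], intro dft_vt D3) (simp add: maps_app_ap[OF 2(2)])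
  have u: "maps u (rar r) Pr" unfolding u_def using maps_app[OF 2(2)] vt_Pr by (intro maps_lam[OF ok]) blast
  have uk: "u \<cdot> k = vt (ts \<cdot> k)" if "k \<in> elts (rar r)" for k unfolding u_def by (rule lam_app[OF ok that])
  have "lam (rar r) (\<lambda>k. ev RP ebar \<cdot> (ts \<cdot> k)) = lam (rar r) (\<lambda>k. ecl (u \<cdot> k))"
    by (rule lam_cong) (simp add: ev_P maps_app[OF 2(2)] uk)
  then have "at_sat RP ebar \<phi> \<longleftrightarrow> rel_big r u"
    using at_sat_Rel[OF P_structure ebar_maps 2(1,2)] rel_P_iff[OF 2(1) u] 2(3) by simp
  also have "\<dots> \<longleftrightarrow> big (\<lambda>i. at_sat (ap A i) (ecoord i) \<phi>)"
    unfolding rel_big_def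
  proof (rule big_cong)
    fix i assume i: "i \<in> elts I"
    have "lam (rar r) (\<lambda>k. ap (ap u k) i) = lam (rar r) (\<lambda>k. ev (ap A i) (ecoord i) \<cdot> (ts \<cdot> k))"
    proof (rule lam_cong)
      fix k assume k: "k \<in> elts (rar r)"
      show "ap (ap u k) i = ev (ap A i) (ecoord i) \<cdot> (ts \<cdot> k)"
        using uk[OF k] maps_app_ap[OF u k] vt_ap[OF i] maps_app_ap[OF ev_coord_maps[OF i] maps_app[OF 2(2) k]] by simp
    qed
    then show "lam (ap (rel_ar S) r) (\<lambda>k. ap (ap u k) i) \<in> elts (ap (rels (ap A i)) r) \<longleftrightarrow> at_sat (ap A i) (ecoord i) \<phi>"
      unfolding 2(3) at_sat_Rel[OF ap_struct[OF i] ecoord_maps[OF i] 2(1,2)] structureD(7)[OF ap_struct[OF i] 2(1)]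
        rar_ap[OF 2(1), symmetric] by simp
  qed
  finally show ?thesis .
qed

end

end

subsection \<open>Preservation\<close>

text \<open>A semantic form of dependence on the variables in \<open>V\<close>. It spares a
  syntactic notion of the variables occurring in a term together with its coincidence lemma.\<close>

definition determined :: "'a \<Rightarrow> 'a \<Rightarrow> ('a \<Rightarrow> 'a) \<Rightarrow> bool" where
  "determined B V F \<longleftrightarrow> (\<forall>e d. maps e omega (carrier B) \<and> maps d omega (carrier B) \<and>
    (\<forall>n\<in>elts V. ap e n = ap d n) \<longrightarrow> F e = F d)"

lemma term_determined:
  assumes B: "is_structure S B" and t: "t \<in> elts T"
  shows "\<exists>V. fin V \<and> elts V \<subseteq> elts omega \<and> determined B V (\<lambda>e. ap (ev B e) t)"
proof -
  have dd: "dfn (\<lambda>s. determined B (s i) (\<lambda>e. ap (ev B e) (s j)))" for i j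
    unfolding determined_def by (intro D3 dft_ev)
  have "\<forall>t\<in>elts T. t \<in> elts T \<and> (\<exists>V. fin V \<and> elts V \<subseteq> elts omega \<and> determined B V (\<lambda>e. ap (ev B e) t))"
  proof (rule term_induct)
    show "dfn (\<lambda>s. s 0 \<in> elts T \<and> (\<exists>V. fin V \<and> elts V \<subseteq> elts omega \<and> determined B V (\<lambda>e. ap (ev B e) (s 0))))"
      by (intro D3 dd)
    fix n assume n: "n \<in> elts omega"
    have "ap (ev B e) (Var n) = ap e n" if e: "maps e omega (carrier B)" for e
      using ev_Var[OF B e n] maps_app_ap[OF ev_maps[OF B e], of "Var n"] maps_app_ap[OF e n] n by simp
    then have "determined B (ins n emp) (\<lambda>e. ap (ev B e) (Var n))" unfolding determined_def by simp
    then show "Var n \<in> elts T \<and> (\<exists>V. fin V \<and> elts V \<subseteq> elts omega \<and> determined B V (\<lambda>e. ap (ev B e) (Var n)))"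
      using n by (auto intro!: exI[of _ "ins n emp"] fin_ins fin_emp)
  next
    fix f ts assume f: "f \<in> elts Fs" and ts: "maps ts (far f) T"
      and IH: "\<And>k. k \<in> elts (far f) \<Longrightarrow> ts \<cdot> k \<in> elts T \<and>
        (\<exists>V. fin V \<and> elts V \<subseteq> elts omega \<and> determined B V (\<lambda>e. ap (ev B e) (ts \<cdot> k)))"
    have "\<exists>V. fin V \<and> elts V \<subseteq> elts omega \<and> (\<forall>k\<in>elts (far f). determined B V (\<lambda>e. ap (ev B e) (ap ts k)))"
    proof (rule fin_bound[OF fin_omega[OF far_omega[OF f]]])
      show "dfn (\<lambda>s. determined B (s 1) (\<lambda>e. ap (ev B e) (ap ts (s 0))))"
        unfolding determined_def by (intro D3 dft_ev)
      show "dfn (\<lambda>s. s 0 \<in> elts omega)" by (intro D3)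
      show "\<exists>V. fin V \<and> elts V \<subseteq> elts omega \<and> determined B V (\<lambda>e. ap (ev B e) (ap ts k))" if "k \<in> elts (far f)" for k
        using IH[OF that] maps_app_ap[OF ts that] by simp
      show "determined B W' (\<lambda>e. ap (ev B e) (ap ts k))"
        if "determined B W (\<lambda>e. ap (ev B e) (ap ts k))" "elts W \<subseteq> elts W'" for k W W'
        using that unfolding determined_def by blast
    qed
    then obtain V where V: "fin V" "elts V \<subseteq> elts omega"
      "\<And>k. k \<in> elts (far f) \<Longrightarrow> determined B V (\<lambda>e. ap (ev B e) (ap ts k))" by blast
    have "determined B V (\<lambda>e. ap (ev B e) (Fn f ts))"
      unfolding determined_def
    proof (intro allI impI)
      fix e d assume h: "maps e omega (carrier B) \<and> maps d omega (carrier B) \<and> (\<forall>n\<in>elts V. ap e n = ap d n)"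
      then have e: "maps e omega (carrier B)" and d: "maps d omega (carrier B)" by auto
      have "lam (far f) (\<lambda>k. ev B e \<cdot> (ts \<cdot> k)) = lam (far f) (\<lambda>k. ev B d \<cdot> (ts \<cdot> k))"
      proof (rule lam_cong)
        fix k assume k: "k \<in> elts (far f)"
        have "ap (ev B e) (ap ts k) = ap (ev B d) (ap ts k)" using V(3)[OF k] h unfolding determined_def by blast
        then show "ev B e \<cdot> (ts \<cdot> k) = ev B d \<cdot> (ts \<cdot> k)"
          using maps_app_ap[OF ev_maps[OF B e] maps_app[OF ts k]] maps_app_ap[OF ev_maps[OF B d] maps_app[OF ts k]]
            maps_app_ap[OF ts k] by simp
      qed
      then show "ap (ev B e) (Fn f ts) = ap (ev B d) (Fn f ts)"
        using ev_Fn[OF B e f ts] ev_Fn[OF B d f ts] maps_app_ap[OF ev_maps[OF B e] Fn_in_terms[OF f ts]]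
          maps_app_ap[OF ev_maps[OF B d] Fn_in_terms[OF f ts]] by simp
    qed
    then show "Fn f ts \<in> elts T \<and> (\<exists>V. fin V \<and> elts V \<subseteq> elts omega \<and> determined B V (\<lambda>e. ap (ev B e) (Fn f ts)))"
      using V Fn_in_terms[OF f ts] by blast
  qed
  then show ?thesis using t by blast
qed

definition determined_lit :: "'a \<Rightarrow> 'a \<Rightarrow> 'a \<Rightarrow> bool" where
  "determined_lit B V l \<longleftrightarrow> (\<forall>e d. maps e omega (carrier B) \<and> maps d omega (carrier B) \<and>
    (\<forall>n\<in>elts V. ap e n = ap d n) \<longrightarrow> (lit_sat B e l \<longleftrightarrow> lit_sat B d l))"

lemma atomic_determined:
  assumes B: "is_structure S B" and \<phi>: "is_atomic S \<phi>"
  shows "\<exists>V. fin V \<and> elts V \<subseteq> elts omega \<and> determined_lit B V \<phi>"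
  using \<phi>
proof (cases rule: atomic_cases)
  case (1 t u)
  obtain V W where V: "fin V" "elts V \<subseteq> elts omega" "determined B V (\<lambda>e. ap (ev B e) t)"
    and W: "fin W" "elts W \<subseteq> elts omega" "determined B W (\<lambda>e. ap (ev B e) u)"
    using term_determined[OF B 1(1)] term_determined[OF B 1(2)] by blast
  have "determined_lit B (un V W) \<phi>"
    unfolding determined_lit_def
  proof (intro allI impI)
    fix e d assume h: "maps e omega (carrier B) \<and> maps d omega (carrier B) \<and> (\<forall>n\<in>elts (un V W). ap e n = ap d n)"
    have "ap (ev B e) t = ap (ev B d) t" "ap (ev B e) u = ap (ev B d) u"
      using h V(3) W(3) unfolding determined_def by auto
    then show "lit_sat B e \<phi> \<longleftrightarrow> lit_sat B d \<phi>" using \<phi> 1 by (simp add: at_sat_Eq_ap)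
  qed
  then show ?thesis using V W fin_un by (intro exI[of _ "un V W"]) auto
next
  case (2 r ts)
  have "\<exists>V. fin V \<and> elts V \<subseteq> elts omega \<and> (\<forall>k\<in>elts (rar r). determined B V (\<lambda>e. ap (ev B e) (ap ts k)))"
  proof (rule fin_bound[OF fin_omega[OF rar_omega[OF 2(1)]]])
    show "dfn (\<lambda>s. determined B (s 1) (\<lambda>e. ap (ev B e) (ap ts (s 0))))"
      unfolding determined_def by (intro D3 dft_ev)
    show "dfn (\<lambda>s. s 0 \<in> elts omega)" by (intro D3)
    show "\<exists>V. fin V \<and> elts V \<subseteq> elts omega \<and> determined B V (\<lambda>e. ap (ev B e) (ap ts k))" if "k \<in> elts (rar r)" for k
      using term_determined[OF B maps_app[OF 2(2) that]] maps_app_ap[OF 2(2) that] by simp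
    show "determined B W' (\<lambda>e. ap (ev B e) (ap ts k))"
      if "determined B W (\<lambda>e. ap (ev B e) (ap ts k))" "elts W \<subseteq> elts W'" for k W W'
      using that unfolding determined_def by blast
  qed
  then obtain V where V: "fin V" "elts V \<subseteq> elts omega"
    "\<And>k. k \<in> elts (rar r) \<Longrightarrow> determined B V (\<lambda>e. ap (ev B e) (ap ts k))" by blast
  have "determined_lit B V \<phi>"
    unfolding determined_lit_def
  proof (intro allI impI)
    fix e d assume h: "maps e omega (carrier B) \<and> maps d omega (carrier B) \<and> (\<forall>n\<in>elts V. ap e n = ap d n)"
    have "lam (rar r) (\<lambda>k. ap (ev B e) (ap ts k)) = lam (rar r) (\<lambda>k. ap (ev B d) (ap ts k))"
      by (rule lam_cong) (use V(3) h in \<open>unfold determined_def, blast\<close>)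
    then show "lit_sat B e \<phi> \<longleftrightarrow> lit_sat B d \<phi>"
      using \<phi> 2 at_sat_Rel_ap[OF 2(1,2)] by (simp add: rar_ap[OF 2(1), symmetric])
  qed
  then show ?thesis using V by blast
qed

lemma literal_determined:
  assumes B: "is_structure S B" and l: "literal l"
  shows "\<exists>V. fin V \<and> elts V \<subseteq> elts omega \<and> determined_lit B V l"
proof -
  obtain \<psi> where \<psi>: "is_atomic S \<psi>" "l = \<psi> \<or> l = Neg \<psi>" using l unfolding literal_def by blast
  have "determined_lit B V l" if "determined_lit B V \<psi>" for V
  proof (cases "l = \<psi>")
    case False
    then have "lit_sat B e l \<longleftrightarrow> \<not> lit_sat B e \<psi>" for e using \<psi> by auto
    then show ?thesis using that unfolding determined_lit_def by simp
  qed (use that in simp)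
  then show ?thesis using atomic_determined[OF B \<psi>(1)] by blast
qed

text \<open>Suppose that all literals fail under some assignment. The atoms of the negative literals
  then hold at almost all indices, where the formula can only be true through its positive literal.
  As there is at most one such literal, it holds at almost all indices and hence in the reduced
  product, a contradiction.\<close>

lemma reduced_product_models:
  assumes F: "proper_filter I F" and A: "func_on A I"
    and A_struct: "\<forall>i\<in>elts I. is_structure S (A \<cdot> i)"
    and nonempty: "elts (product I A) \<noteq> {}"
    and \<phi>: "is_basic_Horn S \<phi>" and m: "\<And>i. i \<in> elts I \<Longrightarrow> models S (A \<cdot> i) \<phi>"
  shows "models S (reduced_product S I F A) \<phi>"
proof -
  note ctxt = F A A_struct nonempty
  let ?P = "reduced_product S I F A"
  note PS = P_structure[OF ctxt]
  obtain n l g where H: "horn_seq n l g \<phi>" using \<phi> is_basic_Horn_iff by blast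
  have n: "succ n \<in> elts omega" using horn_seqD(1)[OF H] by (rule succ_in_omega)
  show ?thesis
    unfolding models_horn[OF PS H]
  proof (intro allI impI, rule ccontr)
    fix d assume d: "maps d omega (carrier ?P)" and no: "\<not> (\<exists>i\<in>elts (succ n). lit_sat ?P d (ap l i))"
    have "\<exists>V. fin V \<and> elts V \<subseteq> elts omega \<and> (\<forall>i\<in>elts (succ n). determined_lit ?P V (ap l i))"
    proof (rule fin_bound[OF fin_omega[OF n]])
      show "dfn (\<lambda>s. determined_lit ?P (s 1) (ap l (s 0)))"
        unfolding determined_lit_def by (intro D3 dfn_lit_sat)
      show "dfn (\<lambda>s. s 0 \<in> elts omega)" by (intro D3)
      show "\<exists>V. fin V \<and> elts V \<subseteq> elts omega \<and> determined_lit ?P V (ap l k)" if "k \<in> elts (succ n)" for k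
        by (rule literal_determined[OF PS horn_seqD(5)[OF H that]])
      show "determined_lit ?P W' (ap l k)"
        if "determined_lit ?P W (ap l k)" "elts W \<subseteq> elts W'" for k W W'
        using that unfolding determined_lit_def by blast
    qed
    then obtain V where V: "fin V" "elts V \<subseteq> elts omega"
      "\<And>i. i \<in> elts (succ n) \<Longrightarrow> determined_lit ?P V (ap l i)" by blast
    have "maps (lam V (\<lambda>k. ap d k)) V (carrier ?P)"
      using V(2) maps_app[OF d] maps_app_ap[OF d] by (intro maps_lam lam_okI D3) auto
    then obtain u where u: "maps u V (product I A)" "lam V (\<lambda>k. ap d k) = lam V (\<lambda>k. ecl I F A (u \<cdot> k))"
      using representatives[OF ctxt V(1)] by blast
    \<comment> \<open>Outside \<open>V\<close> the fixed element \<open>p\<close> serves as default,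
      so that representatives are chosen for the variables in \<open>V\<close> only. The assignment
      obtained from \<open>e\<close> differs from \<open>d\<close> in general but makes the same
      literals true.\<close>
    obtain p where p: "p \<in> elts (product I A)" using nonempty by blast
    define e where "e = lam omega (\<lambda>k. if k \<in> elts V then ap u k else p)"
    have ok: "lam_ok omega (\<lambda>k. if k \<in> elts V then ap u k else p)" by (intro lam_okI D3)
    have e: "maps e omega (product I A)"
      unfolding e_def using p maps_app[OF u(1)] maps_app_ap[OF u(1)] by (intro maps_lam[OF ok]) auto
    note em = ebar_maps[OF ctxt e]
    have agree: "ap (ebar I F A e) k = ap d k" if k: "k \<in> elts V" for k
    proof -
      have ko: "k \<in> elts omega" using k V(2) by blast
      have "ap (ebar I F A e) k = ecl I F A (e \<cdot> k)"
        unfolding ebar_def[OF ctxt e] by (rule lam_ap[OF lam_ok_ecl[OF ctxt e] ko])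
      also have "e \<cdot> k = u \<cdot> k" unfolding e_def using lam_app[OF ok ko] k maps_app_ap[OF u(1) k] by simp
      also have "ecl I F A (u \<cdot> k) = ap d k"
        using lam_app[OF lam_ok_ecl[OF ctxt u(1)] k] lam_app[of V "\<lambda>k. ap d k" k, OF _ k] u(2)
        by (simp add: lam_okI D3)
      finally show ?thesis .
    qed
    have no': "\<not> lit_sat ?P (ebar I F A e) (ap l i)" if i: "i \<in> elts (succ n)" for i
      using V(3)[OF i] no i em d agree unfolding determined_lit_def by blast
    let ?sat = "\<lambda>j i. lit_sat (ap A j) (ecoord e j) (ap l i)"
    have dd: "dfn (\<lambda>s. \<not> is_atomic S (ap l (s i)) \<longrightarrow> \<not> ?sat (s j) (s i))" for i j
      by (intro D3 dfn_is_atomic dfn_lit_sat dft_ecoord[OF ctxt e])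
    let ?neg = "\<lambda>j. \<forall>i\<in>elts (succ n). \<not> is_atomic S (ap l i) \<longrightarrow> \<not> ?sat j i"
    let ?pos = "\<lambda>j. \<exists>i\<in>elts (succ n). is_atomic S (ap l i) \<and> ?sat j i"
    have dneg: "dfn (\<lambda>s. ?neg (s 0))" and dpos: "dfn (\<lambda>s. ?pos (s 0))"
      by (intro D3 dfn_is_atomic dfn_lit_sat dft_ecoord[OF ctxt e])+
    \<comment> \<open>A failing negative literal means that its atom holds in the product, hence on
      a large set; finitely many such sets are intersected.\<close>
    have neg: "big I F (\<lambda>j. \<forall>i\<in>elts (succ n). \<not> is_atomic S (ap l i) \<longrightarrow> \<not> ?sat j i)"
    proof (rule big_fin[OF ctxt fin_omega[OF n], where Q = "\<lambda>i j. \<not> is_atomic S (ap l i) \<longrightarrow> \<not> ?sat j i"])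
      show "dfn (\<lambda>s. \<not> is_atomic S (ap l (s 0)) \<longrightarrow> \<not> ?sat (s 1) (s 0))" by (rule dd)
      fix i assume i: "i \<in> elts (succ n)"
      show "big I F (\<lambda>j. \<not> is_atomic S (ap l i) \<longrightarrow> \<not> ?sat j i)"
      proof (cases "is_atomic S (ap l i)")
        case True
        then show ?thesis by (intro big_all[OF ctxt]) simp
      next
        case False
        then obtain \<psi> where \<psi>: "is_atomic S \<psi>" "ap l i = Neg \<psi>"
          using horn_seqD(5)[OF H i] unfolding literal_def by blast
        then have "at_sat ?P (ebar I F A e) \<psi>" using no'[OF i] by simp
        then have "big I F (\<lambda>j. at_sat (ap A j) (ecoord e j) \<psi>)" using at_sat_P[OF ctxt e \<psi>(1)] by simp
        moreover have "(\<not> is_atomic S (ap l i) \<longrightarrow> \<not> ?sat j i) \<longleftrightarrow> at_sat (ap A j) (ecoord e j) \<psi>" for j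
          using \<psi> by simp
        ultimately show ?thesis by simp
      qed
    qed
    have pos: "?pos j" if j: "j \<in> elts I" "?neg j" for j
    proof -
      have "models S (ap A j) \<phi>" using m[OF j(1)] A_ap[OF ctxt j(1)] by simp
      then show ?thesis
        using models_horn[OF ap_struct[OF ctxt j(1)] H] ecoord_maps[OF ctxt e j(1)] j(2) by blast
    qed
    have b: "big I F ?pos"
      by (rule big_mono[OF ctxt, where Q = ?neg and Q' = ?pos, OF dneg dpos neg pos])
    \<comment> \<open>Large sets are nonempty since the filter is proper, so a positive literal does
      exist.\<close>
    then obtain i where i: "i \<in> elts (succ n)" "is_atomic S (ap l i)" using big_ex[OF ctxt] by blast
    have "big I F (\<lambda>j. at_sat (ap A j) (ecoord e j) (ap l i))"
    proof (rule big_mono[OF ctxt, where Q = ?pos, OF dpos _ b])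
      show "at_sat (ap A j) (ecoord e j) (ap l i)"
        if ex: "\<exists>i\<in>elts (succ n). is_atomic S (ap l i) \<and> ?sat j i" for j
      proof -
        obtain i' where i': "i' \<in> elts (succ n)" "is_atomic S (ap l i')" "?sat j i'" using ex by blast
        \<comment> \<open>The positive literal that is true at the index \<open>j\<close> is the
          same at all indices: this is where the Horn property is used.\<close>
        have "i' = i" by (rule horn_seqD(6)[OF H i'(1) i(1) i'(2) i(2)])
        then show ?thesis using i'(2,3) by simp
      qed
    qed (intro D3 dfn_at_sat dft_ecoord[OF ctxt e])
    then show False using no'[OF i(1)] i(2) at_sat_P[OF ctxt e i(2)] by simp
  qed
qed

lemma horn_class_closed:
  assumes \<Gamma>: "\<forall>\<phi>\<in>elts \<Gamma>. is_basic_Horn S \<phi>" and K: "axiomatized_by S K \<Gamma>"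
  shows "closed_isomorphisms S K \<and> closed_substructures S K \<and> closed_reduced_products S K"
proof -
  have K: "A \<in> K \<longleftrightarrow> is_structure S A \<and> (\<forall>\<phi>\<in>elts \<Gamma>. models S A \<phi>)" for A
    using K unfolding axiomatized_by_def by blast
  have "closed_isomorphisms S K"
    unfolding closed_isomorphisms_def K using iso_emb emb_models \<Gamma> by blast
  moreover have "closed_substructures S K"
    unfolding closed_substructures_def K is_substructure_def[of S]
    using substructure_emb emb_models \<Gamma> is_substructure_def by blast
  moreover have "closed_reduced_products S K"
    unfolding closed_reduced_products_def
  proof (intro allI impI)
    fix I F A assume h: "proper_filter I F \<and> func_on A I \<and> (\<forall>i\<in>elts I. A \<cdot> i \<in> K) \<and> elts (product I A) \<noteq> {}"
    then show "reduced_product S I F A \<in> K"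
      unfolding K using P_structure[of I F A] reduced_product_models[of I F A] \<Gamma> by blast
  qed
  ultimately show ?thesis by blast
qed

subsection \<open>Closed classes are Horn classes\<close>

text \<open>The numbers serve as names of variables for the elements of \<open>Z\<close>. A new
  element receives the index \<open>emp\<close>, after the indices given earlier have been shifted
  by one.\<close>

lemma fin_injection: "fin Z \<Longrightarrow> \<exists>c. maps c Z omega \<and> (\<forall>x\<in>elts Z. \<forall>y\<in>elts Z. ap c x = ap c y \<longrightarrow> x = y)"
proof -
  assume Z: "fin Z"
  let ?Q = "\<lambda>Z. \<exists>c. maps c Z omega \<and> (\<forall>x\<in>elts Z. \<forall>y\<in>elts Z. ap c x = ap c y \<longrightarrow> x = y)"
  show ?thesis
  proof (rule fin_induct[OF Z, where P = ?Q])
    show "dfn (\<lambda>s. ?Q (s 0))" by (intro D3)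
    show "?Q emp" by (rule exI[of _ emp]) (auto simp: maps_def func_on_def)
    fix Y x assume "?Q Y"
    then obtain c where c: "maps c Y omega" "\<forall>x\<in>elts Y. \<forall>y\<in>elts Y. ap c x = ap c y \<longrightarrow> x = y" by blast
    let ?g = "\<lambda>y. if y \<in> elts Y then succ (ap c y) else emp"
    have ok: "lam_ok (ins x Y) ?g" by (intro lam_okI D3)
    have "maps (lam (ins x Y) ?g) (ins x Y) omega"
      using c(1) succ_in_omega by (intro maps_lam[OF ok]) (auto simp: maps_ap)
    moreover have "y = z" if "y \<in> elts (ins x Y)" "z \<in> elts (ins x Y)"
      "ap (lam (ins x Y) ?g) y = ap (lam (ins x Y) ?g) z" for y z
      using that(3) unfolding lam_ap[OF ok that(1)] lam_ap[OF ok that(2)]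
      using that(1,2) c(2) by (auto split: if_splits)
    ultimately show "?Q (ins x Y)" by blast
  qed
qed

text \<open>A set containing all structures whose carrier is a subset of \<open>X\<close>. Tuples of
  every arity are subsets of the product of \<open>omega\<close> and \<open>X\<close>, so one bound
  serves all symbols.\<close>

definition struct_bound :: "'a \<Rightarrow> 'a" where
  "struct_bound X = cart (pow X) (cart (pow (cart Rs (pow (pow (cart omega X)))))
    (pow (cart Fs (pow (cart (pow (cart omega X)) X)))))"

lemma struct_in_bound:
  assumes B: "is_structure S B" and X: "elts (carrier B) \<subseteq> elts X"
  shows "B \<in> elts (struct_bound X)"
proof -
  have "B = opair (carrier B) (opair (rels B) (funs B))"
    using B unfolding is_structure_def mkstruct_def by blast
  moreover have "rels B \<in> elts (pow (cart Rs (pow (pow (cart omega X)))))"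
  proof -
    have "maps (rels B) Rs (pow (pow (cart omega X)))"
    proof (rule mapsI[OF structureD(1)[OF B]])
      fix r assume r: "r \<in> elts Rs"
      have "a \<in> elts (pow (cart omega X))" if "a \<in> elts (rels B \<cdot> r)" for a
        by (rule tuple_in_pow[OF rar_omega[OF r] maps_mono[OF structureD(4)[OF B r that] X]])
      then show "rels B \<cdot> r \<in> elts (pow (pow (cart omega X)))" unfolding elts_pow[of "pow (cart omega X)"] by blast
    qed
    then show ?thesis using maps_subset_cart unfolding elts_pow[of "cart Rs (pow (pow (cart omega X)))"] by blast
  qed
  moreover have "funs B \<in> elts (pow (cart Fs (pow (cart (pow (cart omega X)) X))))"
  proof -
    have "maps (funs B) Fs (pow (cart (pow (cart omega X)) X))"
    proof (rule mapsI[OF structureD(2)[OF B]])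
      fix f assume f: "f \<in> elts Fs"
      have "p \<in> elts (cart (pow (cart omega X)) X)" if p: "p \<in> elts (funs B \<cdot> f)" for p
      proof -
        obtain a where a: "maps a (far f) (carrier B)" "p = opair a (funs B \<cdot> f \<cdot> a)"
          using p func_elts[OF maps_func[OF structureD(5)[OF B f]]] by auto
        show ?thesis
          unfolding a(2) opair_in_cart
          using tuple_in_pow[OF far_omega[OF f] maps_mono[OF a(1) X]] structureD(6)[OF B f a(1)] X by blast
      qed
      then show "funs B \<cdot> f \<in> elts (pow (cart (pow (cart omega X)) X))"
        unfolding elts_pow[of "cart (pow (cart omega X)) X"] by blast
    qed
    then show ?thesis
      using maps_subset_cart unfolding elts_pow[of "cart Fs (pow (cart (pow (cart omega X)) X))"] by blast
  qed
  ultimately show ?thesis using X unfolding struct_bound_def by (metis elts_pow mem_Collect_eq opair_in_cart)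
qed

text \<open>Replacing a structure with an assignment by a quotient of the term algebra, whose elements are
  sets of terms, makes the structures that refute Horn formulas range over a set. This is what
  avoids any form of choice or collection.\<close>

lemma shrink:
  assumes iso: "closed_isomorphisms S K" and sub: "closed_substructures S K"
    and K: "\<forall>A\<in>K. is_structure S A" and B: "B \<in> K" and d: "maps d omega (carrier B)"
  shows "\<exists>C\<in>K. elts (carrier C) \<subseteq> elts (pow T) \<and>
    (\<exists>e. maps e omega (carrier C) \<and> (\<forall>\<phi>. is_atomic S \<phi> \<longrightarrow> (at_sat C e \<phi> \<longleftrightarrow> at_sat B d \<phi>)))"
proof -
  note BS = K[rule_format, OF B]
  define v where "v = ev B d"
  have v: "maps v T (carrier B)" unfolding v_def by (rule ev_maps[OF BS d])
  define kc where "kc t = mkset {t'. t' \<in> elts T \<and> ap v t' = ap v t}" for t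
  have dkc: "dft t \<Longrightarrow> dft (\<lambda>s. kc (t s))" for t
    by (rule dft1[where f = kc]) (unfold kc_def, intro D3)
  have kc: "elts (kc t) = {t'. t' \<in> elts T \<and> ap v t' = ap v t}" for t
    unfolding kc_def by (intro elts_mkset sepI D3)
  define D where "D = mkset (kc ` elts T)"
  have D: "elts D = kc ` elts T" unfolding D_def by (intro elts_mkset replI dkc D3)
  \<comment> \<open>All terms in a class have the same value, so the union over the class recovers
    it without selecting a term.\<close>
  define hf where "hf C = mkset {z. \<exists>t\<in>elts C. z \<in> elts (ap v t)}" for C
  have hf: "hf (kc t) = ap v t" if "t \<in> elts T" for t
  proof -
    have "{z. \<exists>t'\<in>elts (kc t). z \<in> elts (ap v t')} = elts (ap v t)" unfolding kc using that by auto
    then show ?thesis unfolding hf_def by simp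
  qed
  have ok: "lam_ok D hf" by (rule lam_okI, unfold hf_def, intro D3)
  define h where "h = lam D hf"
  have hk: "h \<cdot> kc t = ap v t" if "t \<in> elts T" for t
    unfolding h_def using lam_app[OF ok, of "kc t"] hf[OF that] that D by simp
  have vT: "ap v t \<in> elts (carrier B)" if "t \<in> elts T" for t
    using v that unfolding maps_ap by blast
  have hm: "maps h D (carrier B)" unfolding h_def using vT hf D by (intro maps_lam[OF ok]) auto
  have inj: "x = y" if "x \<in> elts D" "y \<in> elts D" "h \<cdot> x = h \<cdot> y" for x y
  proof -
    obtain t u where "t \<in> elts T" "u \<in> elts T" "x = kc t" "y = kc u" using \<open>x \<in> elts D\<close> \<open>y \<in> elts D\<close> D by auto
    then show ?thesis using that(3) hk by (simp add: kc_def)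
  qed
  have cl: "\<exists>x\<in>elts D. h \<cdot> x = funs B \<cdot> f \<cdot> lam (far f) (\<lambda>k. h \<cdot> (a \<cdot> k))"
    if f: "f \<in> elts Fs" and a: "maps a (far f) D" for f a
  proof -
    have "\<exists>t. t \<in> elts T \<and> kc t = ap a k" if "k \<in> elts (far f)" for k
      using maps_app[OF a that] maps_app_ap[OF a that] D by auto
    moreover have "dfn (\<lambda>s. s 1 \<in> elts T \<and> kc (s 1) = ap a (s 0))" by (intro D3 dkc)
    ultimately obtain ts where ts: "func_on ts (far f)" "\<forall>k\<in>elts (far f). ts \<cdot> k \<in> elts T \<and> kc (ts \<cdot> k) = ap a k"
      using fin_choice[OF fin_omega[OF far_omega[OF f]], of "\<lambda>k t. t \<in> elts T \<and> kc t = ap a k"] by blast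
    have tm: "maps ts (far f) T" using ts by (auto intro: mapsI)
    have "lam (far f) (\<lambda>k. v \<cdot> (ts \<cdot> k)) = lam (far f) (\<lambda>k. h \<cdot> (a \<cdot> k))"
    proof (rule lam_cong)
      fix k assume k: "k \<in> elts (far f)"
      show "v \<cdot> (ts \<cdot> k) = h \<cdot> (a \<cdot> k)"
        using hk[of "ts \<cdot> k"] ts(2) k maps_app_ap[OF v, of "ts \<cdot> k"] maps_app_ap[OF a k] by simp
    qed
    then have "h \<cdot> kc (Fn f ts) = funs B \<cdot> f \<cdot> lam (far f) (\<lambda>k. h \<cdot> (a \<cdot> k))"
      using hk[OF Fn_in_terms[OF f tm]] ev_Fn[OF BS d f tm] maps_app_ap[OF v Fn_in_terms[OF f tm]]
      unfolding v_def by simp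
    then show ?thesis using Fn_in_terms[OF f tm] D by blast
  qed
  have "elts D \<noteq> {}" unfolding D using Var_in_terms[OF emp_in_omega] by blast
  then obtain C where C: "is_structure S C" "carrier C = D" "emb h C B"
    using pullback_structure[OF BS hm _ inj cl] by blast
  have CK: "C \<in> K" by (rule closed_emb[OF iso sub K B C(1,3)])
  define e where "e = lam omega (\<lambda>n. kc (Var n))"
  have oke: "lam_ok omega (\<lambda>n. kc (Var n))" by (intro lam_okI dkc D3)
  have e: "maps e omega (carrier C)" unfolding e_def C(2) by (rule maps_lam[OF oke]) (simp add: D)
  have "d = lam omega (\<lambda>n. h \<cdot> (e \<cdot> n))"
  proof (rule func_lam_eqI[OF maps_func[OF d]])
    fix n assume n: "n \<in> elts omega"
    show "d \<cdot> n = h \<cdot> (e \<cdot> n)"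
      unfolding e_def lam_app[OF oke n] hk[OF Var_in_terms[OF n]]
      using ev_Var[OF BS d n] maps_app_ap[OF v Var_in_terms[OF n]] unfolding v_def by simp
  qed
  then have "at_sat C e \<phi> \<longleftrightarrow> at_sat B d \<phi>" if "is_atomic S \<phi>" for \<phi>
    using at_sat_emb[OF C(1) BS C(3) e that] by simp
  moreover have "elts (carrier C) \<subseteq> elts (pow T)" unfolding C(2) D by (auto simp: kc)
  ultimately show ?thesis using CK e by blast
qed

text \<open>Flat atomic formulas: the element \<open>z\<close> is named by the variable \<open>ap c z\<close>.\<close>

definition vars_of :: "'a \<Rightarrow> 'a \<Rightarrow> 'a \<Rightarrow> 'a" where
  "vars_of c n b = lam n (\<lambda>k. Var (ap c (ap b k)))"

lemma vars_of_ok: "lam_ok n (\<lambda>k. Var (ap c (ap b k)))"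
  by (intro lam_okI D3)

lemma vars_of_maps: "maps c Z omega \<Longrightarrow> maps b n Z \<Longrightarrow> maps (vars_of c n b) n T"
  unfolding vars_of_def by (rule maps_lam[OF vars_of_ok]) (simp add: maps_ap)

context
  fixes B e c Z h
  assumes B: "is_structure S B" and e: "maps e omega (carrier B)" and c: "maps c Z omega"
    and eh: "\<And>z. z \<in> elts Z \<Longrightarrow> ap e (ap c z) = h z"
begin

text \<open>\<open>h\<close> prescribes the value of the variable that names an element. Below it is
  the identity when the structure is the given \<open>A\<close>, and the map component of the index
  when the structure comes from an index.\<close>

lemma ev_named: "z \<in> elts Z \<Longrightarrow> ev B e \<cdot> Var (ap c z) = h z"
  using ev_Var[OF B e, of "ap c z"] maps_app_ap[OF e, of "ap c z"] eh c by (simp add: maps_ap)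

lemma ev_vars_of:
  assumes b: "maps b n Z"
  shows "lam n (\<lambda>k. ev B e \<cdot> (vars_of c n b \<cdot> k)) = lam n (\<lambda>k. h (ap b k))"
proof (rule lam_cong)
  fix k assume k: "k \<in> elts n"
  have "ap b k \<in> elts Z" using b k unfolding maps_ap by blast
  then show "ev B e \<cdot> (vars_of c n b \<cdot> k) = h (ap b k)"
    unfolding vars_of_def lam_app[OF vars_of_ok k] by (rule ev_named)
qed

lemma flat_eq: "x \<in> elts Z \<Longrightarrow> y \<in> elts Z \<Longrightarrow>
    is_atomic S (Eq (Var (ap c x)) (Var (ap c y))) \<and> (at_sat B e (Eq (Var (ap c x)) (Var (ap c y))) \<longleftrightarrow> h x = h y)"
  using atomic_Eq at_sat_Eq[OF B e] ev_named c by (simp add: maps_ap)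

lemma flat_rel:
  assumes r: "r \<in> elts Rs" and b: "maps b (rar r) Z"
  shows "is_atomic S (Rel r (vars_of c (rar r) b)) \<and>
    (at_sat B e (Rel r (vars_of c (rar r) b)) \<longleftrightarrow> lam (rar r) (\<lambda>k. h (ap b k)) \<in> elts (rels B \<cdot> r))"
  using at_sat_Rel[OF B e r vars_of_maps[OF c b]] atomic_Rel[OF r vars_of_maps[OF c b]] ev_vars_of[OF b] by simp

lemma flat_fun:
  assumes f: "f \<in> elts Fs" and b: "maps b (far f) Z" and y: "y \<in> elts Z"
  shows "is_atomic S (Eq (Var (ap c y)) (Fn f (vars_of c (far f) b))) \<and>
    (at_sat B e (Eq (Var (ap c y)) (Fn f (vars_of c (far f) b))) \<longleftrightarrow> h y = funs B \<cdot> f \<cdot> lam (far f) (\<lambda>k. h (ap b k)))"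
proof -
  have t: "Var (ap c y) \<in> elts T" "Fn f (vars_of c (far f) b) \<in> elts T"
    using c y Fn_in_terms[OF f vars_of_maps[OF c b]] by (auto simp: maps_ap)
  show ?thesis
    using atomic_Eq[OF t] at_sat_Eq[OF B e t] ev_named[OF y] ev_Fn[OF B e f vars_of_maps[OF c b]] ev_vars_of[OF b]
    by simp
qed

end

section \<open>The Horn theory of a class\<close>

definition horn_theory :: "'a set \<Rightarrow> 'a" where
  "horn_theory K = mkset {\<phi> \<in> elts Fm. is_basic_Horn S \<phi> \<and> (\<forall>A\<in>K. models S A \<phi>)}"

text \<open>For separation, \<open>models\<close> is rephrased as the existence of a satisfaction
  function in the sense of \<open>is_sat_ap\<close>. \<open>K\<close> may be a proper class, but it
  occurs only inside the separating formula, and the formulas themselves form a set.\<close>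

lemma elts_horn_theory:
  assumes dK: "dfn (\<lambda>s. s 0 \<in> K)" and K: "\<forall>A\<in>K. is_structure S A"
  shows "elts (horn_theory K) = {\<phi>. is_basic_Horn S \<phi> \<and> (\<forall>A\<in>K. models S A \<phi>)}"
proof -
  let ?M = "\<lambda>A \<phi>. \<exists>U. is_sat_ap A U \<and> (\<forall>e. maps e omega (carrier A) \<longrightarrow> e \<in> elts (ap U \<phi>))"
  have m: "models S A \<phi> \<longleftrightarrow> ?M A \<phi>" if A: "is_structure S A" and \<phi>: "\<phi> \<in> elts Fm" for A \<phi>
  proof -
    have "models S A \<phi> \<longleftrightarrow> (\<forall>e. maps e omega (carrier A) \<longrightarrow> e \<in> elts (ap (sat_sets S A) \<phi>))"
      unfolding models_def sat_def[OF A, symmetric] sat_ap[OF A \<phi>] by simp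
    then show ?thesis using sat_sets_spec[OF A] is_sat_unique[OF A] by blast
  qed
  have "{\<phi> \<in> elts Fm. is_basic_Horn S \<phi> \<and> (\<forall>A\<in>K. models S A \<phi>)} =
      {\<phi> \<in> elts Fm. is_basic_Horn S \<phi> \<and> (\<forall>A. A \<in> K \<longrightarrow> ?M A \<phi>)}"
    using m K by blast
  moreover have "isset {\<phi> \<in> elts Fm. is_basic_Horn S \<phi> \<and> (\<forall>A. A \<in> K \<longrightarrow> ?M A \<phi>)}"
    by (intro sepI D3 dfn_is_basic_Horn dfn_is_sat_ap dfn1[where R = "\<lambda>x. x \<in> K", OF dK])
  ultimately have "elts (horn_theory K) = {\<phi> \<in> elts Fm. is_basic_Horn S \<phi> \<and> (\<forall>A\<in>K. models S A \<phi>)}"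
    unfolding horn_theory_def by (simp add: elts_mkset)
  moreover have "\<phi> \<in> elts Fm" if "is_basic_Horn S \<phi>" for \<phi>
    using that horn_Fm unfolding is_basic_Horn_iff by blast
  ultimately show ?thesis by blast
qed

section \<open>The index set and the filter\<close>

context
  fixes K :: "'a set" and A :: 'a
  assumes iso: "closed_isomorphisms S K" and sub: "closed_substructures S K"
    and rp: "closed_reduced_products S K" and dK: "dfn (\<lambda>s. s 0 \<in> K)"
    and K: "\<forall>B\<in>K. is_structure S B"
    and A: "is_structure S A" and AM: "\<forall>\<phi>\<in>elts (horn_theory K). models S A \<phi>"
begin

abbreviation "CA \<equiv> carrier A"

text \<open>The bound on the carriers makes this a set even if \<open>K\<close> is a proper class;
  \<open>shrink\<close> ensures that enough members of \<open>K\<close> obey it.\<close>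

definition Idx :: 'a where
  "Idx = mkset {p. \<exists>B h. p = opair B h \<and> B \<in> K \<and> elts (carrier B) \<subseteq> elts (pow T) \<and> maps h CA (carrier B)}"

lemma elts_Idx:
  "elts Idx = {p. \<exists>B h. p = opair B h \<and> B \<in> K \<and> elts (carrier B) \<subseteq> elts (pow T) \<and> maps h CA (carrier B)}"
  unfolding Idx_def
proof (rule elts_mkset, rule isset_Collect[where a = "cart (struct_bound (pow T)) (pow (cart CA (pow T)))"])
  show "dfn (\<lambda>s. \<exists>B h. s 0 = opair B h \<and> B \<in> K \<and> elts (carrier B) \<subseteq> elts (pow T) \<and> maps h CA (carrier B))"
    by (intro D3 dfn1[where R = "\<lambda>x. x \<in> K", OF dK])
  fix p assume "\<exists>B h. p = opair B h \<and> B \<in> K \<and> elts (carrier B) \<subseteq> elts (pow T) \<and> maps h CA (carrier B)"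
  then obtain B h where p: "p = opair B h" "B \<in> K" "elts (carrier B) \<subseteq> elts (pow T)" "maps h CA (carrier B)" by blast
  have "h \<in> elts (pow (cart CA (pow T)))"
    using maps_subset_cart[OF maps_mono[OF p(4,3)]] unfolding elts_pow[of "cart CA (pow T)"] by blast
  then show "p \<in> elts (cart (struct_bound (pow T)) (pow (cart CA (pow T))))"
    unfolding p(1) opair_in_cart using struct_in_bound[OF K[rule_format, OF p(2)] p(3)] by blast
qed

lemma IdxD:
  assumes "i \<in> elts Idx"
  shows "pfst i \<in> K" "is_structure S (pfst i)" "maps (psnd i) CA (carrier (pfst i))"
  using assms K unfolding elts_Idx by auto

text \<open>The variable \<open>ap c z\<close> is a name for \<open>z\<close>, to be interpreted as
  the map of the index dictates. Two elements may share a name; such a \<open>c\<close> may then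
  have no matching assignment, and conditions on matching assignments become vacuous.\<close>

definition matching :: "'a \<Rightarrow> 'a \<Rightarrow> 'a \<Rightarrow> 'a \<Rightarrow> bool" where
  "matching Z c i e \<longleftrightarrow> maps e omega (carrier (pfst i)) \<and> (\<forall>z\<in>elts Z. ap e (ap c z) = ap (psnd i) z)"

definition matching_A :: "'a \<Rightarrow> 'a \<Rightarrow> 'a \<Rightarrow> bool" where
  "matching_A Z c a \<longleftrightarrow> maps a omega CA \<and> (\<forall>z\<in>elts Z. ap a (ap c z) = z)"

text \<open>A syntactic form of a finite intersection of generators below \<open>X\<close>:
  \<open>L\<close> lists facts of \<open>A\<close> whose preservation at an index suffices for
  membership in \<open>X\<close>.\<close>

definition certifies :: "'a \<Rightarrow> 'a \<Rightarrow> 'a \<Rightarrow> 'a \<Rightarrow> bool" where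
  "certifies Z c L X \<longleftrightarrow> fin L \<and> (\<forall>\<alpha>\<in>elts L. is_atomic S \<alpha>) \<and>
    (\<forall>a. matching_A Z c a \<longrightarrow> (\<forall>\<alpha>\<in>elts L. at_sat A a \<alpha>)) \<and>
    (\<forall>i\<in>elts Idx. \<forall>e. matching Z c i e \<and> (\<forall>\<alpha>\<in>elts L. at_sat (pfst i) e \<alpha>) \<longrightarrow> i \<in> elts X)"

text \<open>A set of indices is large if membership follows from finitely many atomic facts true in \<open>A\<close>.
  The variables naming the elements of \<open>A\<close> are universally quantified, so that the facts
  witnessing two large sets can be united without renaming variables.\<close>

definition large :: "'a \<Rightarrow> bool" where
  "large X \<longleftrightarrow> (\<exists>Y. fin Y \<and> elts Y \<subseteq> elts CA \<and>
    (\<forall>Z c. elts Y \<subseteq> elts Z \<and> elts Z \<subseteq> elts CA \<and> maps c Z omega \<longrightarrow> (\<exists>L. certifies Z c L X)))"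

definition Filt :: 'a where
  "Filt = mkset {X \<in> elts (pow Idx). large X}"

lemma elts_Filt: "elts Filt = {X \<in> elts (pow Idx). large X}"
  unfolding Filt_def
proof (intro elts_mkset sepI)
  show "dfn (\<lambda>s. large (s 0))"
    unfolding large_def certifies_def matching_def matching_A_def by (intro D3 dfn_is_atomic dfn_at_sat)
qed

lemma certifies_mono: "certifies Z c L X \<Longrightarrow> elts X \<subseteq> elts X' \<Longrightarrow> certifies Z c L X'"
  unfolding certifies_def by blast

lemma certifies_Int:
  assumes "certifies Z c L1 X1" "certifies Z c L2 X2" "elts X3 = elts X1 \<inter> elts X2"
  shows "certifies Z c (un L1 L2) X3"
  unfolding certifies_def
proof (intro conjI ballI allI impI)
  show "fin (un L1 L2)" using assms(1,2) fin_un unfolding certifies_def by blast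
  show "is_atomic S \<alpha>" if "\<alpha> \<in> elts (un L1 L2)" for \<alpha>
    using assms(1,2) that unfolding certifies_def by auto
  show "at_sat A a \<alpha>" if "matching_A Z c a" "\<alpha> \<in> elts (un L1 L2)" for a \<alpha>
    using assms(1,2) that unfolding certifies_def by auto
  show "i \<in> elts X3" if i: "i \<in> elts Idx"
    and e: "matching Z c i e \<and> (\<forall>\<alpha>\<in>elts (un L1 L2). at_sat (pfst i) e \<alpha>)" for i e
  proof -
    have "\<forall>\<alpha>\<in>elts L1. at_sat (pfst i) e \<alpha>" "\<forall>\<alpha>\<in>elts L2. at_sat (pfst i) e \<alpha>" using e by auto
    then show ?thesis using assms i e unfolding certifies_def by blast
  qed
qed

lemma largeI:
  assumes "fin Y" "elts Y \<subseteq> elts CA"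
    "\<And>Z c. elts Y \<subseteq> elts Z \<Longrightarrow> elts Z \<subseteq> elts CA \<Longrightarrow> maps c Z omega \<Longrightarrow> \<exists>L. certifies Z c L X"
  shows "large X"
  unfolding large_def using assms by blast

lemma large_mono:
  assumes X: "large X" and sub: "elts X \<subseteq> elts X'"
  shows "large X'"
proof -
  obtain Y where Y: "fin Y" "elts Y \<subseteq> elts CA"
    "\<And>Z c. elts Y \<subseteq> elts Z \<Longrightarrow> elts Z \<subseteq> elts CA \<Longrightarrow> maps c Z omega \<Longrightarrow> \<exists>L. certifies Z c L X"
    using X unfolding large_def by blast
  show ?thesis
  proof (rule largeI[OF Y(1,2)])
    fix Z c assume "elts Y \<subseteq> elts Z" "elts Z \<subseteq> elts CA" "maps c Z omega"
    then obtain L where "certifies Z c L X" using Y(3) by blast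
    then show "\<exists>L. certifies Z c L X'" using certifies_mono sub by blast
  qed
qed

lemma large_Int:
  assumes X: "large X1" "large X2" and X3: "elts X3 = elts X1 \<inter> elts X2"
  shows "large X3"
proof -
  obtain Y1 where Y1: "fin Y1" "elts Y1 \<subseteq> elts CA"
    "\<And>Z c. elts Y1 \<subseteq> elts Z \<Longrightarrow> elts Z \<subseteq> elts CA \<Longrightarrow> maps c Z omega \<Longrightarrow> \<exists>L. certifies Z c L X1"
    using X(1) unfolding large_def by blast
  obtain Y2 where Y2: "fin Y2" "elts Y2 \<subseteq> elts CA"
    "\<And>Z c. elts Y2 \<subseteq> elts Z \<Longrightarrow> elts Z \<subseteq> elts CA \<Longrightarrow> maps c Z omega \<Longrightarrow> \<exists>L. certifies Z c L X2"
    using X(2) unfolding large_def by blast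
  show ?thesis
  proof (rule largeI[of "un Y1 Y2"])
    show "fin (un Y1 Y2)" by (rule fin_un[OF Y1(1) Y2(1)])
    show "elts (un Y1 Y2) \<subseteq> elts CA" using Y1(2) Y2(2) by simp
    fix Z c assume "elts (un Y1 Y2) \<subseteq> elts Z" "elts Z \<subseteq> elts CA" "maps c Z omega"
    then obtain L1 L2 where "certifies Z c L1 X1" "certifies Z c L2 X2"
      using Y1(3)[of Z c] Y2(3)[of Z c] by auto
    then show "\<exists>L. certifies Z c L X3" using certifies_Int X3 by blast
  qed
qed

text \<open>Injectivity makes the inverse of \<open>c\<close> a function on its range; all variables
  outside the range receive the fixed element \<open>a0\<close>.\<close>

lemma named_assignment:
  assumes c: "maps c Z omega" and inj: "\<forall>x\<in>elts Z. \<forall>y\<in>elts Z. ap c x = ap c y \<longrightarrow> x = y"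
    and Z: "elts Z \<subseteq> elts CA"
  shows "\<exists>a. matching_A Z c a"
proof -
  obtain a0 where a0: "a0 \<in> elts CA" using structureD(3)[OF A] by blast
  define g where "g n = mkset {x. (\<exists>z\<in>elts Z. ap c z = n \<and> x \<in> elts z) \<or> (\<not> (\<exists>z\<in>elts Z. ap c z = n) \<and> x \<in> elts a0)}" for n
  have ok: "lam_ok omega g" by (rule lam_okI, unfold g_def, intro D3)
  have g1: "g (ap c z) = z" if z: "z \<in> elts Z" for z
  proof -
    have "{x. (\<exists>z'\<in>elts Z. ap c z' = ap c z \<and> x \<in> elts z') \<or> (\<not> (\<exists>z'\<in>elts Z. ap c z' = ap c z) \<and> x \<in> elts a0)} = elts z"
      using z inj by blast
    then show ?thesis unfolding g_def by simp
  qed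
  have g2: "g n = a0" if "\<not> (\<exists>z\<in>elts Z. ap c z = n)" for n
  proof -
    have "{x. (\<exists>z\<in>elts Z. ap c z = n \<and> x \<in> elts z) \<or> (\<not> (\<exists>z\<in>elts Z. ap c z = n) \<and> x \<in> elts a0)} = elts a0"
      using that by blast
    then show ?thesis unfolding g_def by simp
  qed
  have "g n \<in> elts CA" for n
    using g1 g2 a0 Z by (cases "\<exists>z\<in>elts Z. ap c z = n") auto
  then have "maps (lam omega g) omega CA" by (intro maps_lam[OF ok])
  moreover have "ap (lam omega g) (ap c z) = z" if "z \<in> elts Z" for z
    using lam_ap[OF ok, of "ap c z"] g1[OF that] c that by (simp add: maps_ap)
  ultimately show ?thesis unfolding matching_A_def by blast
qed

text \<open>The clause made of \<open>\<sigma> c\<close> and the negations of the facts certifying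
  \<open>X\<close> is a basic Horn formula that fails in \<open>A\<close>. As \<open>A\<close>
  satisfies the Horn theory, the clause fails in some \<open>B\<close> in \<open>K\<close>, and
  after \<open>shrink\<close> the refuting assignment determines an index. There the certificate is
  true, so the index lies in \<open>X\<close>, while \<open>\<sigma> c\<close> is false. With
  \<open>\<sigma>\<close> atomic this keeps false facts false; with a contradiction for
  \<open>\<sigma>\<close> it gives properness.\<close>

lemma large_witness:
  assumes X: "large X" and W: "fin W" "elts W \<subseteq> elts CA"
    and \<sigma>: "\<And>Z c. elts W \<subseteq> elts Z \<Longrightarrow> elts Z \<subseteq> elts CA \<Longrightarrow> maps c Z omega \<Longrightarrow>
      literal (\<sigma> c) \<and> (\<forall>a. matching_A Z c a \<longrightarrow> \<not> lit_sat A a (\<sigma> c))"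
  shows "\<exists>i\<in>elts Idx. i \<in> elts X \<and> (\<exists>Z c e. elts W \<subseteq> elts Z \<and> elts Z \<subseteq> elts CA \<and> maps c Z omega \<and>
    matching Z c i e \<and> \<not> lit_sat (pfst i) e (\<sigma> c))"
proof -
  obtain Y where Y: "fin Y" "elts Y \<subseteq> elts CA"
    "\<And>Z c. elts Y \<subseteq> elts Z \<Longrightarrow> elts Z \<subseteq> elts CA \<Longrightarrow> maps c Z omega \<Longrightarrow> \<exists>L. certifies Z c L X"
    using X unfolding large_def by blast
  \<comment> \<open>\<open>Y\<close> carries the certificate of \<open>X\<close> and
    \<open>W\<close> the elements mentioned by \<open>\<sigma>\<close>; both must receive names from
    the same \<open>c\<close>.\<close>
  define Z where "Z = un Y W"
  have Z: "fin Z" "elts Z \<subseteq> elts CA" "elts Y \<subseteq> elts Z" "elts W \<subseteq> elts Z"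
    using fin_un[OF Y(1) W(1)] Y(2) W(2) by (auto simp: Z_def)
  obtain c where c: "maps c Z omega" "\<forall>x\<in>elts Z. \<forall>y\<in>elts Z. ap c x = ap c y \<longrightarrow> x = y"
    using fin_injection[OF Z(1)] by blast
  obtain L where L: "fin L" "\<And>\<alpha>. \<alpha> \<in> elts L \<Longrightarrow> is_atomic S \<alpha>"
      "\<And>a \<alpha>. matching_A Z c a \<Longrightarrow> \<alpha> \<in> elts L \<Longrightarrow> at_sat A a \<alpha>"
      "\<And>i e. i \<in> elts Idx \<Longrightarrow> matching Z c i e \<Longrightarrow> (\<forall>\<alpha>\<in>elts L. at_sat (pfst i) e \<alpha>) \<Longrightarrow> i \<in> elts X"
    using Y(3)[OF Z(3,2) c(1)] unfolding certifies_def by blast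
  obtain a where a: "matching_A Z c a" using named_assignment[OF c Z(2)] by blast
  have lit: "literal (\<sigma> c)" and \<sigma>a: "\<not> lit_sat A a (\<sigma> c)" using \<sigma>[OF Z(4,2) c(1)] a by blast+
  obtain n l g \<phi> where H: "horn_seq n l g \<phi>"
    and l: "\<And>x. (\<exists>i\<in>elts (succ n). ap l i = x) \<longleftrightarrow> x = \<sigma> c \<or> (\<exists>\<alpha>\<in>elts L. x = Neg \<alpha>)"
    using horn_exists[OF L(1,2) lit] by blast
  have "\<not> lit_sat A a (ap l i)" if i: "i \<in> elts (succ n)" for i
  proof -
    have "ap l i = \<sigma> c \<or> (\<exists>\<alpha>\<in>elts L. ap l i = Neg \<alpha>)" using l[of "ap l i"] i by blast
    then show ?thesis using \<sigma>a L(2) L(3)[OF a] by auto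
  qed
  then have "\<not> models S A \<phi>"
    unfolding models_horn[OF A H] using a unfolding matching_A_def by blast
  then have "\<phi> \<notin> elts (horn_theory K)" using AM by blast
  then obtain B where B: "B \<in> K" "\<not> models S B \<phi>"
    unfolding elts_horn_theory[OF dK K] is_basic_Horn_iff using H by blast
  note BS = K[rule_format, OF B(1)]
  obtain d where d: "maps d omega (carrier B)" "\<And>i. i \<in> elts (succ n) \<Longrightarrow> \<not> lit_sat B d (ap l i)"
    using B(2) unfolding models_horn[OF BS H] by blast
  have d': "\<not> lit_sat B d x" if "x = \<sigma> c \<or> (\<exists>\<alpha>\<in>elts L. x = Neg \<alpha>)" for x
    using d(2) l[of x] that by blast
  obtain C e where C: "C \<in> K" "elts (carrier C) \<subseteq> elts (pow T)" "maps e omega (carrier C)"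
    "\<And>\<phi>. is_atomic S \<phi> \<Longrightarrow> at_sat C e \<phi> \<longleftrightarrow> at_sat B d \<phi>"
    using shrink[OF iso sub K B(1) d(1)] by blast
  have C': "lit_sat C e x \<longleftrightarrow> lit_sat B d x" for x
    unfolding lit_sat_def using C(4) by blast
  obtain b0 where b0: "b0 \<in> elts (carrier C)" using structureD(3)[OF K[rule_format, OF C(1)]] by blast
  \<comment> \<open>Outside \<open>Z\<close> every element is sent to \<open>b0\<close>. The result
    is rarely a homomorphism, which is why the index set admits arbitrary maps.\<close>
  define h where "h = lam CA (\<lambda>z. if z \<in> elts Z then ap e (ap c z) else b0)"
  have ok: "lam_ok CA (\<lambda>z. if z \<in> elts Z then ap e (ap c z) else b0)" by (intro lam_okI D3)
  have "maps h CA (carrier C)"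
    unfolding h_def using b0 C(3) c(1) by (intro maps_lam[OF ok]) (auto simp: maps_ap)
  then have i: "opair C h \<in> elts Idx" unfolding elts_Idx using C(1,2) by blast
  have m: "matching Z c (opair C h) e"
    unfolding matching_def using C(3) Z(2) lam_ap[OF ok] by (auto simp: h_def)
  have "\<forall>\<alpha>\<in>elts L. at_sat C e \<alpha>"
  proof
    fix \<alpha> assume \<alpha>: "\<alpha> \<in> elts L"
    then have "\<not> lit_sat B d (Neg \<alpha>)" by (intro d') blast
    then show "at_sat C e \<alpha>" using L(2)[OF \<alpha>] C(4) by simp
  qed
  then have "opair C h \<in> elts X" using L(4)[OF i m] by simp
  moreover have "\<not> lit_sat C e (\<sigma> c)" unfolding C' by (rule d') blast
  ultimately show ?thesis using i m Z c(1) by (intro bexI[of _ "opair C h"]) auto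
qed

lemma Filt_proper: "proper_filter Idx Filt"
  unfolding proper_filter_def
proof (intro conjI ballI allI impI)
  show "elts X \<subseteq> elts Idx" if "X \<in> elts Filt" for X
    using that unfolding elts_Filt by simp
  have "large Idx"
    unfolding large_def certifies_def using fin_emp by (intro exI[of _ emp]) (auto intro!: exI[of _ emp])
  then show "Idx \<in> elts Filt" unfolding elts_Filt by simp
  show "mkset {} \<notin> elts Filt"
  proof
    assume "mkset {} \<in> elts Filt"
    then have "large emp" unfolding elts_Filt emp_def by simp
    \<comment> \<open>\<open>Neg ?\<tau>\<close> is false under every assignment. With this literal
      for \<open>\<sigma>\<close>, \<open>large_witness\<close> would produce an element of
      \<open>emp\<close>.\<close>
    let ?\<tau> = "Eq (Var emp) (Var emp)"
    have at: "is_atomic S ?\<tau>" by (intro atomic_Eq Var_in_terms emp_in_omega)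
    have "\<exists>i\<in>elts Idx. i \<in> elts emp \<and> (\<exists>Z c e. elts emp \<subseteq> elts Z \<and> elts Z \<subseteq> elts CA \<and> maps c Z omega \<and>
      matching Z c i e \<and> \<not> lit_sat (pfst i) e (Neg ?\<tau>))"
    proof (rule large_witness[OF \<open>large emp\<close> fin_emp])
      show "literal (Neg ?\<tau>) \<and> (\<forall>a. matching_A Z c a \<longrightarrow> \<not> lit_sat A a (Neg ?\<tau>))" for Z c
        using at at_sat_Eq_ap[of "Var emp" "Var emp"] unfolding literal_def by auto
    qed simp
    then show False by simp
  qed
  show "Y \<in> elts Filt" if X: "X \<in> elts Filt" and Y: "elts X \<subseteq> elts Y \<and> elts Y \<subseteq> elts Idx" for X Y
  proof -
    have "large Y" using X Y large_mono unfolding elts_Filt by blast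
    then show ?thesis unfolding elts_Filt using Y by simp
  qed
  show "mkset (elts X \<inter> elts Y) \<in> elts Filt" if X: "X \<in> elts Filt" and Y: "Y \<in> elts Filt" for X Y
  proof -
    have "isset {x \<in> elts X. x \<in> elts Y}" by (intro sepI D3)
    then have e: "elts (mkset (elts X \<inter> elts Y)) = elts X \<inter> elts Y" by (simp add: elts_mkset Int_def)
    have "large (mkset (elts X \<inter> elts Y))" using large_Int[OF _ _ e] X Y unfolding elts_Filt by blast
    then show ?thesis using X unfolding elts_Filt by (auto simp: e)
  qed
qed

section \<open>The evaluation embedding\<close>

definition Fam :: 'a where "Fam = lam Idx pfst"

lemma Fam_ok: "lam_ok Idx pfst" by (intro lam_okI D3)

lemma Fam_func: "func_on Fam Idx" unfolding Fam_def by (rule func_lam[OF Fam_ok])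

lemma Fam_app: "i \<in> elts Idx \<Longrightarrow> Fam \<cdot> i = pfst i" and Fam_ap: "i \<in> elts Idx \<Longrightarrow> ap Fam i = pfst i"
  unfolding Fam_def by (rule lam_app[OF Fam_ok], assumption) (rule lam_ap[OF Fam_ok])

definition hat :: "'a \<Rightarrow> 'a" where "hat x = lam Idx (\<lambda>i. ap (psnd i) x)"

lemma hat_ok: "lam_ok Idx (\<lambda>i. ap (psnd i) x)" by (intro lam_okI D3)

lemma dft_hat: "dft t \<Longrightarrow> dft (\<lambda>s. hat (t s))"
  by (rule dft1) (unfold hat_def, intro D3)

lemma hat_ap: "i \<in> elts Idx \<Longrightarrow> ap (hat x) i = ap (psnd i) x"
  unfolding hat_def by (rule lam_ap[OF hat_ok])

lemma hat_product: "x \<in> elts CA \<Longrightarrow> hat x \<in> elts (product Idx Fam)"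
  unfolding elts_product_of[OF Fam_func]
  using func_lam[OF hat_ok] IdxD(3) by (auto simp: hat_ap Fam_ap maps_ap hat_def[symmetric])

text \<open>The carrier of \<open>A\<close> has an element, and evaluation at it is an explicitly
  defined member of the product.\<close>

lemma product_nonempty: "elts (product Idx Fam) \<noteq> {}"
  using structureD(3)[OF A] hat_product by blast

lemma Fam_struct: "\<forall>i\<in>elts Idx. is_structure S (Fam \<cdot> i)"
  using Fam_app IdxD(2) by simp

lemmas ctxt = Filt_proper Fam_func Fam_struct product_nonempty

lemma big_Filt_iff: "dfn (\<lambda>s. R (s 0)) \<Longrightarrow> big Idx Filt R \<longleftrightarrow> large (mkset {i \<in> elts Idx. R i})"
  unfolding big_def[OF ctxt] elts_Filt using elts_mkset[OF sepI] by auto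

text \<open>A single atomic fact true in \<open>A\<close> is already a certificate. It may depend on
  the naming \<open>c\<close>, since \<open>large\<close> quantifies over all namings.\<close>

lemma bigI:
  assumes R: "dfn (\<lambda>s. R (s 0))" and Y: "fin Y" "elts Y \<subseteq> elts CA"
    and \<alpha>: "\<And>Z c. elts Y \<subseteq> elts Z \<Longrightarrow> elts Z \<subseteq> elts CA \<Longrightarrow> maps c Z omega \<Longrightarrow>
      is_atomic S (\<alpha> c) \<and> (\<forall>a. matching_A Z c a \<longrightarrow> at_sat A a (\<alpha> c)) \<and>
      (\<forall>i\<in>elts Idx. \<forall>e. matching Z c i e \<and> at_sat (pfst i) e (\<alpha> c) \<longrightarrow> R i)"
  shows "big Idx Filt R"
  unfolding big_Filt_iff[OF R]
proof (rule largeI[OF Y])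
  fix Z c assume "elts Y \<subseteq> elts Z" "elts Z \<subseteq> elts CA" "maps c Z omega"
  then have "is_atomic S (\<alpha> c) \<and> (\<forall>a. matching_A Z c a \<longrightarrow> at_sat A a (\<alpha> c)) \<and>
      (\<forall>i\<in>elts Idx. \<forall>e. matching Z c i e \<and> at_sat (pfst i) e (\<alpha> c) \<longrightarrow> R i)" using \<alpha> by blast
  then have "certifies Z c (ins (\<alpha> c) emp) (mkset {i \<in> elts Idx. R i})"
    unfolding certifies_def elts_mkset[OF sepI[OF R]] by (auto simp: fin_ins fin_emp)
  then show "\<exists>L. certifies Z c L (mkset {i \<in> elts Idx. R i})" by blast
qed

text \<open>\<open>large_witness\<close> is applied with \<open>\<alpha> c\<close> as the positive
  literal: it yields an index where \<open>R\<close> holds although \<open>\<alpha> c\<close> fails,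
  against the last part of the premise.\<close>

lemma bigE:
  assumes "big Idx Filt R" and R: "dfn (\<lambda>s. R (s 0))" and W: "fin W" "elts W \<subseteq> elts CA"
    and \<alpha>: "\<And>Z c. elts W \<subseteq> elts Z \<Longrightarrow> elts Z \<subseteq> elts CA \<Longrightarrow> maps c Z omega \<Longrightarrow>
      is_atomic S (\<alpha> c) \<and> (\<forall>a. matching_A Z c a \<longrightarrow> \<not> at_sat A a (\<alpha> c)) \<and>
      (\<forall>i\<in>elts Idx. \<forall>e. matching Z c i e \<and> R i \<longrightarrow> at_sat (pfst i) e (\<alpha> c))"
  shows False
proof -
  have "\<exists>i\<in>elts Idx. i \<in> elts (mkset {i \<in> elts Idx. R i}) \<and> (\<exists>Z c e. elts W \<subseteq> elts Z \<and> elts Z \<subseteq> elts CA \<and>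
      maps c Z omega \<and> matching Z c i e \<and> \<not> lit_sat (pfst i) e (\<alpha> c))"
  proof (rule large_witness[OF assms(1)[unfolded big_Filt_iff[OF R]] W])
    show "literal (\<alpha> c) \<and> (\<forall>a. matching_A Z c a \<longrightarrow> \<not> lit_sat A a (\<alpha> c))"
      if "elts W \<subseteq> elts Z" "elts Z \<subseteq> elts CA" "maps c Z omega" for Z c
      using \<alpha>[OF that] unfolding literal_def by simp
  qed
  then obtain i Z c e where i: "i \<in> elts Idx" "R i" "elts W \<subseteq> elts Z" "elts Z \<subseteq> elts CA" "maps c Z omega"
    "matching Z c i e" "\<not> lit_sat (pfst i) e (\<alpha> c)"
    unfolding elts_mkset[OF sepI[OF R]] by blast
  then show False using \<alpha>[OF i(3-5)] by simp
qed

lemma matchingD: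
  assumes "matching Z c i e"
  shows "maps e omega (carrier (pfst i))" "z \<in> elts Z \<Longrightarrow> ap e (ap c z) = ap (psnd i) z"
  using assms unfolding matching_def by blast+

lemma matching_AD:
  assumes "matching_A Z c a"
  shows "maps a omega CA" "z \<in> elts Z \<Longrightarrow> ap a (ap c z) = z"
  using assms unfolding matching_A_def by blast+

lemma big_eq:
  assumes x: "x \<in> elts CA" and y: "y \<in> elts CA" and b: "big Idx Filt (\<lambda>i. ap (psnd i) x = ap (psnd i) y)"
  shows "x = y"
proof (rule ccontr)
  assume ne: "x \<noteq> y"
  show False
  proof (rule bigE[OF b, where W = "ins x (ins y emp)" and \<alpha> = "\<lambda>c. Eq (Var (ap c x)) (Var (ap c y))"])
    show "dfn (\<lambda>s. ap (psnd (s 0)) x = ap (psnd (s 0)) y)" by (intro D3)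
    show "fin (ins x (ins y emp))" by (intro fin_ins fin_emp)
    show "elts (ins x (ins y emp)) \<subseteq> elts CA" using x y by simp
    fix Z c assume "elts (ins x (ins y emp)) \<subseteq> elts Z" "elts Z \<subseteq> elts CA" and c: "maps c Z omega"
    then have z: "x \<in> elts Z" "y \<in> elts Z" by auto
    have "is_atomic S (Eq (Var (ap c x)) (Var (ap c y)))"
      using c z by (intro atomic_Eq Var_in_terms) (auto simp: maps_ap)
    moreover have "\<not> at_sat A a (Eq (Var (ap c x)) (Var (ap c y)))" if m: "matching_A Z c a" for a
      using flat_eq[OF A matching_AD(1)[OF m] c matching_AD(2)[OF m] z] ne by simp
    moreover have "at_sat (pfst i) e (Eq (Var (ap c x)) (Var (ap c y)))"
      if i: "i \<in> elts Idx" and m: "matching Z c i e" and r: "ap (psnd i) x = ap (psnd i) y" for i e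
      using flat_eq[OF IdxD(2)[OF i] matchingD(1)[OF m] c matchingD(2)[OF m] z] r by simp
    ultimately show "is_atomic S (Eq (Var (ap c x)) (Var (ap c y))) \<and>
      (\<forall>a. matching_A Z c a \<longrightarrow> \<not> at_sat A a (Eq (Var (ap c x)) (Var (ap c y)))) \<and>
      (\<forall>i\<in>elts Idx. \<forall>e. matching Z c i e \<and> ap (psnd i) x = ap (psnd i) y \<longrightarrow>
        at_sat (pfst i) e (Eq (Var (ap c x)) (Var (ap c y))))" by blast
  qed
qed

lemma lam_ap_id: "maps b n CA \<Longrightarrow> lam n (\<lambda>k. ap b k) = b"
  using func_lam_eqI[of b n "ap b"] maps_app_ap maps_func by metis

lemma range_maps: "maps b n CA \<Longrightarrow> ap b ` elts n \<subseteq> elts Z \<Longrightarrow> maps b n Z"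
  unfolding maps_ap by blast

lemma range_CA: "maps b n CA \<Longrightarrow> ap b ` elts n \<subseteq> elts CA"
  unfolding maps_ap by blast

text \<open>The same flat formula serves both directions: if it is true in \<open>A\<close>, it
  certifies the set of indices; if it is false, \<open>bigE\<close> excludes that this set is
  large.\<close>

lemma big_rel:
  assumes r: "r \<in> elts Rs" and b: "maps b (rar r) CA"
  shows "big Idx Filt (\<lambda>i. lam (rar r) (\<lambda>k. ap (psnd i) (ap b k)) \<in> elts (ap (rels (pfst i)) r)) \<longleftrightarrow>
    b \<in> elts (rels A \<cdot> r)"
proof -
  let ?R = "\<lambda>i. lam (rar r) (\<lambda>k. ap (psnd i) (ap b k)) \<in> elts (ap (rels (pfst i)) r)"
  let ?\<alpha> = "\<lambda>c. Rel r (vars_of c (rar r) b)"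
  have dR: "dfn (\<lambda>s. ?R (s 0))" by (intro D3)
  have Y: "fin (mkset (ap b ` elts (rar r)))" "elts (mkset (ap b ` elts (rar r))) \<subseteq> elts CA"
    using fin_range[OF rar_omega[OF r] maps_func[OF b]] range_CA[OF b] unfolding elts_range by auto
  have 1: "is_atomic S (?\<alpha> c)" if "maps b (rar r) Z" "maps c Z omega" for Z c
    by (rule atomic_Rel[OF r vars_of_maps[OF that(2,1)]])
  have 2: "at_sat A a (?\<alpha> c) \<longleftrightarrow> b \<in> elts (rels A \<cdot> r)"
    if "maps b (rar r) Z" "maps c Z omega" "matching_A Z c a" for Z c a
    using flat_rel[OF A matching_AD(1)[OF that(3)] that(2) matching_AD(2)[OF that(3)] r that(1)]
    unfolding lam_ap_id[OF b] by blast
  have 3: "at_sat (pfst i) e (?\<alpha> c) \<longleftrightarrow> ?R i"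
    if "maps b (rar r) Z" "maps c Z omega" "i \<in> elts Idx" "matching Z c i e" for Z c i e
    using flat_rel[OF IdxD(2)[OF that(3)] matchingD(1)[OF that(4)] that(2) matchingD(2)[OF that(4)] r that(1)]
    unfolding structureD(7)[OF IdxD(2)[OF that(3)] r] by blast
  show ?thesis
  proof
    assume br: "b \<in> elts (rels A \<cdot> r)"
    show "big Idx Filt ?R"
    proof (rule bigI[OF dR Y, where \<alpha> = ?\<alpha>])
      fix Z c assume "elts (mkset (ap b ` elts (rar r))) \<subseteq> elts Z" and c: "maps c Z omega"
      then have bZ: "maps b (rar r) Z" using range_maps[OF b] unfolding elts_range by blast
      show "is_atomic S (?\<alpha> c) \<and> (\<forall>a. matching_A Z c a \<longrightarrow> at_sat A a (?\<alpha> c)) \<and>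
        (\<forall>i\<in>elts Idx. \<forall>e. matching Z c i e \<and> at_sat (pfst i) e (?\<alpha> c) \<longrightarrow> ?R i)"
        using 1[OF bZ c] 2[OF bZ c] 3[OF bZ c] br by blast
    qed
  next
    assume big: "big Idx Filt ?R"
    show "b \<in> elts (rels A \<cdot> r)"
    proof (rule ccontr)
      assume br: "b \<notin> elts (rels A \<cdot> r)"
      show False
      proof (rule bigE[OF big dR Y, where \<alpha> = ?\<alpha>])
        fix Z c assume "elts (mkset (ap b ` elts (rar r))) \<subseteq> elts Z" and c: "maps c Z omega"
        then have bZ: "maps b (rar r) Z" using range_maps[OF b] unfolding elts_range by blast
        show "is_atomic S (?\<alpha> c) \<and> (\<forall>a. matching_A Z c a \<longrightarrow> \<not> at_sat A a (?\<alpha> c)) \<and>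
          (\<forall>i\<in>elts Idx. \<forall>e. matching Z c i e \<and> ?R i \<longrightarrow> at_sat (pfst i) e (?\<alpha> c))"
          using 1[OF bZ c] 2[OF bZ c] 3[OF bZ c] br by blast
      qed
    qed
  qed
qed

text \<open>The value of \<open>f\<close> at \<open>b\<close> is recorded by a flat equation true in
  \<open>A\<close>, which is the certificate. Its support consists of the entries of
  \<open>b\<close> and of the value itself.\<close>

lemma big_fun:
  assumes f: "f \<in> elts Fs" and b: "maps b (far f) CA"
  shows "big Idx Filt (\<lambda>i. ap (psnd i) (funs A \<cdot> f \<cdot> b) = ap (ap (funs (pfst i)) f) (lam (far f) (\<lambda>k. ap (psnd i) (ap b k))))"
proof -
  let ?y = "funs A \<cdot> f \<cdot> b"
  let ?R = "\<lambda>i. ap (psnd i) ?y = ap (ap (funs (pfst i)) f) (lam (far f) (\<lambda>k. ap (psnd i) (ap b k)))"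
  let ?\<alpha> = "\<lambda>c. Eq (Var (ap c ?y)) (Fn f (vars_of c (far f) b))"
  let ?Y = "ins ?y (mkset (ap b ` elts (far f)))"
  show ?thesis
  proof (rule bigI[where Y = ?Y and \<alpha> = ?\<alpha>])
    show "dfn (\<lambda>s. ?R (s 0))" by (intro D3)
    show "fin ?Y" by (intro fin_ins fin_range[OF far_omega[OF f] maps_func[OF b]])
    show "elts ?Y \<subseteq> elts CA" using range_CA[OF b] structureD(6)[OF A f b] unfolding elts_ins elts_range by simp
    fix Z c assume Y: "elts ?Y \<subseteq> elts Z" and Z: "elts Z \<subseteq> elts CA" and c: "maps c Z omega"
    have bZ: "maps b (far f) Z" using range_maps[OF b] Y unfolding elts_ins elts_range by blast
    have y: "?y \<in> elts Z" using Y by simp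
    have "at_sat A a (?\<alpha> c)" if m: "matching_A Z c a" for a
      using flat_fun[OF A matching_AD(1)[OF m] c matching_AD(2)[OF m] f bZ y] unfolding lam_ap_id[OF b] by blast
    moreover have "?R i" if i: "i \<in> elts Idx" and m: "matching Z c i e" and s: "at_sat (pfst i) e (?\<alpha> c)" for i e
    proof -
      have "maps (lam (far f) (\<lambda>k. ap (psnd i) (ap b k))) (far f) (carrier (pfst i))"
        using b IdxD(3)[OF i] by (intro maps_lam lam_okI D3) (auto simp: maps_ap)
      then show ?thesis
        using flat_fun[OF IdxD(2)[OF i] matchingD(1)[OF m] c matchingD(2)[OF m] f bZ y] s
          structureD(8)[OF IdxD(2)[OF i] f] by simp
    qed
    moreover have "is_atomic S (?\<alpha> c)"
      using c y Fn_in_terms[OF f vars_of_maps[OF c bZ]] by (intro atomic_Eq Var_in_terms) (auto simp: maps_ap)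
    ultimately show "is_atomic S (?\<alpha> c) \<and> (\<forall>a. matching_A Z c a \<longrightarrow> at_sat A a (?\<alpha> c)) \<and>
      (\<forall>i\<in>elts Idx. \<forall>e. matching Z c i e \<and> at_sat (pfst i) e (?\<alpha> c) \<longrightarrow> ?R i)" by blast
  qed
qed

text \<open>Read coordinatewise, the clauses of \<open>emb\<close> for the map into the reduced
  product become the statements \<open>big_eq\<close>, \<open>big_rel\<close> and
  \<open>big_fun\<close>. The reduced product lies in \<open>K\<close>, and closure under embeddings
  brings \<open>A\<close> into \<open>K\<close>.\<close>

lemma model_in_class: "A \<in> K"
proof -
  let ?P = "reduced_product S Idx Filt Fam"
  let ?ecl = "ecl Idx Filt Fam"
  have PK: "?P \<in> K"
    using rp ctxt IdxD(1) Fam_app unfolding closed_reduced_products_def by simp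
  define h where "h = lam CA (\<lambda>x. ?ecl (hat x))"
  have ok: "lam_ok CA (\<lambda>x. ?ecl (hat x))" by (intro lam_okI dft_ecl[OF ctxt] dft_hat D3)
  have h: "h \<cdot> x = ?ecl (hat x)" if "x \<in> elts CA" for x unfolding h_def by (rule lam_app[OF ok that])
  have u: "maps (lam n (\<lambda>k. hat (ap b k))) n (product Idx Fam)"
    and hu: "lam n (\<lambda>k. h \<cdot> (b \<cdot> k)) = lam n (\<lambda>k. ?ecl (lam n (\<lambda>k. hat (ap b k)) \<cdot> k))"
    and uk: "i \<in> elts Idx \<Longrightarrow> lam n (\<lambda>k. ap (ap (lam n (\<lambda>k. hat (ap b k))) k) i) = lam n (\<lambda>k. ap (psnd i) (ap b k))"
    if b: "maps b n CA" for b n i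
  proof -
    have oku: "lam_ok n (\<lambda>k. hat (ap b k))" by (intro lam_okI dft_hat D3)
    show "maps (lam n (\<lambda>k. hat (ap b k))) n (product Idx Fam)"
      using b hat_product by (intro maps_lam[OF oku]) (auto simp: maps_ap)
    show "lam n (\<lambda>k. h \<cdot> (b \<cdot> k)) = lam n (\<lambda>k. ?ecl (lam n (\<lambda>k. hat (ap b k)) \<cdot> k))"
      by (rule lam_cong) (simp add: lam_app[OF oku] h maps_app[OF b] maps_app_ap[OF b, symmetric])
    show "i \<in> elts Idx \<Longrightarrow> lam n (\<lambda>k. ap (ap (lam n (\<lambda>k. hat (ap b k))) k) i) = lam n (\<lambda>k. ap (psnd i) (ap b k))"
      by (rule lam_cong) (simp add: lam_ap[OF oku] hat_ap)
  qed
  have "emb h A ?P"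
    unfolding emb_def
  proof (intro conjI ballI allI impI)
    show "maps h CA (carrier ?P)"
      unfolding h_def using ecl_in_P[OF ctxt] hat_product by (intro maps_lam[OF ok]) blast
    show "x = y" if x: "x \<in> elts CA" and y: "y \<in> elts CA" and "h \<cdot> x = h \<cdot> y" for x y
    proof (rule big_eq[OF x y])
      have "big Idx Filt (\<lambda>i. ap (hat x) i = ap (hat y) i)"
        using that(3) ecl_eq_iff[OF ctxt hat_product[OF x] hat_product[OF y]] unfolding h[OF x] h[OF y] by blast
      moreover have "big Idx Filt (\<lambda>i. ap (hat x) i = ap (hat y) i) \<longleftrightarrow> big Idx Filt (\<lambda>i. ap (psnd i) x = ap (psnd i) y)"
        by (rule big_cong[OF ctxt]) (simp add: hat_ap)
      ultimately show "big Idx Filt (\<lambda>i. ap (psnd i) x = ap (psnd i) y)" by blast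
    qed
    show "b \<in> elts (rels A \<cdot> r) \<longleftrightarrow> lam (rar r) (\<lambda>k. h \<cdot> (b \<cdot> k)) \<in> elts (rels ?P \<cdot> r)"
      if r: "r \<in> elts Rs" and b: "maps b (rar r) CA" for r b
    proof -
      have "rel_big Idx Filt Fam r (lam (rar r) (\<lambda>k. hat (ap b k))) \<longleftrightarrow>
          big Idx Filt (\<lambda>i. lam (rar r) (\<lambda>k. ap (psnd i) (ap b k)) \<in> elts (ap (rels (pfst i)) r))"
        unfolding rel_big_def[OF ctxt] rar_ap[OF r, symmetric]
        by (rule big_cong[OF ctxt]) (simp add: uk[OF b] Fam_ap)
      then show ?thesis
        unfolding hu[OF b] rel_P_iff[OF ctxt r u[OF b]] big_rel[OF r b] by blast
    qed
    show "h \<cdot> (funs A \<cdot> f \<cdot> b) = funs ?P \<cdot> f \<cdot> lam (far f) (\<lambda>k. h \<cdot> (b \<cdot> k))"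
      if f: "f \<in> elts Fs" and b: "maps b (far f) CA" for f b
    proof -
      let ?u = "lam (far f) (\<lambda>k. hat (ap b k))"
      note y = structureD(6)[OF A f b]
      have "big Idx Filt (\<lambda>i. ap (hat (funs A \<cdot> f \<cdot> b)) i = ap (fval Idx Fam f ?u) i) \<longleftrightarrow>
        big Idx Filt (\<lambda>i. ap (psnd i) (funs A \<cdot> f \<cdot> b) = ap (ap (funs (pfst i)) f) (lam (far f) (\<lambda>k. ap (psnd i) (ap b k))))"
        by (rule big_cong[OF ctxt])
          (simp add: hat_ap fval_ap[OF ctxt] far_ap[OF f, symmetric] uk[OF b] Fam_ap)
      then have "?ecl (hat (funs A \<cdot> f \<cdot> b)) = ?ecl (fval Idx Fam f ?u)"
        using ecl_eq_iff[OF ctxt hat_product[OF y] fval_Pr[OF ctxt f u[OF b]]] big_fun[OF f b] by blast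
      then show ?thesis unfolding h[OF y] hu[OF b] fun_P_app[OF ctxt f u[OF b]] .
    qed
  qed
  then show ?thesis by (rule closed_emb[OF iso sub K PK A])
qed

end

section \<open>The equivalence for definable classes of structures\<close>

theorem horn_class_iff:
  assumes dK: "definable_class K" and K: "\<forall>A\<in>K. is_structure S A"
  shows "(\<exists>\<Gamma>. (\<forall>\<phi>\<in>elts \<Gamma>. is_basic_Horn S \<phi>) \<and> axiomatized_by S K \<Gamma>) \<longleftrightarrow>
    closed_isomorphisms S K \<and> closed_substructures S K \<and> closed_reduced_products S K"
proof
  assume "\<exists>\<Gamma>. (\<forall>\<phi>\<in>elts \<Gamma>. is_basic_Horn S \<phi>) \<and> axiomatized_by S K \<Gamma>"
  then show "closed_isomorphisms S K \<and> closed_substructures S K \<and> closed_reduced_products S K"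
    using horn_class_closed by blast
next
  assume c: "closed_isomorphisms S K \<and> closed_substructures S K \<and> closed_reduced_products S K"
  note dK' = dfn_class[OF dK]
  note \<Gamma> = elts_horn_theory[OF dK' K]
  have "axiomatized_by S K (horn_theory K)"
    unfolding axiomatized_by_def
  proof (intro equalityI subsetI CollectI)
    fix A assume "A \<in> K"
    then show "is_structure S A \<and> (\<forall>\<phi>\<in>elts (horn_theory K). models S A \<phi>)" using K unfolding \<Gamma> by blast
  next
    fix A assume "A \<in> {A. is_structure S A \<and> (\<forall>\<phi>\<in>elts (horn_theory K). models S A \<phi>)}"
    then show "A \<in> K" using model_in_class[OF _ _ _ dK' K] c by blast
  qed
  moreover have "\<forall>\<phi>\<in>elts (horn_theory K). is_basic_Horn S \<phi>" unfolding \<Gamma> by blast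
  ultimately show "\<exists>\<Gamma>. (\<forall>\<phi>\<in>elts \<Gamma>. is_basic_Horn S \<phi>) \<and> axiomatized_by S K \<Gamma>" by blast
qed

end

theorem theorem3p2:
  fixes mem :: "'v \<Rightarrow> 'v \<Rightarrow> bool" and S :: 'v and K :: "'v set"
  assumes "ZF_model mem"
    and "membership.is_signature mem S"
    and "membership.definable_class mem K"
    and "\<forall>A\<in>K. membership.is_structure mem S A"
  shows "(\<exists>\<Gamma>. (\<forall>\<phi>\<in>membership.elts mem \<Gamma>. membership.is_basic_Horn mem S \<phi>) \<and>
            membership.axiomatized_by mem S K \<Gamma>)
    \<longleftrightarrow> membership.closed_isomorphisms mem S K \<and>
        membership.closed_substructures mem S K \<and>
        membership.closed_reduced_products mem S K"
proof -
  interpret ZF_signature mem S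
    using assms(1,2) by (intro ZF_signature.intro ZF_signature_axioms.intro)
  show ?thesis by (rule horn_class_iff[OF assms(3,4)])
qed

end
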